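(* Let $d_1,d_2,\alpha,\beta$ be integers with $0\le\alpha<d_1$ and $0\le\beta<d_2$. Let $\mathcal{T}$ be a regular T-mesh without holes and with no vanished l-edges, and let $\mathcal{M}$ be its conformality conditions matrix (for the parameters $d_1,d_2,\alpha,\beta$). Then $$\dim\mathcal{S}(d_{1}, d_{2}, \alpha, \beta, \mathcal{T}) = (d_{1}+1)(d_{2}+1) + C^{h}(d_{1}+1)(d_{2}-\beta) + C^{v}(d_{2}+1)(d_{1}-\alpha) + V^{+}(d_{1}-\alpha)(d_{2}-\beta) + \dim\ker\mathcal{M},$$ where $C^h$ and $C^v$ are the numbers of horizontal and vertical cross-cuts of $\mathcal{T}$, $V^+$ is the number of free-vertices of $\mathcal{T}$, and $\ker\mathcal{M}$ is the solution space of $\mathcal{M}\mathbf{x}=0$.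
   Context: **T-meshes.** A T-mesh $\mathcal{T}$ is a finite collection of axis-aligned closed rectangles $F_i$ (faces, cells) in $\mathbb{R}^2$ with union the domain $\Omega$, such that distinct rectangles intersect only at points on their edges. The vertices of the rectangles are the vertices of $\mathcal{T}$; the line segment connecting two adjacent vertices on a grid line is an edge of $\mathcal{T}$. A T-junction is a vertex of one rectangle lying in the interior of a side of another rectangle. $\Omega$ need not be rectangular. $\mathcal{T}$ is regular if for each vertex the set of all rectangles containing it has connected interior. $\mathcal{T}$ is without holes if the (connected) domain $\Omega$ has no holes. A vertex is a boundary vertex if it lies on the boundary of $\Omega$, and an interior vertex otherwise. An edge lying on the boundary of $\Omega$ is a boundary edge; other edges are interior edges. **l-edges.** An l-edge is a maximal line segment composed of connected (collinear) interior edges; its two end points are T-junctions or boundary vertices. It is an interior l-edge if both end points are interior vertices, a cross-cut if both end points are boundary vertices, and a ray if exactly one end point is a boundary vertex. Each interior vertex lies on exactly one horizontal and one vertical l-edge. A free-vertex is an interior vertex for which both of these l-edges are cross-cuts or rays. The vertices on an l-edge are all mesh vertices lying on it, including its end points. **Vanished l-edges.** $N^h$ is the least integer $\ge \frac{d_1+1}{d_1-\alpha}$ and $N^v$ is the least integer $\ge\frac{d_2+1}{d_2-\beta}$. A horizontal (resp. vertical) interior l-edge is vanished if the number of vertices on it is less than $N^h$ (resp. $N^v$). **Spline space.** $\mathcal{S}(d_1,d_2,\alpha,\beta,\mathcal{T})$ is the real vector space of functions $f\in C^{\alpha,\beta}(\Omega)$ whose restriction to each cell of $\mathcal{T}$ is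 a polynomial of bi-degree $(d_1,d_2)$ (degree at most $d_1$ in $x$ and at most $d_2$ in $y$). Here $C^{\alpha,\beta}(\Omega)$ is the space of bivariate functions continuous of order $\alpha$ in the $x$ direction and of order $\beta$ in the $y$ direction; that is, the difference of the two polynomial pieces on the two sides of an interior edge is divisible by $(x-x_0)^{\alpha+1}$ if the edge lies on $x=x_0$, and by $(y-y_0)^{\beta+1}$ if it lies on $y=y_0$. **Conformality conditions matrix.** To each interior vertex $v=(x_v,y_v)$ that is not a free-vertex assign $(d_1-\alpha)(d_2-\beta)$ real unknowns $d_v^{p,q}$ (vertex cofactors), $0\le p\le d_1-\alpha-1$, $0\le q\le d_2-\beta-1$, and put $d_v(x,y)=\sum_{p,q} d_v^{p,q}(x-x_v)^p(y-y_v)^q$. For each horizontal interior l-edge $e$ impose the polynomial identity $\sum_{v\in e} d_v(x,y)(x-x_v)^{\alpha+1}=0$, which amounts to $(d_1+1)(d_2-\beta)$ scalar linear equations; for each vertical interior l-edge $e$ impose $\sum_{v\in e} d_v(x,y)(y-y_v)^{\beta+1}=0$, which amounts to $(d_2+1)(d_1-\alpha)$ scalar linear equations (sums over all vertices $v$ on $e$). The conformality conditions matrix $\mathcal{M}$ is the coefficient matrix of the resulting system $\mathcal{M}\mathbf{x}=0$, where $\mathbf{x}$ collects all the vertex cofactors. *)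

theory Defs
  imports
    "HOL-Analysis.Analysis"
    "HOL-Computational_Algebra.Polynomial"
    "HOL-Library.Function_Algebras"
begin

subsection \<open>Real-valued functions as a real vector space\<close>

instantiation "fun" :: (type, real_vector) real_vector
begin

definition scaleR_fun_def: "r *\<^sub>R f = (\<lambda>x. r *\<^sub>R f x)"

instance
  by standard
    (simp_all add: scaleR_fun_def plus_fun_def fun_eq_iff scaleR_add_right scaleR_add_left)

end


subsection \<open>T-meshes\<close>

type_synonym point = "real \<times> real"

text \<open>A cell is given by its lower left and its upper right corner.\<close>

type_synonym cell = "point \<times> point"

definition rect :: "cell \<Rightarrow> point set" where
  "rect F = cbox (fst F) (snd F)"

definition domain :: "cell set \<Rightarrow> point set" where
  "domain T = (\<Union>F\<in>T. rect F)"

definition t_mesh :: "cell set \<Rightarrow> bool" where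
  "t_mesh T \<longleftrightarrow> finite T \<and> T \<noteq> {} \<and>
     (\<forall>F\<in>T. fst (fst F) < fst (snd F) \<and> snd (fst F) < snd (snd F)) \<and>
     (\<forall>F\<in>T. \<forall>G\<in>T. F \<noteq> G \<longrightarrow>
        rect F \<inter> rect G \<subseteq> frontier (rect F) \<inter> frontier (rect G))"

definition corners :: "cell \<Rightarrow> point set" where
  "corners F = {fst (fst F), fst (snd F)} \<times> {snd (fst F), snd (snd F)}"

definition vertices :: "cell set \<Rightarrow> point set" where
  "vertices T = (\<Union>F\<in>T. corners F)"

definition interior_vertices :: "cell set \<Rightarrow> point set" where
  "interior_vertices T = {v \<in> vertices T. v \<notin> frontier (domain T)}"

definition boundary_vertices :: "cell set \<Rightarrow> point set" where
  "boundary_vertices T = {v \<in> vertices T. v \<in> frontier (domain T)}"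

definition regular :: "cell set \<Rightarrow> bool" where
  "regular T \<longleftrightarrow>
     (\<forall>v\<in>vertices T. connected (interior (\<Union>F\<in>{F\<in>T. v \<in> rect F}. rect F)))"

text \<open>A hole is a bounded component of the complement of the domain.\<close>

definition without_holes :: "cell set \<Rightarrow> bool" where
  "without_holes T \<longleftrightarrow> connected (domain T) \<and>
     (\<forall>C \<in> components (- domain T). \<not> bounded C)"


subsection \<open>Edges and l-edges\<close>

definition hsides :: "cell \<Rightarrow> point set set" where
  "hsides F = {{fst (fst F)..fst (snd F)} \<times> {y} | y. y \<in> {snd (fst F), snd (snd F)}}"

definition vsides :: "cell \<Rightarrow> point set set" where
  "vsides F = {{x} \<times> {snd (fst F)..snd (snd F)} | x. x \<in> {fst (fst F), fst (snd F)}}"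

text \<open>
  Two vertices are adjacent if no vertex lies strictly between them. The segment joining them is
  an edge if it is part of the grid, that is, if it lies on a side of some cell.
\<close>

definition hedges :: "cell set \<Rightarrow> point set set" where
  "hedges T = {closed_segment u w | u w. u \<in> vertices T \<and> w \<in> vertices T \<and> u \<noteq> w \<and>
     (\<exists>F\<in>T. \<exists>s\<in>hsides F. closed_segment u w \<subseteq> s) \<and>
     open_segment u w \<inter> vertices T = {}}"

definition vedges :: "cell set \<Rightarrow> point set set" where
  "vedges T = {closed_segment u w | u w. u \<in> vertices T \<and> w \<in> vertices T \<and> u \<noteq> w \<and>
     (\<exists>F\<in>T. \<exists>s\<in>vsides F. closed_segment u w \<subseteq> s) \<and>
     open_segment u w \<inter> vertices T = {}}"

definition interior_hedges :: "cell set \<Rightarrow> point set set" where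
  "interior_hedges T = {e \<in> hedges T. \<not> e \<subseteq> frontier (domain T)}"

definition interior_vedges :: "cell set \<Rightarrow> point set set" where
  "interior_vedges T = {e \<in> vedges T. \<not> e \<subseteq> frontier (domain T)}"

definition composite_segment :: "point set set \<Rightarrow> point set \<Rightarrow> bool" where
  "composite_segment E s \<longleftrightarrow>
     (\<exists>u w. s = closed_segment u w) \<and> (\<exists>A \<subseteq> E. s = \<Union>A)"

definition maximal_segments :: "point set set \<Rightarrow> point set set" where
  "maximal_segments E = {s. composite_segment E s \<and>
     (\<forall>s'. composite_segment E s' \<and> s \<subseteq> s' \<longrightarrow> s' = s)}"

definition hl_edges :: "cell set \<Rightarrow> point set set" where
  "hl_edges T = maximal_segments (interior_hedges T)"

definition vl_edges :: "cell set \<Rightarrow> point set set" where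
  "vl_edges T = maximal_segments (interior_vedges T)"

definition is_interior_l_edge :: "cell set \<Rightarrow> point set \<Rightarrow> bool" where
  "is_interior_l_edge T e \<longleftrightarrow>
     (\<exists>u w. e = closed_segment u w \<and> u \<in> interior_vertices T \<and> w \<in> interior_vertices T)"

definition is_cross_cut :: "cell set \<Rightarrow> point set \<Rightarrow> bool" where
  "is_cross_cut T e \<longleftrightarrow>
     (\<exists>u w. e = closed_segment u w \<and> u \<in> boundary_vertices T \<and> w \<in> boundary_vertices T)"

definition is_ray :: "cell set \<Rightarrow> point set \<Rightarrow> bool" where
  "is_ray T e \<longleftrightarrow>
     (\<exists>u w. e = closed_segment u w \<and> u \<in> boundary_vertices T \<and> w \<in> interior_vertices T)"

definition interior_hl_edges :: "cell set \<Rightarrow> point set set" where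
  "interior_hl_edges T = {e \<in> hl_edges T. is_interior_l_edge T e}"

definition interior_vl_edges :: "cell set \<Rightarrow> point set set" where
  "interior_vl_edges T = {e \<in> vl_edges T. is_interior_l_edge T e}"

definition hcross_cuts :: "cell set \<Rightarrow> point set set" where
  "hcross_cuts T = {e \<in> hl_edges T. is_cross_cut T e}"

definition vcross_cuts :: "cell set \<Rightarrow> point set set" where
  "vcross_cuts T = {e \<in> vl_edges T. is_cross_cut T e}"

definition free_vertices :: "cell set \<Rightarrow> point set" where
  "free_vertices T = {v \<in> interior_vertices T.
     (\<exists>e \<in> hl_edges T. v \<in> e \<and> (is_cross_cut T e \<or> is_ray T e)) \<and>
     (\<exists>e \<in> vl_edges T. v \<in> e \<and> (is_cross_cut T e \<or> is_ray T e))}"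

text \<open>
  The least number of vertices on a non-vanished l-edge, for degree \<open>d\<close> and smoothness \<open>a\<close> in the
  direction of the l-edge.
\<close>

definition vertex_threshold :: "nat \<Rightarrow> nat \<Rightarrow> int" where
  "vertex_threshold d a = \<lceil>(real d + 1) / (real d - real a)\<rceil>"

definition no_vanished_l_edges :: "nat \<Rightarrow> nat \<Rightarrow> nat \<Rightarrow> nat \<Rightarrow> cell set \<Rightarrow> bool" where
  "no_vanished_l_edges d1 d2 \<alpha> \<beta> T \<longleftrightarrow>
     (\<forall>e \<in> interior_hl_edges T. \<not> int (card (vertices T \<inter> e)) < vertex_threshold d1 \<alpha>) \<and>
     (\<forall>e \<in> interior_vl_edges T. \<not> int (card (vertices T \<inter> e)) < vertex_threshold d2 \<beta>)"


subsection \<open>Spline spaces\<close>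

text \<open>
  A bivariate polynomial is a polynomial in \<open>y\<close> whose coefficients are polynomials in \<open>x\<close>; so the
  coefficient of \<open>x ^ i * y ^ j\<close> in \<open>p\<close> is \<open>coeff (coeff p j) i\<close>.
\<close>

type_synonym bipoly = "real poly poly"

definition bieval :: "bipoly \<Rightarrow> point \<Rightarrow> real" where
  "bieval p z = poly (poly p [:snd z:]) (fst z)"

definition bidegree_le :: "nat \<Rightarrow> nat \<Rightarrow> bipoly \<Rightarrow> bool" where
  "bidegree_le d1 d2 p \<longleftrightarrow> degree p \<le> d2 \<and> (\<forall>j. degree (coeff p j) \<le> d1)"

text \<open>The polynomials \<open>x - c\<close> and \<open>y - c\<close>.\<close>

definition X_minus :: "real \<Rightarrow> bipoly" where
  "X_minus c = [:[:- c, 1:]:]"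

definition Y_minus :: "real \<Rightarrow> bipoly" where
  "Y_minus c = [:[:- c:], 1:]"

text \<open>
  A function on the domain is represented by a function on the plane vanishing outside the domain.
  The family \<open>P\<close> consists of the polynomial pieces of \<open>f\<close>.
\<close>

definition spline_space :: "nat \<Rightarrow> nat \<Rightarrow> nat \<Rightarrow> nat \<Rightarrow> cell set \<Rightarrow> (point \<Rightarrow> real) set" where
  "spline_space d1 d2 \<alpha> \<beta> T = {f.
     (\<forall>z. z \<notin> domain T \<longrightarrow> f z = 0) \<and>
     (\<exists>P :: cell \<Rightarrow> bipoly.
        (\<forall>F\<in>T. bidegree_le d1 d2 (P F) \<and> (\<forall>z\<in>rect F. f z = bieval (P F) z)) \<and>
        (\<forall>e\<in>interior_vedges T. \<forall>F\<in>T. \<forall>G\<in>T. \<forall>x0.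
           F \<noteq> G \<and> e \<subseteq> rect F \<and> e \<subseteq> rect G \<and> e \<subseteq> {z. fst z = x0}
             \<longrightarrow> X_minus x0 ^ (\<alpha> + 1) dvd P F - P G) \<and>
        (\<forall>e\<in>interior_hedges T. \<forall>F\<in>T. \<forall>G\<in>T. \<forall>y0.
           F \<noteq> G \<and> e \<subseteq> rect F \<and> e \<subseteq> rect G \<and> e \<subseteq> {z. snd z = y0}
             \<longrightarrow> Y_minus y0 ^ (\<beta> + 1) dvd P F - P G))}"


subsection \<open>The conformality conditions matrix\<close>

text \<open>
  Columns: the index \<open>(v, p, q)\<close> stands for the unknown \<open>d\<^sub>v\<^sup>p\<^sup>q\<close>, the coefficient of
  \<open>(x - x\<^sub>v) ^ p * (y - y\<^sub>v) ^ q\<close> in the vertex cofactor of \<open>v\<close>.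
  Rows: the index \<open>Inl (e, i, j)\<close> (horizontal l-edges) or \<open>Inr (e, i, j)\<close> (vertical l-edges)
  stands for the scalar equation which equates to zero the coefficient of \<open>x ^ i * y ^ j\<close>
  in the polynomial identity belonging to \<open>e\<close>. The vertices on a horizontal l-edge share their
  second coordinate, so that the left hand side of its identity has degree less than \<open>d2 - \<beta>\<close>
  in \<open>y\<close>, and no equation is missed; similarly for vertical l-edges.
\<close>

type_synonym mat_col = "point \<times> nat \<times> nat"
type_synonym mat_row = "(point set \<times> nat \<times> nat) + (point set \<times> nat \<times> nat)"

definition ccm_cols :: "nat \<Rightarrow> nat \<Rightarrow> nat \<Rightarrow> nat \<Rightarrow> cell set \<Rightarrow> mat_col set" where
  "ccm_cols d1 d2 \<alpha> \<beta> T =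
     (interior_vertices T - free_vertices T) \<times> {..<d1 - \<alpha>} \<times> {..<d2 - \<beta>}"

definition ccm_rows :: "nat \<Rightarrow> nat \<Rightarrow> nat \<Rightarrow> nat \<Rightarrow> cell set \<Rightarrow> mat_row set" where
  "ccm_rows d1 d2 \<alpha> \<beta> T =
     (interior_hl_edges T \<times> {..d1} \<times> {..<d2 - \<beta>}) <+>
     (interior_vl_edges T \<times> {..<d1 - \<alpha>} \<times> {..d2})"

fun ccm :: "nat \<Rightarrow> nat \<Rightarrow> mat_row \<Rightarrow> mat_col \<Rightarrow> real" where
  "ccm \<alpha> \<beta> (Inl (e, i, j)) (v, p, q) =
     (if v \<in> e
      then coeff (coeff (X_minus (fst v) ^ p * Y_minus (snd v) ^ q * X_minus (fst v) ^ (\<alpha> + 1)) j) i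
      else 0)"
| "ccm \<alpha> \<beta> (Inr (e, i, j)) (v, p, q) =
     (if v \<in> e
      then coeff (coeff (X_minus (fst v) ^ p * Y_minus (snd v) ^ q * Y_minus (snd v) ^ (\<beta> + 1)) j) i
      else 0)"

text \<open>The kernel of a matrix with row and column index sets \<open>R\<close> and \<open>C\<close>; vectors indexed by \<open>C\<close>
  are represented by functions vanishing outside \<open>C\<close>.\<close>

definition matrix_kernel :: "'r set \<Rightarrow> 'c set \<Rightarrow> ('r \<Rightarrow> 'c \<Rightarrow> real) \<Rightarrow> ('c \<Rightarrow> real) set" where
  "matrix_kernel R C M =
     {x. (\<forall>c. c \<notin> C \<longrightarrow> x c = 0) \<and> (\<forall>r\<in>R. (\<Sum>c\<in>C. M r c * x c) = 0)}"

definition ccm_kernel :: "nat \<Rightarrow> nat \<Rightarrow> nat \<Rightarrow> nat \<Rightarrow> cell set \<Rightarrow> (mat_col \<Rightarrow> real) set" where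
  "ccm_kernel d1 d2 \<alpha> \<beta> T =
     matrix_kernel (ccm_rows d1 d2 \<alpha> \<beta> T) (ccm_cols d1 d2 \<alpha> \<beta> T) (ccm \<alpha> \<beta>)"

end

theory Submission
  imports Defs
begin

text \<open>
  A spline is determined by its jumps. Across a horizontal edge on \<open>y = y\<^sub>0\<close> its pieces differ by
  \<open>h * (y - y\<^sub>0) ^ (\<beta> + 1)\<close>, across a vertical edge on \<open>x = x\<^sub>0\<close> by \<open>v * (x - x\<^sub>0) ^ (\<alpha> + 1)\<close>. Summing the
  jumps around an interior vertex gives
  \<open>(h\<^sub>E - h\<^sub>W) * (y - y\<^sub>0) ^ (\<beta> + 1) = (v\<^sub>N - v\<^sub>S) * (x - x\<^sub>0) ^ (\<alpha> + 1)\<close>, and coprimality yields the vertex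
  cofactor \<open>d\<close> with \<open>h\<^sub>E - h\<^sub>W = d * (x - x\<^sub>0) ^ (\<alpha> + 1)\<close> and \<open>v\<^sub>N - v\<^sub>S = d * (y - y\<^sub>0) ^ (\<beta> + 1)\<close>.
  Along an l-edge the edge cofactor is therefore recovered by summation: it vanishes beyond an interior
  end point, so that a ray imposes no condition on the vertex cofactors, an interior l-edge imposes one
  conformality condition, and a cross-cut leaves its initial edge cofactor free. Conversely, jumps that
  are curl-free at the interior vertices come from a spline because the domain is simply connected:
  continuous logarithms on the domain provide the necessary potentials.
\<close>

subsection \<open>Bivariate polynomials\<close>

text \<open>Cells meet at T-junctions and the domain may have any outline, so edges and vertices
  form no uniform structure. The mesh is therefore refined to the tensor grid of all its
  coordinates: a cell becomes a rectangle of index boxes, an edge cofactor a function on unit grid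
  segments that is 0 wherever no two cells are separated, and the smoothness conditions become
  difference equations. Rows and columns are integrated independently; what ties them together is
  that both use the same vertex cofactors. The resulting curl condition is known only at grid points
  with four covered boxes, while at the others the curl is arbitrary and must be absorbed before the
  jumps can be summed. Regularity serves to link boxes through sides rather than corners, both for
  gluing the pieces to one function and for carrying information across the domain. The parameters
  of a spline are the polynomial on one reference box, with \<open>(d1 + 1) * (d2 + 1)\<close>
  coefficients, the initial edge cofactors of the cross-cuts, the cofactors of the free-vertices,
  and a kernel vector. The last two are independent because no interior l-edge contains a
  free-vertex.\<close>

definition cst :: "real \<Rightarrow> bipoly" where "cst r = [:[:r:]:]"

lemma cst_simps [simp]: "cst 0 = 0" "cst 1 = 1" "cst (a + b) = cst a + cst b"
    "cst (a * b) = cst a * cst b" "cst a = 0 \<longleftrightarrow> a = 0"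
  by (simp_all add: cst_def one_pCons)

lemma bieval_simps [simp]:
  "bieval (p + q) z = bieval p z + bieval q z" "bieval (p - q) z = bieval p z - bieval q z"
  "bieval (p * q) z = bieval p z * bieval q z" "bieval 0 z = 0" "bieval (- p) z = - bieval p z"
  "bieval (cst r) z = r" "bieval (p ^ n) z = bieval p z ^ n"
  "bieval (X_minus a) z = fst z - a" "bieval (Y_minus a) z = snd z - a"
  by (simp_all add: bieval_def cst_def X_minus_def Y_minus_def)

section \<open>Bidegree bounds and cancellation of linear factors\<close>

lemma bidegree_le_0 [simp]: "bidegree_le k l 0"
  by (simp add: bidegree_le_def)

lemma bidegree_le_add: "bidegree_le k l p \<Longrightarrow> bidegree_le k l q \<Longrightarrow> bidegree_le k l (p + q)"
  by (simp add: bidegree_le_def degree_add_le)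

lemma bidegree_le_minus: "bidegree_le k l p \<Longrightarrow> bidegree_le k l (- p)"
  by (simp add: bidegree_le_def)

lemma bidegree_le_diff: "bidegree_le k l p \<Longrightarrow> bidegree_le k l q \<Longrightarrow> bidegree_le k l (p - q)"
  by (simp add: bidegree_le_def degree_diff_le)

lemma bidegree_le_sum: "(\<And>i. i \<in> I \<Longrightarrow> bidegree_le k l (p i)) \<Longrightarrow> bidegree_le k l (sum p I)"
  by (induction I rule: infinite_finite_induct) (auto intro: bidegree_le_add)

lemma bidegree_le_mono: "bidegree_le k l p \<Longrightarrow> k \<le> k' \<Longrightarrow> l \<le> l' \<Longrightarrow> bidegree_le k' l' p"
  by (auto simp: bidegree_le_def intro: order_trans)

lemma bidegree_le_mult:
  assumes "bidegree_le k l p" "bidegree_le k' l' q"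
  shows "bidegree_le (k + k') (l + l') (p * q)"
proof -
  have "degree (p * q) \<le> l + l'"
    using degree_mult_le[of p q] assms by (auto simp: bidegree_le_def)
  moreover have "degree (coeff (p * q) j) \<le> k + k'" for j
    unfolding coeff_mult
    by (intro degree_sum_le) (use assms in \<open>auto simp: bidegree_le_def intro!: order_trans[OF degree_mult_le] add_mono\<close>)
  ultimately show ?thesis by (simp add: bidegree_le_def)
qed

lemma bidegree_le_cst: "bidegree_le k l (cst r)"
  by (auto simp: bidegree_le_def cst_def coeff_pCons split: nat.splits)

lemma bidegree_le_X_minus_power: "bidegree_le n 0 (X_minus a ^ n)"
proof (induction n)
  case 0
  then show ?case using bidegree_le_cst[of 0 0 1] by simp
next
  case (Suc n)
  have "bidegree_le 1 0 (X_minus a)"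
    by (auto simp: bidegree_le_def X_minus_def coeff_pCons split: nat.splits)
  from bidegree_le_mult[OF this Suc] show ?case by simp
qed

lemma bidegree_le_Y_minus_power: "bidegree_le 0 n (Y_minus a ^ n)"
proof (induction n)
  case 0
  then show ?case using bidegree_le_cst[of 0 0 1] by simp
next
  case (Suc n)
  have "bidegree_le 0 1 (Y_minus a)"
    by (auto simp: bidegree_le_def Y_minus_def coeff_pCons split: nat.splits)
  from bidegree_le_mult[OF this Suc] show ?case by simp
qed

lemma X_minus_power: "X_minus a ^ n = [:[:- a, 1:] ^ n:]"
  by (induction n) (simp_all add: X_minus_def one_pCons)

lemma X_minus_power_neq_0 [simp]: "X_minus a ^ n \<noteq> 0"
  by (simp add: X_minus_power)

lemma Y_minus_power_neq_0 [simp]: "Y_minus a ^ n \<noteq> 0"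
  by (simp add: Y_minus_def)

lemma Y_minus_power_monic: "degree (Y_minus a ^ n) = n" "coeff (Y_minus a ^ n) n = 1"
proof -
  show *: "degree (Y_minus a ^ n) = n"
    by (subst degree_power_eq) (simp_all add: Y_minus_def)
  show "coeff (Y_minus a ^ n) n = 1"
    using lead_coeff_power[of "Y_minus a" n] unfolding * by (simp add: Y_minus_def)
qed

text \<open>Powers of x - a are constant in y, so multiplication acts on each y-coefficient
  separately and adds \<open>n\<close> to its degree.\<close>

lemma bidegree_le_X_minus_cancel:
  assumes "bidegree_le d1 d2 (p * X_minus a ^ n)" "n \<le> d1"
  shows "bidegree_le (d1 - n) d2 p"
proof -
  let ?q = "[:- a, 1:] ^ n"
  have q: "degree ?q = n" "?q \<noteq> 0"
    by (auto simp: degree_power_eq)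
  have eq: "p * X_minus a ^ n = smult ?q p"
    by (simp add: X_minus_power)
  have "degree (coeff p j) \<le> d1 - n" for j
  proof (cases "coeff p j = 0")
    case False
    have "degree (coeff p j) + n = degree (?q * coeff p j)"
      using False q by (subst degree_mult_eq) auto
    also have "\<dots> \<le> d1"
      using assms(1) unfolding eq bidegree_le_def by (metis coeff_smult)
    finally show ?thesis by simp
  qed auto
  moreover have "degree p \<le> d2"
    using assms(1) q(2) unfolding eq bidegree_le_def by auto
  ultimately show ?thesis by (auto simp: bidegree_le_def)
qed

text \<open>Comparing degrees in y gives the second bound. For the degree in x the recurrence
  \<open>coeff p j = coeff (p * Y_minus a) (Suc j) + [:a:] * coeff p (Suc j)\<close> recovers the
  coefficients from the top down.\<close>

lemma bidegree_le_Y_minus_cancel_aux: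
  assumes "bidegree_le d1 d2 (p * Y_minus a)"
  shows "bidegree_le d1 (d2 - 1) p"
proof (cases "p = 0")
  case False
  have eq: "p * Y_minus a = smult [:- a:] p + pCons 0 p"
    by (simp add: Y_minus_def mult.commute[of p])
  have "degree (p * Y_minus a) = degree p + 1"
    using False by (subst degree_mult_eq) (auto simp: Y_minus_def)
  then have 1: "degree p \<le> d2 - 1"
    using assms unfolding bidegree_le_def by linarith
  have "degree (coeff p j) \<le> d1" for j
  \<comment> \<open>Downward induction on \<open>j\<close>, starting beyond the degree, where the
    coefficients vanish.\<close>
  proof (induction "Suc (degree p) - j" arbitrary: j)
    case 0
    then show ?case by (simp add: coeff_eq_0)
  next
    case (Suc k)
    have IH: "degree (coeff p (Suc j)) \<le> d1" using Suc by auto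
    have "coeff (p * Y_minus a) (Suc j) = [:- a:] * coeff p (Suc j) + coeff p j"
      by (simp add: eq)
    then have "coeff p j = coeff (p * Y_minus a) (Suc j) - [:- a:] * coeff p (Suc j)"
      by simp
    moreover have "degree ([:- a:] * coeff p (Suc j)) \<le> d1"
      using IH degree_mult_le[of "[:- a:]" "coeff p (Suc j)"] by simp
    ultimately show ?case
      using assms by (metis bidegree_le_def degree_diff_le)
  qed
  then show ?thesis using 1 by (simp add: bidegree_le_def)
qed auto

lemma bidegree_le_Y_minus_cancel:
  assumes "bidegree_le d1 d2 (p * Y_minus a ^ n)"
  shows "bidegree_le d1 (d2 - n) p"
  using assms
proof (induction n arbitrary: d2)
  case (Suc n)
  have "bidegree_le d1 (d2 - 1) (p * Y_minus a ^ n)"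
    by (rule bidegree_le_Y_minus_cancel_aux[of _ _ _ a]) (use Suc.prems in \<open>simp add: ac_simps\<close>)
  from Suc.IH[OF this] show ?case by simp
qed auto

section \<open>Coprimality of x - a and y - b\<close>

lemma prime_elem_X_minus: "prime_elem (X_minus a)"
proof -
  have "prime_elem [:- a, 1:]"
    by (auto simp: prime_elem_def dvd_iff_poly_eq_0)
  then show ?thesis unfolding X_minus_def by (rule lift_prime_elem_poly)
qed

text \<open>A divisor that is constant in y divides every y-coefficient, but the leading coefficient
  of y - b is 1.\<close>

lemma not_X_minus_dvd_Y_minus: "\<not> X_minus a dvd Y_minus b"
proof
  assume "X_minus a dvd Y_minus b"
  then have "[:- a, 1:] dvd coeff (Y_minus b) 1"
    by (metis X_minus_def const_poly_dvd_iff)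
  then show False by (simp add: Y_minus_def dvd_iff_poly_eq_0)
qed

text \<open>By primality each factor x - a can only divide \<open>p\<close>, so the factors are
  split off one at a time.\<close>

lemma X_minus_power_dvd_cancel:
  assumes "X_minus a ^ m dvd p * Y_minus b ^ n"
  shows "X_minus a ^ m dvd p"
  using assms
proof (induction m arbitrary: p)
  case (Suc m)
  have "X_minus a dvd p * Y_minus b ^ n"
    using Suc.prems by (metis dvd_mult_left power_Suc)
  then have "X_minus a dvd p"
    using prime_elem_X_minus not_X_minus_dvd_Y_minus
    by (meson prime_elem_dvd_mult_iff prime_elem_dvd_power)
  then obtain q where q: "p = X_minus a * q" by (elim dvdE)
  have "X_minus a ^ m dvd q * Y_minus b ^ n"
    using Suc.prems X_minus_power_neq_0[of a 1] by (simp add: q mult.assoc)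
  then show ?case using Suc.IH[of q] by (simp add: q)
qed auto

text \<open>The power of x - a is coprime to that of y - b and so divides \<open>p\<close>;
  cancelling it from the equation shows that the quotient is the cofactor of \<open>q\<close> too.
  For the jumps around a grid point this quotient is the vertex cofactor.\<close>

lemma common_cofactor:
  assumes "p * Y_minus b ^ n = q * X_minus a ^ m"
  obtains d where "p = d * X_minus a ^ m" "q = d * Y_minus b ^ n"
proof -
  have "X_minus a ^ m dvd p"
    by (rule X_minus_power_dvd_cancel[of _ _ _ b n]) (simp add: assms)
  then obtain d where d: "p = d * X_minus a ^ m" by (metis dvdE mult.commute)
  have "q * X_minus a ^ m = (d * Y_minus b ^ n) * X_minus a ^ m"
    unfolding assms[symmetric] d by (simp add: ac_simps)
  then have "q = d * Y_minus b ^ n"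
    by (rule mult_right_cancel[OF X_minus_power_neq_0, THEN iffD1])
  with d show ?thesis by (rule that)
qed

text \<open>One expansion serves all parameters: around (a, b) for vertex cofactors, and around the
  origin for the reference polynomial and the initial edge cofactors.\<close>

definition cofactor_poly :: "real \<Rightarrow> real \<Rightarrow> nat \<Rightarrow> nat \<Rightarrow> (nat \<Rightarrow> nat \<Rightarrow> real) \<Rightarrow> bipoly" where
  "cofactor_poly a b k l g = (\<Sum>i<k. \<Sum>j<l. cst (g i j) * (X_minus a ^ i * Y_minus b ^ j))"

lemma cofactor_poly_add:
  "cofactor_poly a b k l (\<lambda>i j. f i j + g i j) = cofactor_poly a b k l f + cofactor_poly a b k l g"
  by (simp add: cofactor_poly_def algebra_simps sum.distrib)

lemma cofactor_poly_scale:
  "cofactor_poly a b k l (\<lambda>i j. r * g i j) = cst r * cofactor_poly a b k l g"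
  by (simp add: cofactor_poly_def algebra_simps sum_distrib_left)

lemma cofactor_poly_0 [simp]: "cofactor_poly a b k l (\<lambda>i j. 0) = 0"
  by (simp add: cofactor_poly_def)

text \<open>The truncated bounds also hold for \<open>k = 0\<close> or \<open>l = 0\<close>, where
  the sum is empty.\<close>

lemma bidegree_le_cofactor_poly: "bidegree_le (k - 1) (l - 1) (cofactor_poly a b k l g)"
  unfolding cofactor_poly_def
proof (intro bidegree_le_sum)
  fix i j assume "i \<in> {..<k}" "j \<in> {..<l}"
  then have "i \<le> k - 1" "j \<le> l - 1" by auto
  moreover have "bidegree_le (0 + (i + 0)) (0 + (0 + j)) (cst (g i j) * (X_minus a ^ i * Y_minus b ^ j))"
    by (intro bidegree_le_mult bidegree_le_cst bidegree_le_X_minus_power bidegree_le_Y_minus_power)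
  ultimately show "bidegree_le (k - 1) (l - 1) (cst (g i j) * (X_minus a ^ i * Y_minus b ^ j))"
    by (auto elim: bidegree_le_mono)
qed

text \<open>The powers of x - a are monic of increasing degree, so subtracting
  \<open>coeff p k\<close> times the top power lowers the degree. The alternative
  \<open>p = 0\<close> makes the case \<open>k = 0\<close> correct.\<close>

lemma shifted_powers_exist:
  fixes p :: "real poly"
  assumes "p = 0 \<or> degree p < k"
  shows "\<exists>c. p = (\<Sum>i<k. smult (c i) ([:- a, 1:] ^ i))"
  using assms
proof (induction k arbitrary: p)
  case (Suc k)
  let ?q = "[:- a, 1:] ^ k :: real poly"
  have q: "degree ?q = k" "coeff ?q k = 1"
    using lead_coeff_power[of "[:- a, 1:]" k] by (simp_all add: degree_power_eq)
  let ?p = "p - smult (coeff p k) ?q"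
  have "coeff ?p i = 0" if "i \<ge> k" for i
    using that Suc.prems q by (cases "i = k") (auto simp: coeff_eq_0)
  then have "?p = 0 \<or> degree ?p < k"
    by (metis leading_coeff_0_iff not_le)
  from Suc.IH[OF this] obtain c where c: "?p = (\<Sum>i<k. smult (c i) ([:- a, 1:] ^ i))" by blast
  have "p = (\<Sum>i<Suc k. smult ((c(k := coeff p k)) i) ([:- a, 1:] ^ i))"
    using c by (simp add: algebra_simps)
  then show ?case by blast
qed auto

text \<open>The coefficient of order \<open>k\<close> sees only the last summand. The coefficients
  range over an arbitrary domain because this is used twice: over the reals for powers of x - a, and
  over the polynomials in x for powers of y - b.\<close>

lemma smult_shifted_powers_eq_0:
  fixes c :: "nat \<Rightarrow> 'a::idom"
  assumes "(\<Sum>i<k. smult (c i) ([:- a, 1:] ^ i)) = 0" "i < k"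
  shows "c i = 0"
  using assms
proof (induction k)
  case (Suc k)
  have "c i * coeff ([:- a, 1:] ^ i) k = 0" if "i < k" for i
    using that by (auto simp: degree_power_eq intro!: coeff_eq_0)
  then have "(\<Sum>i<k. c i * coeff ([:- a, 1:] ^ i) k) = 0"
    by (intro sum.neutral) auto
  then have "coeff (\<Sum>i<Suc k. smult (c i) ([:- a, 1:] ^ i)) k = c k"
    using lead_coeff_power[of "[:- a, 1:]" k] by (simp add: coeff_sum degree_power_eq)
  then have ck: "c k = 0" using Suc.prems(1) by (metis coeff_0)
  then show ?case using Suc by (cases "i = k") auto
qed auto

text \<open>Grouping by powers of y - b fits the nested representation of \<open>bipoly\<close>, so
  that questions about two variables reduce to one variable twice.\<close>

lemma cofactor_poly_alt:
  "cofactor_poly a b k l g =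
     (\<Sum>j<l. smult (\<Sum>i<k. smult (g i j) ([:- a, 1:] ^ i)) ([:[:- b:], 1:] ^ j))"
proof -
  have "cst r * (X_minus a ^ i * Y_minus b ^ j) = smult (smult r ([:- a, 1:] ^ i)) ([:[:- b:], 1:] ^ j)"
    for r i j by (simp add: cst_def X_minus_power Y_minus_def)
  then have "cofactor_poly a b k l g =
      (\<Sum>i<k. \<Sum>j<l. smult (smult (g i j) ([:- a, 1:] ^ i)) ([:[:- b:], 1:] ^ j))"
    by (simp add: cofactor_poly_def)
  also have "\<dots> = (\<Sum>j<l. \<Sum>i<k. smult (smult (g i j) ([:- a, 1:] ^ i)) ([:[:- b:], 1:] ^ j))"
    by (rule sum.swap)
  finally show ?thesis by (simp add: smult_sum)
qed

lemma cofactor_poly_eq_0: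
  assumes "cofactor_poly a b k l g = 0" "i < k" "j < l"
  shows "g i j = 0"
proof -
  have "(\<Sum>i<k. smult (g i j) ([:- a, 1:] ^ i)) = 0"
    using smult_shifted_powers_eq_0[of "\<lambda>j. \<Sum>i<k. smult (g i j) ([:- a, 1:] ^ i)" "[:b:]" l j] assms
    by (simp add: cofactor_poly_alt)
  then show ?thesis using smult_shifted_powers_eq_0[of "\<lambda>i. g i j" a k i] assms by simp
qed

lemma cofactor_poly_exists:
  assumes "bidegree_le (k - 1) (l - 1) p" "0 < k" "0 < l"
  shows "\<exists>g. p = cofactor_poly a b k l g"
proof -
  \<comment> \<open>A strict degree bound, unlike one with \<open>l - 1\<close>, distinguishes
    \<open>l = 0\<close> from \<open>l = 1\<close> and so supports the induction on
    \<open>l\<close>.\<close>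
  have "\<exists>g. p = cofactor_poly a b k l g" if "p = 0 \<or> degree p < l" "\<And>j. degree (coeff p j) < k" for p l
    using that
  proof (induction l arbitrary: p)
    case 0
    then show ?case by (auto simp: cofactor_poly_def)
  next
    case (Suc l)
    let ?q = "Y_minus b ^ l" and ?c = "coeff p l"
    let ?p = "p - smult ?c ?q"
    have "coeff ?p i = 0" if "i \<ge> l" for i
      using that Suc.prems Y_minus_power_monic[of b l] by (cases "i = l") (auto simp: coeff_eq_0)
    then have 1: "?p = 0 \<or> degree ?p < l"
      by (metis leading_coeff_0_iff not_le)
    have 2: "degree (coeff ?p j) < k" for j
    proof -
      \<comment> \<open>The powers of y - b have constant coefficients, so subtracting
        \<open>smult ?c ?q\<close> keeps the degree in x below \<open>k\<close>.\<close>
      have "degree (coeff ?q j) = 0"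
        using bidegree_le_Y_minus_power[of l b] by (simp add: bidegree_le_def)
      then have "degree (?c * coeff ?q j) < k"
        using degree_mult_le[of ?c "coeff ?q j"] Suc.prems(2)[of l] by simp
      then show ?thesis
        using Suc.prems(2)[of j] by (simp add: degree_diff_less)
    qed
    from Suc.IH[OF 1 2] obtain g where g: "?p = cofactor_poly a b k l g" by blast
    obtain c where c: "?c = (\<Sum>i<k. smult (c i) ([:- a, 1:] ^ i))"
      using shifted_powers_exist[of ?c k a] Suc.prems(2)[of l] by blast
    have "p = cofactor_poly a b k l g + smult ?c ?q" using g by (simp add: algebra_simps)
    also have "\<dots> = cofactor_poly a b k (Suc l) (\<lambda>i j. if j = l then c i else g i j)"
      by (simp add: cofactor_poly_alt c Y_minus_def)
    finally show ?case by blast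
  qed
  moreover have "p = 0 \<or> degree p < l" "\<And>j. degree (coeff p j) < k"
  proof -
    show "p = 0 \<or> degree p < l" using assms unfolding bidegree_le_def by linarith
    fix j
    have "degree (coeff p j) \<le> k - 1" using assms unfolding bidegree_le_def by blast
    then show "degree (coeff p j) < k" using assms by linarith
  qed
  ultimately show ?thesis by blast
qed

subsection \<open>Dimension counting\<close>

text \<open>A linear relation instead of a linear map: the spline of given parameters is not constructed explicitly.\<close>

lemma dim_linear_relation:
  fixes A :: "'a::real_vector set" and B :: "'b::real_vector set" and R :: "'a \<Rightarrow> 'b \<Rightarrow> bool"
  assumes "subspace A"
    and total: "\<And>a. a \<in> A \<Longrightarrow> \<exists>b. R a b"
    and onto: "\<And>b. b \<in> B \<Longrightarrow> \<exists>a\<in>A. R a b"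
    and range: "\<And>a b. a \<in> A \<Longrightarrow> R a b \<Longrightarrow> b \<in> B"
    and add: "\<And>a b a' b'. R a b \<Longrightarrow> R a' b' \<Longrightarrow> R (a + a') (b + b')"
    and scale: "\<And>r a b. R a b \<Longrightarrow> R (r *\<^sub>R a) (r *\<^sub>R b)"
    and right_zero: "\<And>b. R 0 b \<Longrightarrow> b = 0"
    and left_zero: "\<And>a. a \<in> A \<Longrightarrow> R a 0 \<Longrightarrow> a = 0"
  shows "dim B = dim A"
proof -
  \<comment> \<open>Two values related to the same argument differ by something related to
    0.\<close>
  have unique: "b = b'" if "R a b" "R a b'" for a b b'
  proof -
    have "R (a + (-1) *\<^sub>R a) (b + (-1) *\<^sub>R b')" by (intro add scale that)
    then show ?thesis using right_zero by force
  qed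
  obtain C where C: "C \<subseteq> A" "independent C" "A \<subseteq> span C" "card C = dim A"
    by (rule basis_exists)
  have span_C: "span C = A"
    using C \<open>subspace A\<close> by (simp add: span_minimal subset_antisym)
  define g0 where "g0 a = (THE b. R a b)" for a
  have g0: "R a (g0 a)" if a: "a \<in> A" for a
  proof -
    obtain b where b: "R a b" using total[OF a] ..
    then have "(THE b. R a b) = b" by (intro the_equality unique)
    with b show ?thesis by (simp add: g0_def)
  qed
  \<comment> \<open>\<open>g0\<close> is only a choice of values. The linear \<open>g\<close> agrees
    with it on a basis, and since \<open>R\<close> is closed under linear combinations,
    \<open>g\<close> satisfies \<open>R\<close> on all of \<open>A\<close>.\<close>
  obtain g where g: "linear g" "\<And>c. c \<in> C \<Longrightarrow> g c = g0 c"
    using linear_independent_extend[OF C(2), of g0] by blast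
  interpret g: linear g by fact
  have R_g: "R a (g a)" if "a \<in> A" for a
  proof -
    have "a \<in> span C" using that span_C by simp
    then show ?thesis
    proof (induction rule: span_induct_alt)
      case base
      have "R 0 (g0 0)" using g0 subspace_0[OF \<open>subspace A\<close>] by blast
      then show ?case using right_zero[of "g0 0"] unfolding g.zero by simp
    next
      case (step c x y)
      have "R x (g x)" using g g0 C(1) step by auto
      then show ?case unfolding g.add g.scale by (intro add scale step)
    qed
  qed
  have image: "g ` A = B"
  proof (intro equalityI subsetI)
    fix b assume "b \<in> B"
    then obtain a where "a \<in> A" "R a b" using onto by blast
    then show "b \<in> g ` A" using unique[OF _ R_g] by blast
  qed (use R_g range in blast)
  have inj: "inj_on g A"
    unfolding linear_inj_on_iff_eq_0[OF g(1) \<open>subspace A\<close>]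
  proof (intro ballI impI)
    fix a assume a: "a \<in> A" "g a = 0"
    show "a = 0" by (rule left_zero[OF a(1)]) (use R_g[OF a(1)] a(2) in simp)
  qed
  have "independent (g ` C)"
    using linear_independent_injective_image[OF g(1) C(2)] inj span_C by simp
  moreover have "span (g ` C) = B"
    using linear_span_image[OF g(1), of C] span_C image by simp
  moreover have "card (g ` C) = card C"
    using card_image inj C(1) inj_on_subset by blast
  ultimately show ?thesis
    using dim_span_eq_card_independent[of "g ` C"] C(4) by simp
qed

text \<open>Bases of the two factors, embedded as (c, 0) and (0, d), combine to a basis. The finite
  spanning sets keep the bases finite; \<open>dim\<close> is 0 on infinite-dimensional spaces, so
  additivity could fail there.\<close>

lemma dim_subspace_Times:
  fixes A :: "'a::real_vector set" and B :: "'b::real_vector set"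
  assumes "subspace A" "subspace B"
    and "\<exists>U. finite U \<and> A \<subseteq> span U" "\<exists>V. finite V \<and> B \<subseteq> span V"
  shows "dim (A \<times> B) = dim A + dim B"
proof -
  obtain U V where UV: "finite U" "A \<subseteq> span U" "finite V" "B \<subseteq> span V" using assms(3,4) by blast
  obtain C where C: "C \<subseteq> A" "independent C" "A \<subseteq> span C" "card C = dim A"
    by (rule basis_exists)
  obtain D where D: "D \<subseteq> B" "independent D" "B \<subseteq> span D" "card D = dim B"
    by (rule basis_exists)
  have fin: "finite C" "finite D"
    using independent_span_bound[OF UV(1) C(2)] independent_span_bound[OF UV(3) D(2)] C D UV
    by auto
  have span: "span C = A" "span D = B"
    by (intro subset_antisym span_minimal C D assms)+
  let ?i = "\<lambda>a. (a, 0) :: 'a \<times> 'b" and ?j = "\<lambda>b. (0, b) :: 'a \<times> 'b"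
  have lin: "linear ?i" "linear ?j"
    by (auto intro!: linearI)
  let ?E = "?i ` C \<union> ?j ` D"
  have span_E: "span ?E = A \<times> B"
    unfolding span_Un linear_span_image[OF lin(1)] linear_span_image[OF lin(2)] span
  proof (intro equalityI subsetI)
    fix z assume "z \<in> A \<times> B"
    then have "z = ?i (fst z) + ?j (snd z)" "?i (fst z) \<in> ?i ` A" "?j (snd z) \<in> ?j ` B" by auto
    then show "z \<in> {x + y |x y. x \<in> ?i ` A \<and> y \<in> ?j ` B}" by blast
  qed auto
  have disj: "?i ` C \<inter> ?j ` D = {}"
  proof -
    \<comment> \<open>The two embeddings share only the zero vector, which no independent set
      contains.\<close>
    have "0 \<notin> C" using C(2) dependent_zero by blast
    then show ?thesis by auto
  qed
  have card: "card ?E = card C + card D"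
    using fin disj by (subst card_Un_disjoint) (auto simp: card_image inj_on_def)
  have "independent ?E"
  proof (rule independent_if_scalars_zero)
    show "finite ?E" using fin by simp
    fix f x assume sum: "(\<Sum>x\<in>?E. f x *\<^sub>R x) = 0" and x: "x \<in> ?E"
    have "(\<Sum>x\<in>?E. f x *\<^sub>R x) = (\<Sum>c\<in>C. f (?i c) *\<^sub>R ?i c) + (\<Sum>d\<in>D. f (?j d) *\<^sub>R ?j d)"
      using fin disj by (subst sum.union_disjoint) (auto simp: sum.reindex inj_on_def)
    also have "\<dots> = ((\<Sum>c\<in>C. f (?i c) *\<^sub>R c), (\<Sum>d\<in>D. f (?j d) *\<^sub>R d))"
      by (simp add: sum_prod[symmetric] scaleR_prod_def prod_eq_iff fst_sum snd_sum)
    finally have "(\<Sum>c\<in>C. f (?i c) *\<^sub>R c) = 0" "(\<Sum>d\<in>D. f (?j d) *\<^sub>R d) = 0"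
      using sum by (simp_all add: zero_prod_def)
    then have "\<forall>c\<in>C. f (?i c) = 0" "\<forall>d\<in>D. f (?j d) = 0"
      using independentD[OF C(2) fin(1), of "\<lambda>c. f (?i c)"]
        independentD[OF D(2) fin(2), of "\<lambda>d. f (?j d)"] by auto
    then show "f x = 0" using x by auto
  qed
  then show ?thesis
    using dim_span_eq_card_independent[of ?E] span_E card C(4) D(4) by simp
qed

lemma finite_span_Times:
  fixes A :: "'a::real_vector set" and B :: "'b::real_vector set"
  assumes "\<exists>U. finite U \<and> A \<subseteq> span U" "\<exists>V. finite V \<and> B \<subseteq> span V"
  shows "\<exists>W. finite W \<and> A \<times> B \<subseteq> span W"
proof -
  let ?i = "\<lambda>a. (a, 0) :: 'a \<times> 'b" and ?j = "\<lambda>b. (0, b) :: 'a \<times> 'b"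
  obtain U V where UV: "finite U" "A \<subseteq> span U" "finite V" "B \<subseteq> span V" using assms by blast
  have lin: "linear ?i" "linear ?j" by (auto intro!: linearI)
  have "(a, b) \<in> span (?i ` U \<union> ?j ` V)" if "a \<in> A" "b \<in> B" for a b
  proof -
    have "?i a \<in> span (?i ` U)" unfolding linear_span_image[OF lin(1)] using that UV by blast
    moreover have "?j b \<in> span (?j ` V)" unfolding linear_span_image[OF lin(2)] using that UV by blast
    ultimately have "?i a + ?j b \<in> span (?i ` U \<union> ?j ` V)"
      by (intro span_add) (meson span_mono subsetD sup_ge1 sup_ge2)+
    then show ?thesis by simp
  qed
  then show ?thesis using UV by (intro exI[of _ "?i ` U \<union> ?j ` V"]) auto
qed

section \<open>Spaces of functions on a finite index set\<close>

definition supported_on :: "'i set \<Rightarrow> ('i \<Rightarrow> real) set" where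
  "supported_on I = {x. \<forall>i. i \<notin> I \<longrightarrow> x i = 0}"

lemma supported_onD: "f \<in> supported_on I \<Longrightarrow> i \<notin> I \<Longrightarrow> f i = 0"
  by (simp add: supported_on_def)

lemma subspace_supported_on: "subspace (supported_on I)"
  by (rule subspaceI) (auto simp: supported_on_def scaleR_fun_def)

definition unit_fun :: "'i \<Rightarrow> 'i \<Rightarrow> real" where
  "unit_fun i = (\<lambda>k. if k = i then 1 else 0)"

lemma supported_on_expand:
  assumes "finite I" "x \<in> supported_on I"
  shows "x = (\<Sum>i\<in>I. x i *\<^sub>R unit_fun i)"
proof
  fix k
  have sum_apply: "(\<Sum>i\<in>J. f i) k = (\<Sum>i\<in>J. f i k)" for J and f :: "'a \<Rightarrow> 'a \<Rightarrow> real"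
    by (induction J rule: infinite_finite_induct) auto
  show "x k = (\<Sum>i\<in>I. x i *\<^sub>R unit_fun i) k"
    unfolding sum_apply using assms
    by (auto simp: scaleR_fun_def unit_fun_def supported_on_def if_distrib[of "\<lambda>r. _ * r"] cong: if_cong)
qed

lemma span_unit_funs:
  assumes "finite I"
  shows "span (unit_fun ` I) = supported_on I"
proof
  show "span (unit_fun ` I) \<subseteq> supported_on I"
    by (rule span_minimal[OF _ subspace_supported_on]) (auto simp: supported_on_def unit_fun_def)
  show "supported_on I \<subseteq> span (unit_fun ` I)"
  proof
    fix x assume "x \<in> supported_on I"
    then have x: "x = (\<Sum>i\<in>I. x i *\<^sub>R unit_fun i)" by (rule supported_on_expand[OF assms])
    show "x \<in> span (unit_fun ` I)"
      by (subst x) (intro span_sum span_scale span_base imageI)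
  qed
qed

lemma finite_span_supported_on:
  assumes "finite I"
  shows "\<exists>U. finite U \<and> supported_on I \<subseteq> span U"
  using span_unit_funs[OF assms] assms by (intro exI[of _ "unit_fun ` I"]) auto

lemma dim_supported_on:
  assumes "finite I"
  shows "dim (supported_on I) = card I"
proof -
  have inj: "inj_on unit_fun I"
  proof (rule inj_onI)
    fix i k :: 'a assume "unit_fun i = unit_fun k"
    then have "unit_fun i k = unit_fun k k" by (rule fun_cong)
    then show "i = k" by (simp add: unit_fun_def split: if_splits)
  qed
  have "independent (unit_fun ` I)"
  proof (rule independent_if_scalars_zero)
    show "finite (unit_fun ` I)" using assms by simp
    fix f :: "('a \<Rightarrow> real) \<Rightarrow> real" and x
    assume sum: "(\<Sum>x\<in>unit_fun ` I. f x *\<^sub>R x) = 0" and "x \<in> unit_fun ` I"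
    then obtain i where i: "i \<in> I" "x = unit_fun i" by blast
    \<comment> \<open>The coefficients are read as a vector supported on \<open>I\<close>; its
      expansion into unit functions is the vanishing combination, so the vector is 0.\<close>
    let ?g = "\<lambda>i. if i \<in> I then f (unit_fun i) else 0"
    have "?g = (\<Sum>i\<in>I. ?g i *\<^sub>R unit_fun i)"
      by (rule supported_on_expand[OF assms]) (simp add: supported_on_def)
    also have "\<dots> = 0"
      using sum by (simp add: sum.reindex[OF inj])
    finally have "?g i = (0 :: 'a \<Rightarrow> real) i" by (rule fun_cong)
    then show "f x = 0" using i by simp
  qed
  then show ?thesis
    using dim_span_eq_card_independent[of "unit_fun ` I"] span_unit_funs[OF assms] card_image[OF inj]
    by simp
qed

subsection \<open>Index meshes\<close>

lemma sum_split_last: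
  fixes f :: "nat \<Rightarrow> 'a::ab_group_add"
  shows "1 \<le> i \<Longrightarrow> p \<le> i \<Longrightarrow> (\<Sum>k=p..i. f k) = f i + (\<Sum>k=p..i-1. f k)"
  by (cases i) (auto simp: add.commute)

text \<open>
  A mesh on a rectangular grid: the cell \<open>F\<close> consists of the grid boxes \<open>(i, j)\<close> with
  \<open>left F \<le> i < right F\<close> and \<open>low F \<le> j < up F\<close>, and the grid point \<open>(i, j)\<close> is the lower left corner
  of the box \<open>(i, j)\<close>. The boxes with \<open>i = 0\<close> or \<open>j = 0\<close> are empty, so that the truncated differences
  \<open>i - 1\<close> and \<open>j - 1\<close> do no harm. The grid segment from \<open>(i, j)\<close> to \<open>(i + 1, j)\<close> is active if it separates
  two cells; the maximal runs of active segments are the horizontal l-edges. Vertical l-edges are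
  obtained from the transposed mesh \<open>tr\<close>.
\<close>

locale index_mesh =
  fixes T :: "'c set" and left right low up :: "'c \<Rightarrow> nat"
  assumes finite_cells: "finite T"
    and left_right: "F \<in> T \<Longrightarrow> 1 \<le> left F \<and> left F < right F"
    and low_up: "F \<in> T \<Longrightarrow> 1 \<le> low F \<and> low F < up F"
    and cells_disjoint: "F \<in> T \<Longrightarrow> G \<in> T \<Longrightarrow> left F \<le> i \<Longrightarrow> i < right F \<Longrightarrow> low F \<le> j \<Longrightarrow> j < up F \<Longrightarrow>
      left G \<le> i \<Longrightarrow> i < right G \<Longrightarrow> low G \<le> j \<Longrightarrow> j < up G \<Longrightarrow> F = G"
begin

definition covers :: "'c \<Rightarrow> nat \<Rightarrow> nat \<Rightarrow> bool" where
  "covers F i j \<longleftrightarrow> F \<in> T \<and> left F \<le> i \<and> i < right F \<and> low F \<le> j \<and> j < up F"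

definition covered :: "nat \<Rightarrow> nat \<Rightarrow> bool" where
  "covered i j \<longleftrightarrow> (\<exists>F. covers F i j)"

definition active :: "nat \<Rightarrow> nat \<Rightarrow> bool" where
  "active i j \<longleftrightarrow> (\<exists>F G. covers F i j \<and> covers G i (j - 1) \<and> F \<noteq> G)"

text \<open>The combinatorial form of an interior point of the domain;
  \<open>inner_point_iff\<close> relates the two.\<close>

definition inner_point :: "nat \<Rightarrow> nat \<Rightarrow> bool" where
  "inner_point i j \<longleftrightarrow> covered i j \<and> covered (i - 1) j \<and> covered i (j - 1) \<and> covered (i - 1) (j - 1)"

definition vertex :: "nat \<Rightarrow> nat \<Rightarrow> bool" where
  "vertex i j \<longleftrightarrow> (\<exists>F\<in>T. (i = left F \<or> i = right F) \<and> (j = low F \<or> j = up F))"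

definition run :: "nat \<Rightarrow> nat \<Rightarrow> nat \<Rightarrow> bool" where
  "run p q j \<longleftrightarrow> p < q \<and> (\<forall>k. p \<le> k \<and> k < q \<longrightarrow> active k j) \<and> \<not> active (p - 1) j \<and> \<not> active q j"

sublocale tr: index_mesh T low up left right
  by unfold_locales (use finite_cells left_right low_up cells_disjoint in auto)

lemma tr_covers: "tr.covers F i j \<longleftrightarrow> covers F j i"
  by (auto simp: covers_def tr.covers_def)

lemma tr_covered: "tr.covered i j \<longleftrightarrow> covered j i"
  by (simp add: covered_def tr.covered_def tr_covers)

lemma tr_inner: "tr.inner_point i j \<longleftrightarrow> inner_point j i"
  by (auto simp: inner_point_def tr.inner_point_def tr_covered)

lemma tr_vertex: "tr.vertex i j \<longleftrightarrow> vertex j i"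
  by (auto simp: vertex_def tr.vertex_def)

lemma vertexI: "F \<in> T \<Longrightarrow> i = left F \<or> i = right F \<Longrightarrow> j = low F \<or> j = up F \<Longrightarrow> vertex i j"
  unfolding vertex_def by blast

lemma coversI: "F \<in> T \<Longrightarrow> left F \<le> i \<Longrightarrow> i < right F \<Longrightarrow> low F \<le> j \<Longrightarrow> j < up F \<Longrightarrow> covers F i j"
  by (simp add: covers_def)

lemma activeI: "covers F i j \<Longrightarrow> covers G i (j - 1) \<Longrightarrow> F \<noteq> G \<Longrightarrow> active i j"
  unfolding active_def by blast

lemma covers_unique: "covers F i j \<Longrightarrow> covers G i j \<Longrightarrow> F = G"
  unfolding covers_def using cells_disjoint by blast

lemma covers_pos: "covers F i j \<Longrightarrow> 1 \<le> i \<and> 1 \<le> j"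
  unfolding covers_def using left_right low_up by fastforce

lemma covered_pos: "covered i j \<Longrightarrow> 1 \<le> i \<and> 1 \<le> j"
  unfolding covered_def using covers_pos by blast

lemma vertex_pos: "vertex i j \<Longrightarrow> 1 \<le> i \<and> 1 \<le> j"
  unfolding vertex_def using left_right low_up by fastforce

lemma inner_pos: "inner_point i j \<Longrightarrow> 2 \<le> i \<and> 2 \<le> j"
  unfolding inner_point_def using covered_pos[of "i - 1" "j - 1"] by auto

lemma active_covered: "active i j \<Longrightarrow> covered i j \<and> covered i (j - 1)"
  by (auto simp: active_def covered_def)

lemma active_pos: "active i j \<Longrightarrow> 1 \<le> i \<and> 2 \<le> j"
  using active_covered[of i j] covered_pos[of i j] covered_pos[of i "j - 1"] by auto

lemma covers_same_if_not_active:
  "\<not> active i j \<Longrightarrow> covers F i j \<Longrightarrow> covers G i (j - 1) \<Longrightarrow> F = G"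
  by (auto simp: active_def)

lemma active_above_below:
  assumes "covers F i j" "covers G i (j - 1)" "F \<noteq> G"
  shows "low F = j" "up G = j"
proof -
  have j: "1 \<le> j - 1" using covers_pos assms by blast
  show "low F = j"
  proof (rule ccontr)
    assume "low F \<noteq> j"
    then have "covers F i (j - 1)" using assms(1) j by (auto simp: covers_def)
    then show False using covers_unique assms by blast
  qed
  show "up G = j"
  proof (rule ccontr)
    assume "up G \<noteq> j"
    then have "covers G i j" using assms(2) j by (auto simp: covers_def)
    then show False using covers_unique assms by blast
  qed
qed

text \<open>Over one of the two segments the line \<open>j\<close> carries a side of a cell
  \<open>F\<close> above and of a cell \<open>G\<close> below. As (i, j) is a corner of neither,
  both cells continue past column \<open>i\<close>: the line goes on and nothing crosses it
  there.\<close>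

lemma active_not_vertex:
  assumes "active i j \<or> active (i - 1) j" "\<not> vertex i j" "1 \<le> i"
  obtains F G where "covers F i j" "covers F (i - 1) j" "covers G i (j - 1)" "covers G (i - 1) (j - 1)" "F \<noteq> G"
proof -
  define k where "k = (if active i j then i else i - 1)"
  have k0: "k = i \<or> k = i - 1" "active k j"
    using assms(1) by (auto simp: k_def)
  obtain F G where FG: "covers F k j" "covers G k (j - 1)" "F \<noteq> G"
    using k0(2) unfolding active_def by blast
  note k = k0(1) FG
  note * = active_above_below[OF k(2-4)]
  have FT: "F \<in> T" "G \<in> T" using k(2,3) by (simp_all add: covers_def)
  have "\<not> (i = left F \<or> i = right F)" "\<not> (i = left G \<or> i = right G)"
    using vertexI[OF FT(1), of i j] vertexI[OF FT(2), of i j] assms(2) * by auto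
  moreover have "left F \<le> k" "k < right F" "low F \<le> j" "j < up F"
    "left G \<le> k" "k < right G" "low G \<le> j - 1" "j - 1 < up G"
    using k(2,3) by (simp_all add: covers_def)
  moreover have "k = i \<or> k + 1 = i" using k(1) assms(3) by auto
  ultimately have "left F \<le> i - 1" "left F \<le> i" "i < right F" "i - 1 < right F"
    "left G \<le> i - 1" "left G \<le> i" "i < right G" "i - 1 < right G"
    by arith+
  then have "covers F i j" "covers F (i - 1) j" "covers G i (j - 1)" "covers G (i - 1) (j - 1)"
    using k(2,3) by (simp_all add: covers_def)
  then show ?thesis by (rule that) (rule k(4))
qed

lemma vertex_if_active_changes:
  assumes "active i j \<noteq> active (i - 1) j" "1 \<le> i"
  shows "vertex i j"
proof (rule ccontr)
  assume "\<not> vertex i j"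
  have "active i j \<or> active (i - 1) j" using assms(1) by blast
  then obtain F G where "covers F i j" "covers F (i - 1) j" "covers G i (j - 1)" "covers G (i - 1) (j - 1)" "F \<noteq> G"
    by (rule active_not_vertex[OF _ \<open>\<not> vertex i j\<close> assms(2)])
  then have "active i j \<and> active (i - 1) j" using activeI by blast
  with assms show False by simp
qed

text \<open>A cell \<open>F\<close> with a corner at the point has a horizontal side starting there.
  In the box column of that side the boxes above and below the line belong to different cells, since
  one of them belongs to \<open>F\<close>, which does not cross the line.\<close>

lemma inner_vertex_active:
  assumes "vertex i j" "inner_point i j"
  shows "active i j \<or> active (i - 1) j"
proof -
  have pos: "2 \<le> i" "2 \<le> j" using inner_pos[OF assms(2)] by auto
  obtain F where F: "F \<in> T" "i = left F \<or> i = right F" "j = low F \<or> j = up F"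
    using assms(1)[unfolded vertex_def] by (elim bexE conjE) (rule that)
  \<comment> \<open>The column of boxes next to the point in which \<open>F\<close> lies.\<close>
  define k where "k = (if i = left F then i else i - 1)"
  have k: "left F \<le> k" "k < right F" "k = i \<or> k = i - 1"
    using F(2) left_right[OF F(1)] by (cases "i = left F"; simp add: k_def; linarith)+
  obtain A B where AB: "covers A k j" "covers B k (j - 1)"
  proof -
    have "covered k j" "covered k (j - 1)" using assms(2) k(3) by (auto simp: inner_point_def)
    then show ?thesis using that unfolding covered_def by (elim exE)
  qed
  have "A \<noteq> B"
  proof
    assume "A = B"
    then have "low A < j" "j < up A" using AB pos by (auto simp: covers_def)
    moreover have "A = F"
    proof (cases "j = low F")
      case True
      then have "covers F k j" using F(1) k(1,2) low_up[OF F(1)] by (intro coversI) linarith+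
      then show ?thesis using covers_unique AB by blast
    next
      case False
      then have "j = up F" using F(3) by simp
      then have "covers F k (j - 1)" using F(1) k(1,2) low_up[OF F(1)] by (intro coversI) linarith+
      then show ?thesis using covers_unique AB \<open>A = B\<close> by blast
    qed
    ultimately show False using F(3) by auto
  qed
  then have "active k j" using AB by (intro activeI)
  then show ?thesis using k(3) by (elim disjE) simp_all
qed

lemma covers_bound: "\<exists>M. \<forall>F i j. covers F i j \<longrightarrow> i < M \<and> j < M"
proof -
  obtain M where M: "\<forall>n\<in>(\<lambda>F. right F + up F) ` T. n < M"
    using finite_nat_set_iff_bounded finite_cells by blast
  have "i < M \<and> j < M" if "covers F i j" for F i j
  proof -
    have F: "F \<in> T" "i < right F" "j < up F" using that by (simp_all add: covers_def)
    have "right F + up F < M" using M F(1) by blast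
    then show ?thesis using F by linarith
  qed
  then show ?thesis by blast
qed

lemma active_bound: "\<exists>M. \<forall>i j. active i j \<longrightarrow> i < M \<and> j < M"
  using covers_bound unfolding active_def by blast

section \<open>Maximal runs of active segments\<close>

lemma run_active: "run p q j \<Longrightarrow> p \<le> k \<Longrightarrow> k < q \<Longrightarrow> active k j"
  by (simp add: run_def)

text \<open>Activity is bounded, so extending the segment to the right stops at a first inactive
  index; to the left there is a least index from which all segments are active.\<close>

lemma run_exists:
  assumes "active k j"
  obtains p q where "run p q j" "p \<le> k" "k < q"
proof -
  obtain M where M: "\<And>i. active i j \<Longrightarrow> i < M" using active_bound by blast
  define q where "q = (LEAST q. k < q \<and> \<not> active q j)"
  have ex: "k < M \<and> \<not> active M j" using M assms by blast
  then have q: "k < q" "\<not> active q j" unfolding q_def using LeastI[of "\<lambda>q. k < q \<and> \<not> active q j" M] by blast+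
  have q': "active i j" if "k < i" "i < q" for i
    using that(1) not_less_Least[OF that(2)[unfolded q_def]] by blast
  define p where "p = (LEAST p. p \<le> k \<and> (\<forall>i. p \<le> i \<and> i \<le> k \<longrightarrow> active i j))"
  have "k \<le> k \<and> (\<forall>i. k \<le> i \<and> i \<le> k \<longrightarrow> active i j)" using assms by auto
  then have p: "p \<le> k \<and> (\<forall>i. p \<le> i \<and> i \<le> k \<longrightarrow> active i j)"
    unfolding p_def by (rule LeastI)
  \<comment> \<open>Active indices are positive, so \<open>p - 1\<close> is a genuine predecessor
    and would contradict the minimality of \<open>p\<close>.\<close>
  have "\<not> active (p - 1) j"
  proof
    assume a: "active (p - 1) j"
    then have pos: "1 \<le> p - 1" using active_pos by blast
    have "p - 1 \<le> k \<and> (\<forall>i. p - 1 \<le> i \<and> i \<le> k \<longrightarrow> active i j)"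
    proof -
      have "active i j" if "p - 1 \<le> i" "i \<le> k" for i
        using that a p by (cases "i = p - 1") auto
      then show ?thesis using p by auto
    qed
    then have "(LEAST p. p \<le> k \<and> (\<forall>i. p \<le> i \<and> i \<le> k \<longrightarrow> active i j)) \<le> p - 1" by (rule Least_le)
    then have "p \<le> p - 1" by (simp only: p_def[symmetric])
    then show False using pos by linarith
  qed
  moreover have "active i j" if "p \<le> i" "i < q" for i
    using that p q' by (cases "i \<le> k") auto
  ultimately have "run p q j" using p q by (auto simp: run_def)
  then show ?thesis using that p q by blast
qed

text \<open>The bounds on \<open>k\<close> are weak: even runs sharing just an end point coincide,
  since the segment beyond an end of a run is inactive. Hence a grid point lies on at most one
  horizontal l-edge.\<close>

lemma run_unique:
  assumes "run p q j" "run p' q' j" "p \<le> k" "k \<le> q" "p' \<le> k" "k \<le> q'"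
  shows "p' = p \<and> q' = q"
proof -
  note r = assms(1,2)[unfolded run_def]
  have pos: "1 \<le> p" "1 \<le> p'" using r active_pos by blast+
  have "\<not> q < q'"
  proof
    assume "q < q'"
    then have "active q j" using r assms by auto
    then show False using r by auto
  qed
  moreover have "\<not> q' < q"
  proof
    assume "q' < q"
    then have "active q' j" using r assms by auto
    then show False using r by auto
  qed
  moreover have "\<not> p' < p"
  proof
    assume "p' < p"
    then have "p' \<le> p - 1" "p - 1 < q'" using r assms pos by auto
    then have "active (p - 1) j" using r by blast
    then show False using r by auto
  qed
  moreover have "\<not> p < p'"
  proof
    assume "p < p'"
    then have "p \<le> p' - 1" "p' - 1 < q" using r assms pos by auto
    then have "active (p' - 1) j" using r by blast
    then show False using r by auto
  qed
  ultimately show ?thesis by auto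
qed

lemma run_pos: "run p q j \<Longrightarrow> 1 \<le> p \<and> 2 \<le> j"
  using active_pos by (auto simp: run_def)

lemma run_ends_vertex:
  assumes "run p q j"
  shows "vertex p j" "vertex q j"
proof -
  have "1 \<le> p" using run_pos assms by blast
  then show "vertex p j"
    using assms by (intro vertex_if_active_changes) (auto simp: run_def)
  have "active (q - 1) j" using assms by (auto simp: run_def)
  then show "vertex q j"
    using assms by (intro vertex_if_active_changes) (auto simp: run_def)
qed

lemma run_inner:
  assumes "run p q j" "p < k" "k < q"
  shows "inner_point k j"
proof -
  have "p \<le> k - 1" "k - 1 < q" using assms(2,3) by auto
  then have "active k j" "active (k - 1) j" using assms by (auto simp only: run_def less_imp_le)
  then show ?thesis using active_covered by (auto simp: inner_point_def)
qed

text \<open>Summation of the jumps \<open>w\<close> along each run. The set \<open>B\<close> is a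
  subgroup, later the polynomials of bounded bidegree, so that degree bounds pass from the jumps and
  start values to \<open>h\<close>.\<close>

lemma row_integration:
  fixes w :: "nat \<Rightarrow> nat \<Rightarrow> 'a::ab_group_add" and s :: "nat \<Rightarrow> nat \<Rightarrow> nat \<Rightarrow> 'a"
  assumes w0: "\<And>i j. \<not> (inner_point i j \<and> vertex i j) \<Longrightarrow> w i j = 0"
    and closed_run: "\<And>p q j. run p q j \<Longrightarrow> inner_point p j \<Longrightarrow> inner_point q j \<Longrightarrow> (\<Sum>k=p..q. w k j) = 0"
    and B: "0 \<in> B" "\<And>a b. a \<in> B \<Longrightarrow> b \<in> B \<Longrightarrow> a + b \<in> B" "\<And>a. a \<in> B \<Longrightarrow> - a \<in> B"
    and wB: "\<And>i j. w i j \<in> B" and sB: "\<And>p q j. s p q j \<in> B"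
  obtains h where "\<And>i j. \<not> active i j \<Longrightarrow> h i j = 0"
    and "\<And>i j. inner_point i j \<Longrightarrow> h i j - h (i - 1) j = w i j"
    and "\<And>p q j. run p q j \<Longrightarrow> \<not> inner_point p j \<Longrightarrow> \<not> inner_point q j \<Longrightarrow> h p j = s p q j"
    and "\<And>i j. h i j \<in> B"
proof -
  \<comment> \<open>The edge cofactor before the jump at \<open>p\<close>: 0 if the run starts at an
    interior vertex, otherwise the value that makes the total 0 at an interior right end, and the
    free value \<open>s\<close> on a cross-cut.\<close>
  define start where "start p q j =
    (if inner_point p j then 0 else if inner_point q j then - (\<Sum>k=p..q. w k j) else s p q j)" for p q j
  \<comment> \<open>By \<open>run_unique\<close> the outer sum has a single term; it merely selects
    the run through segment \<open>i\<close>.\<close>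
  define h where "h i j = (if active i j
    then (\<Sum>(p, q) | run p q j \<and> p \<le> i \<and> i < q. start p q j + (\<Sum>k=p..i. w k j)) else 0)" for i j
  have h: "h i j = start p q j + (\<Sum>k=p..i. w k j)" if "run p q j" "p \<le> i" "i < q" for p q i j
  proof -
    have "active i j" using that by (auto simp: run_def)
    moreover have "{(p, q). run p q j \<and> p \<le> i \<and> i < q} = {(p, q)}"
    proof -
      have "p' = p \<and> q' = q" if "run p' q' j" "p' \<le> i" "i < q'" for p' q'
        by (rule run_unique[OF \<open>run p q j\<close>, of p' q' i]) (use that \<open>p \<le> i\<close> \<open>i < q\<close> in simp_all)
      then show ?thesis using that by blast
    qed
    ultimately show ?thesis by (simp add: h_def)
  qed
  have h0: "h i j = 0" if "\<not> active i j" for i j using that by (simp add: h_def)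
  have "h i j - h (i - 1) j = w i j" if i: "inner_point i j" for i j
  proof -
    have pos: "2 \<le> i" using inner_pos i by blast
    consider (both) "active i j" "active (i - 1) j" | (start) "active i j" "\<not> active (i - 1) j"
      | (stop) "\<not> active i j" "active (i - 1) j" | (none) "\<not> active i j" "\<not> active (i - 1) j" by blast
    then show ?thesis
    proof cases
      case both
      obtain p q where r: "run p q j" "p \<le> i - 1" "i - 1 < q" using run_exists[OF both(2)] .
      have "i \<noteq> q" using both r(1) by (auto simp: run_def)
      then have r': "p \<le> i" "i < q" using r pos by auto
      have "(\<Sum>k=p..i. w k j) = w i j + (\<Sum>k=p..i-1. w k j)"
        by (rule sum_split_last) (use r' pos in simp_all)
      then show ?thesis unfolding h[OF r] h[OF r(1) r'] by simp
    next
      case start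
      obtain p q where r: "run p q j" "p \<le> i" "i < q" using run_exists[OF start(1)] .
      have "\<not> p < i"
      proof
        assume "p < i"
        then have "active (i - 1) j" using run_active[OF r(1), of "i - 1"] r(3) by simp
        then show False using start by blast
      qed
      then have "p = i" using r by auto
      then show ?thesis unfolding h[OF r] h0[OF start(2)] by (simp add: start_def i)
    next
      case stop
      obtain p q where r: "run p q j" "p \<le> i - 1" "i - 1 < q" using run_exists[OF stop(2)] .
      have "q = i"
      proof (rule ccontr)
        assume "q \<noteq> i"
        then have "active i j" using run_active[OF r(1), of i] r(2,3) by simp
        then show False using stop by blast
      qed
      have *: "(\<Sum>k=p..i. w k j) = w i j + (\<Sum>k=p..i-1. w k j)"
        by (rule sum_split_last) (use r pos in simp_all)
      \<comment> \<open>At an interior right end the total is 0: by \<open>closed_run\<close> if the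
        left end is interior too, and by the choice of \<open>start\<close> otherwise.\<close>
      have "start p q j + (\<Sum>k=p..q. w k j) = 0"
        using closed_run[OF r(1)] i \<open>q = i\<close> by (auto simp: start_def)
      then have "start p q j + (\<Sum>k=p..i-1. w k j) + w i j = 0"
        unfolding \<open>q = i\<close> * by (simp only: ac_simps)
      then show ?thesis unfolding h[OF r] h0[OF stop(1)] by (simp only: diff_0 neg_eq_iff_add_eq_0)
    next
      case none
      then have "\<not> vertex i j" using inner_vertex_active i by blast
      then show ?thesis using w0 by (simp add: h0[OF none(1)] h0[OF none(2)] del: One_nat_def)
    qed
  qed
  \<comment> \<open>On a cross-cut \<open>w\<close> is 0 at \<open>p\<close>, so the sum adds
    nothing to the start value.\<close>
  moreover have "h p j = s p q j" if "run p q j" "\<not> inner_point p j" "\<not> inner_point q j" for p q j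
    using h[OF that(1), of p] that w0[of p j] by (auto simp: run_def start_def)
  moreover have sum_B: "sum f I \<in> B" if "\<And>i. f i \<in> B" for f :: "nat \<Rightarrow> 'a" and I
    by (induction I rule: infinite_finite_induct) (use that B in auto)
  have "h i j \<in> B" for i j
  proof (cases "active i j")
    case True
    obtain p q where r: "run p q j" "p \<le> i" "i < q" using run_exists[OF True] .
    show ?thesis unfolding h[OF r] start_def using B wB sB sum_B by auto
  qed (simp add: h0 B)
  ultimately show ?thesis using that h0 by blast
qed

text \<open>Without jumps \<open>h\<close> is constant along a run. An interior end forces this
  constant to equal the value 0 on the inactive segment beyond it, and \<open>start\<close> deals
  with cross-cuts.\<close>

lemma row_uniqueness:
  fixes h :: "nat \<Rightarrow> nat \<Rightarrow> 'a::ab_group_add"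
  assumes h0: "\<And>i j. \<not> active i j \<Longrightarrow> h i j = 0"
    and jump: "\<And>i j. inner_point i j \<Longrightarrow> h i j - h (i - 1) j = 0"
    and start: "\<And>p q j. run p q j \<Longrightarrow> \<not> inner_point p j \<Longrightarrow> \<not> inner_point q j \<Longrightarrow> h p j = 0"
  shows "h i j = 0"
proof (cases "active i j")
  case True
  then obtain p q where r: "run p q j" "p \<le> i" "i < q" by (rule run_exists)
  have const: "h k j = h p j" if "p \<le> k" "k < q" for k
    using that
  proof (induction k)
    case (Suc k)
    show ?case
    proof (cases "p = Suc k")
      case False
      then have "inner_point (Suc k) j" using run_inner[OF r(1)] Suc.prems by simp
      then show ?thesis using jump[of "Suc k" j] Suc False by simp
    qed simp
  qed simp
  have "p < q" using r by simp
  have ends: "\<not> active (p - 1) j" "\<not> active q j" using r(1) by (simp_all add: run_def)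
  have "h p j = 0"
  proof (cases "inner_point p j")
    case True
    then show ?thesis using jump[OF True] h0[OF ends(1)] by simp
  next
    case not_p: False
    show ?thesis
    proof (cases "inner_point q j")
      case True
      have "h (q - 1) j = 0" using jump[OF True] h0[OF ends(2)] by simp
      moreover have "h (q - 1) j = h p j" by (rule const) (use \<open>p < q\<close> in simp_all)
      ultimately show ?thesis by simp
    qed (use start[OF r(1) not_p] in simp)
  qed
  then show ?thesis using const[OF r(2,3)] by simp
qed (rule h0)

text \<open>
  On the full grid, removing the jump \<open>\<kappa>\<close> along the half line to the left of each bad point \<open>(a, b)\<close>,
  where \<open>\<kappa>\<close> is the curl there, leaves curl-free jumps, which can be summed up. The removed jumps are
  those of \<open>\<kappa>\<close> times the function \<open>n\<close> belonging to \<open>(a, b)\<close>.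
\<close>

lemma potential_exists:
  fixes h v :: "nat \<Rightarrow> nat \<Rightarrow> 'a::comm_ring_1"
  assumes winding: "\<And>a b. 1 \<le> a \<Longrightarrow> 1 \<le> b \<Longrightarrow> \<not> inner_point a b \<Longrightarrow> \<exists>n :: nat \<Rightarrow> nat \<Rightarrow> int.
      (\<forall>i j. covered i j \<longrightarrow> covered i (j - 1) \<longrightarrow> n i j - n i (j - 1) = (if j = b \<and> i < a then - 1 else 0)) \<and>
      (\<forall>i j. covered i j \<longrightarrow> covered (i - 1) j \<longrightarrow> n i j = n (i - 1) j)"
    and bound: "\<And>i j. h i j \<noteq> 0 \<Longrightarrow> i < M \<and> j < M" "\<And>i j. v i j \<noteq> 0 \<Longrightarrow> i < M \<and> j < M"
    and curl: "\<And>i j. inner_point i j \<Longrightarrow> h i j - h (i - 1) j = v i j - v i (j - 1)"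
  obtains Q where "\<And>i j. covered i j \<Longrightarrow> covered i (j - 1) \<Longrightarrow> Q i j - Q i (j - 1) = h i j"
    and "\<And>i j. covered i j \<Longrightarrow> covered (i - 1) j \<Longrightarrow> Q i j - Q (i - 1) j = v i j"
proof -
  define \<kappa> where "\<kappa> i j = h i j - h (i - 1) j - (v i j - v i (j - 1))" for i j
  \<comment> \<open>Far out all jumps vanish, so finitely many bad points suffice. The index
    \<open>M\<close> itself is included because the curl also involves the preceding
    segments.\<close>
  define S where "S = {(a, b). 1 \<le> a \<and> a \<le> M \<and> 1 \<le> b \<and> b \<le> M \<and> \<not> inner_point a b}"
  have "finite S"
    by (rule finite_subset[of _ "{1..M} \<times> {1..M}"]) (auto simp: S_def)
  have \<kappa>0: "\<kappa> i j = 0" if "1 \<le> i" "1 \<le> j" "(i, j) \<notin> S" for i j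
  proof (cases "inner_point i j")
    case False
    then have "M \<le> i - 1 \<or> M \<le> j - 1" using that by (auto simp: S_def)
    then have "h i j = 0" "h (i - 1) j = 0" "v i j = 0" "v i (j - 1) = 0"
      using bound by fastforce+
    then show ?thesis by (simp add: \<kappa>_def)
  qed (use curl in \<open>simp add: \<kappa>_def\<close>)
  define cut where "cut ab i j = (if j = snd ab \<and> i < fst ab then - 1 else 0 :: int)" for ab :: "nat \<times> nat" and i j
  have "\<exists>n. \<forall>ab\<in>S. (\<forall>i j. covered i j \<longrightarrow> covered i (j - 1) \<longrightarrow> n ab i j - n ab i (j - 1) = cut ab i j) \<and>
      (\<forall>i j. covered i j \<longrightarrow> covered (i - 1) j \<longrightarrow> n ab i j = n ab (i - 1) j)"
    by (rule bchoice) (use winding in \<open>auto simp: S_def cut_def\<close>)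
  then obtain n where n: "\<And>ab i j. ab \<in> S \<Longrightarrow> covered i j \<Longrightarrow> covered i (j - 1) \<Longrightarrow> n ab i j - n ab i (j - 1) = cut ab i j"
      "\<And>ab i j. ab \<in> S \<Longrightarrow> covered i j \<Longrightarrow> covered (i - 1) j \<Longrightarrow> n ab i j = n ab (i - 1) j"
    by blast
  define \<kappa>' where "\<kappa>' ab = \<kappa> (fst ab) (snd ab)" for ab
  define h' where "h' i j = h i j - (\<Sum>ab\<in>S. \<kappa>' ab * of_int (cut ab i j))" for i j
  \<comment> \<open>Integration along the bottom row and then up the column; \<open>curl'\<close>
    makes the result independent of the path.\<close>
  define P where "P i j = (\<Sum>k=1..i. v k 0) + (\<Sum>l=1..j. h' i l)" for i j
  have curl': "h' i j - h' (i - 1) j = v i j - v i (j - 1)" if "1 \<le> i" "1 \<le> j" for i j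
  proof -
    have "h' i j - h' (i - 1) j = h i j - h (i - 1) j
        - (\<Sum>ab\<in>S. \<kappa>' ab * (of_int (cut ab i j) - of_int (cut ab (i - 1) j)))"
      by (simp add: h'_def algebra_simps sum_subtractf)
    \<comment> \<open>The half line of \<open>cut\<close> has its only end at the bad point, so its
      difference in \<open>i\<close> is 1 exactly there.\<close>
    also have "(\<Sum>ab\<in>S. \<kappa>' ab * (of_int (cut ab i j) - of_int (cut ab (i - 1) j))) =
        (\<Sum>ab\<in>S. if ab = (i, j) then \<kappa>' ab else 0)"
      using that by (intro sum.cong) (auto simp: cut_def)
    also have "\<dots> = \<kappa> i j"
      using \<open>finite S\<close> \<kappa>0[OF that] by (simp add: \<kappa>'_def)
    finally show ?thesis by (simp add: \<kappa>_def algebra_simps)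
  qed
  have Ph: "P i j - P i (j - 1) = h' i j" if "1 \<le> j" for i j
  proof -
    show ?thesis using sum_split_last[of j 1 "h' i"] that by (simp add: P_def)
  qed
  have Pv: "P i j - P (i - 1) j = v i j" if "1 \<le> i" for i j
  proof (induction j)
    case 0
    show ?case using sum_split_last[of i 1 "\<lambda>k. v k 0"] that by (simp add: P_def)
  next
    case (Suc j)
    have "P i (Suc j) - P (i - 1) (Suc j) = (P i j - P (i - 1) j) + (h' i (Suc j) - h' (i - 1) (Suc j))"
      using Ph[of "Suc j" i] Ph[of "Suc j" "i - 1"] by (simp add: algebra_simps)
    then show ?case using Suc curl'[of i "Suc j"] that by simp
  qed
  \<comment> \<open>The removed half-line jumps are put back through the functions \<open>n\<close>,
    which have exactly these jumps between covered boxes.\<close>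
  define Q where "Q i j = P i j + (\<Sum>ab\<in>S. \<kappa>' ab * of_int (n ab i j))" for i j
  show ?thesis
  proof (rule that)
    fix i j assume c: "covered i j" "covered i (j - 1)"
    have "Q i j - Q i (j - 1) = (P i j - P i (j - 1)) + (\<Sum>ab\<in>S. \<kappa>' ab * of_int (n ab i j - n ab i (j - 1)))"
      by (simp add: Q_def algebra_simps sum_subtractf)
    also have "\<dots> = h i j"
      using n(1) c covered_pos[OF c(1)] Ph[of j i] by (simp add: h'_def)
    finally show "Q i j - Q i (j - 1) = h i j" .
  next
    fix i j assume c: "covered i j" "covered (i - 1) j"
    have "Q i j - Q (i - 1) j = (P i j - P (i - 1) j) + (\<Sum>ab\<in>S. \<kappa>' ab * of_int (n ab i j - n ab (i - 1) j))"
      by (simp add: Q_def algebra_simps sum_subtractf)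
    also have "\<dots> = v i j"
      using n(2) c covered_pos[OF c(1)] Pv[of i j] by simp
    finally show "Q i j - Q (i - 1) j = v i j" .
  qed
qed

text \<open>From any box of the cell one steps down to the lowest row and then left, staying inside
  the cell.\<close>

lemma constant_on_cell:
  assumes "\<And>i j. covers F i j \<Longrightarrow> covers F i (j - 1) \<Longrightarrow> Q i j = Q i (j - 1)"
    and "\<And>i j. covers F i j \<Longrightarrow> covers F (i - 1) j \<Longrightarrow> Q i j = Q (i - 1) j"
    and "covers F i j"
  shows "Q i j = Q (left F) (low F)"
proof -
  have 1: "Q i j = Q i (low F)" if "covers F i j" for i j
    using that
  proof (induction j)
    case (Suc j)
    show ?case
    proof (cases "low F = Suc j")
      case False
      then have "covers F i j" using Suc.prems by (auto simp: covers_def)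
      then show ?thesis using Suc assms(1)[of i "Suc j"] by auto
    qed auto
  qed (auto simp: covers_def)
  have 2: "Q i (low F) = Q (left F) (low F)" if "covers F i (low F)" for i
    using that
  proof (induction i)
    case (Suc i)
    show ?case
    proof (cases "left F = Suc i")
      case False
      then have "covers F i (low F)" using Suc.prems by (auto simp: covers_def)
      then show ?thesis using Suc assms(2)[of "Suc i" "low F"] by auto
    qed auto
  qed (auto simp: covers_def)
  have "covers F i (low F)" using assms(3) low_up by (auto simp: covers_def)
  then show ?thesis using 1[OF assms(3)] 2 by simp
qed

end

subsection \<open>The grid spanned by a T-mesh\<close>

lemma mem_rect: "z \<in> rect F \<longleftrightarrow> fst (fst F) \<le> fst z \<and> fst z \<le> fst (snd F) \<and>
    snd (fst F) \<le> snd z \<and> snd z \<le> snd (snd F)"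
  by (cases F; cases "fst F"; cases "snd F"; cases z) (auto simp: rect_def cbox_Pair_eq)

lemma real_open_right:
  fixes a b :: real
  assumes "open A" "a \<in> A" "a < b"
  obtains u where "u \<in> A" "a < u" "u < b"
proof -
  obtain c where c: "c > a" "{a..<c} \<subseteq> A"
    using open_right[OF assms] by blast
  have "(a + min b c) / 2 \<in> A" using c assms by (intro subsetD[OF c(2)]) auto
  then show ?thesis using that[of "(a + min b c) / 2"] c assms by auto
qed

lemma real_open_left:
  fixes a b :: real
  assumes "open A" "a \<in> A" "b < a"
  obtains u where "u \<in> A" "b < u" "u < a"
proof -
  obtain c where c: "c < a" "{c<..a} \<subseteq> A"
    using open_left[OF assms] by blast
  have "(a + max b c) / 2 \<in> A" using c assms by (intro subsetD[OF c(2)]) auto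
  then show ?thesis using that[of "(a + max b c) / 2"] c assms by auto
qed

lemma interior_prod_neighbourhood:
  assumes "z \<in> interior U"
  obtains A B where "open A" "open B" "fst z \<in> A" "snd z \<in> B" "A \<times> B \<subseteq> U"
proof -
  obtain W where W: "open W" "z \<in> W" "W \<subseteq> U" using assms by (auto simp: interior_def)
  obtain A B where "open A" "open B" "z \<in> A \<times> B" "A \<times> B \<subseteq> W"
    by (rule open_prod_elim[OF W(1,2)])
  then show ?thesis using that[of A B] W by (auto simp: mem_Times_iff)
qed

text \<open>A connected interior would contain a point with first coordinate \<open>a\<close>, and
  every product neighbourhood of such a point leaves the two opposite quadrants. The sign
  \<open>s\<close> tells which pair of opposite quadrants is meant.\<close>

lemma disconnected_at_corner:
  fixes U :: "point set" and s :: real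
  assumes U: "\<And>z. z \<in> U \<Longrightarrow> (a \<le> fst z \<and> 0 \<le> s * (snd z - b)) \<or> (fst z \<le> a \<and> s * (snd z - b) \<le> 0)"
    and s: "s = 1 \<or> s = - 1"
    and p: "p \<in> interior U" "fst p < a" and q: "q \<in> interior U" "a < fst q"
  shows "\<not> connected (interior U)"
proof
  assume "connected (interior U)"
  then have "connected (fst ` interior U)"
    by (intro connected_continuous_image continuous_intros)
  then have "a \<in> fst ` interior U"
    using connectedD_interval[of "fst ` interior U" "fst p" "fst q" a] p q by auto
  then obtain z where z: "z \<in> interior U" "fst z = a" by auto
  obtain A B where AB: "open A" "open B" "fst z \<in> A" "snd z \<in> B" "A \<times> B \<subseteq> U"
    by (rule interior_prod_neighbourhood[OF z(1)])
  obtain l where l: "l \<in> A" "l < a"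
    using real_open_left[OF AB(1,3), of "a - 1"] z(2) by auto
  obtain r where r: "r \<in> A" "a < r"
    using real_open_right[OF AB(1,3), of "a + 1"] z(2) by auto
  obtain t where t: "t \<in> B" "snd z < t"
    using real_open_right[OF AB(2,4), of "snd z + 1"] by auto
  obtain t' where t': "t' \<in> B" "t' < snd z"
    using real_open_left[OF AB(2,4), of "snd z - 1"] by auto
  have in_U: "(u, v) \<in> U" if "u \<in> A" "v \<in> B" for u v using that AB(5) by blast
  show False
  proof (cases "s * (snd z - b) < 0")
    case True
    then show False using U[OF in_U[OF r(1) AB(4)]] r(2) by auto
  next
    \<comment> \<open>To the left of \<open>z\<close> there are points of \<open>U\<close> above and
      below its height; one of these heights makes \<open>s\<close> times the distance to
      \<open>b\<close> positive.\<close>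
    case False
    then show False
      using s U[OF in_U[OF l(1) t(1)]] U[OF in_U[OF l(1) t'(1)]] l(2) t(2) t'(2) by auto
  qed
qed

text \<open>The sequences may contain more coordinates than the mesh uses. Cell coordinates have
  index at least 1, so that row 0 and column 0 of boxes stay empty.\<close>

locale mesh_grid =
  fixes T :: "cell set" and x y :: "nat \<Rightarrow> real"
  assumes mesh: "t_mesh T" and x_mono: "strict_mono x" and y_mono: "strict_mono y"
    and grid: "F \<in> T \<Longrightarrow> fst (fst F) \<in> x ` {1..} \<and> fst (snd F) \<in> x ` {1..} \<and>
      snd (fst F) \<in> y ` {1..} \<and> snd (snd F) \<in> y ` {1..}"
begin

definition lf :: "cell \<Rightarrow> nat" where "lf F = inv x (fst (fst F))"
definition rt :: "cell \<Rightarrow> nat" where "rt F = inv x (fst (snd F))"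
definition lw :: "cell \<Rightarrow> nat" where "lw F = inv y (snd (fst F))"
definition hg :: "cell \<Rightarrow> nat" where "hg F = inv y (snd (snd F))"

lemma x_le [simp]: "x i \<le> x j \<longleftrightarrow> i \<le> j" and x_less [simp]: "x i < x j \<longleftrightarrow> i < j"
  and x_eq [simp]: "x i = x j \<longleftrightarrow> i = j"
  using x_mono by (simp_all add: strict_mono_less_eq strict_mono_less strict_mono_eq)

lemma y_le [simp]: "y i \<le> y j \<longleftrightarrow> i \<le> j" and y_less [simp]: "y i < y j \<longleftrightarrow> i < j"
  and y_eq [simp]: "y i = y j \<longleftrightarrow> i = j"
  using y_mono by (simp_all add: strict_mono_less_eq strict_mono_less strict_mono_eq)

lemma finite_T: "finite T" and T_nonempty: "T \<noteq> {}"
  using mesh by (simp_all add: t_mesh_def)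

lemma index_coords:
  assumes "F \<in> T"
  shows "fst (fst F) = x (lf F)" "fst (snd F) = x (rt F)" "snd (fst F) = y (lw F)" "snd (snd F) = y (hg F)"
  using grid[OF assms] by (auto simp: lf_def rt_def lw_def hg_def f_inv_into_f)

lemma index_bounds:
  assumes "F \<in> T"
  shows "1 \<le> lf F" "lf F < rt F" "1 \<le> lw F" "lw F < hg F"
proof -
  have "fst (fst F) < fst (snd F)" "snd (fst F) < snd (snd F)"
    using mesh assms by (auto simp: t_mesh_def)
  then show "lf F < rt F" "lw F < hg F" by (simp_all add: index_coords[OF assms])
  show "1 \<le> lf F" "1 \<le> lw F"
    using grid[OF assms] by (auto simp: index_coords[OF assms])
qed

lemma mem_rect_index: "F \<in> T \<Longrightarrow> z \<in> rect F \<longleftrightarrow> x (lf F) \<le> fst z \<and> fst z \<le> x (rt F) \<and>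
    y (lw F) \<le> snd z \<and> snd z \<le> y (hg F)"
  by (simp add: mem_rect index_coords)

lemma mem_interior_rect:
  assumes "F \<in> T" "x (lf F) < fst z" "fst z < x (rt F)" "y (lw F) < snd z" "snd z < y (hg F)"
  shows "z \<in> interior (rect F)"
proof (rule interiorI)
  show "open ({x (lf F)<..<x (rt F)} \<times> {y (lw F)<..<y (hg F)})" by (intro open_Times) auto
  show "z \<in> {x (lf F)<..<x (rt F)} \<times> {y (lw F)<..<y (hg F)}" using assms by (cases z) auto
  show "{x (lf F)<..<x (rt F)} \<times> {y (lw F)<..<y (hg F)} \<subseteq> rect F"
    using assms(1) by (auto simp: mem_rect_index)
qed

definition mx :: "nat \<Rightarrow> real" where "mx i = (x i + x (Suc i)) / 2"
definition my :: "nat \<Rightarrow> real" where "my j = (y j + y (Suc j)) / 2"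

lemma mx_between: "x i < mx i" "mx i < x (Suc i)"
  using x_less[of i "Suc i"] unfolding mx_def by (simp_all del: x_less add: field_simps)

lemma my_between: "y i < my i" "my i < y (Suc i)"
  using y_less[of i "Suc i"] unfolding my_def by (simp_all del: y_less add: field_simps)

lemma less_mx: "i \<le> k \<Longrightarrow> x i < mx k" and mx_less: "k < i \<Longrightarrow> mx k < x i"
  using mx_between[of k] x_le[of i k] x_le[of "Suc k" i] by (auto simp del: x_le)

lemma less_my: "i \<le> k \<Longrightarrow> y i < my k" and my_less: "k < i \<Longrightarrow> my k < y i"
  using my_between[of k] y_le[of i k] y_le[of "Suc k" i] by (auto simp del: y_le)

sublocale index_mesh T lf rt lw hg
proof
  show "finite T" by (rule finite_T)
  show "1 \<le> lf F \<and> lf F < rt F" "1 \<le> lw F \<and> lw F < hg F" if "F \<in> T" for F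
    using index_bounds[OF that] by auto
  fix F G i j
  assume F: "F \<in> T" and G: "G \<in> T" and i: "lf F \<le> i" "i < rt F" and j: "lw F \<le> j" "j < hg F"
    and i': "lf G \<le> i" "i < rt G" and j': "lw G \<le> j" "j < hg G"
  \<comment> \<open>The centre of a common box lies in the interior of both rectangles, but distinct
    cells share only frontier points.\<close>
  have "(mx i, my j) \<in> interior (rect F)" "(mx i, my j) \<in> interior (rect G)"
    by (rule mem_interior_rect; use F G i j i' j' in \<open>simp add: less_mx less_my mx_less my_less\<close>)+
  then have "(mx i, my j) \<in> rect F \<inter> rect G - frontier (rect F)"
    using interior_subset by (auto simp: frontier_def)
  then show "F = G" using mesh F G unfolding t_mesh_def by blast
qed

section \<open>Grid boxes and the topology of the domain\<close>

definition gbox :: "nat \<Rightarrow> nat \<Rightarrow> point set" where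
  "gbox i j = {x i..x (Suc i)} \<times> {y j..y (Suc j)}"

lemma mem_gbox: "z \<in> gbox i j \<longleftrightarrow> x i \<le> fst z \<and> fst z \<le> x (Suc i) \<and> y j \<le> snd z \<and> snd z \<le> y (Suc j)"
  by (cases z) (auto simp: gbox_def)

lemma closed_gbox: "closed (gbox i j)"
  by (simp add: gbox_def closed_Times)

lemma gbox_subset_rect: "covers F i j \<Longrightarrow> gbox i j \<subseteq> rect F"
proof
  fix z assume "covers F i j" "z \<in> gbox i j"
  then have "F \<in> T" "x (lf F) \<le> x i" "x (Suc i) \<le> x (rt F)" "y (lw F) \<le> y j" "y (Suc j) \<le> y (hg F)"
    by (auto simp: covers_def)
  then show "z \<in> rect F"
    using \<open>z \<in> gbox i j\<close> unfolding mem_gbox mem_rect_index[OF \<open>F \<in> T\<close>]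
    by (meson order_trans)
qed

lemma gbox_subset_domain: "covered i j \<Longrightarrow> gbox i j \<subseteq> domain T"
  using gbox_subset_rect by (fastforce simp: covered_def domain_def covers_def)

lemma bracket:
  fixes u :: "nat \<Rightarrow> real"
  assumes "u a \<le> r" "r \<le> u b" "a < b"
  shows "\<exists>i. a \<le> i \<and> i < b \<and> u i \<le> r \<and> r \<le> u (Suc i)"
  using assms(3,2)
proof (induction b)
  case (Suc b)
  show ?case
  proof (cases "r \<le> u b \<and> a < b")
    case True
    then show ?thesis using Suc by (metis less_Suc_eq)
  next
    case False
    then have "u b \<le> r" using Suc.prems assms(1) by (cases "a = b") auto
    then show ?thesis using Suc.prems by (intro exI[of _ b]) auto
  qed
qed auto

lemma rect_gbox:
  assumes "F \<in> T" "z \<in> rect F"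
  obtains i j where "covers F i j" "z \<in> gbox i j"
proof -
  note z = assms(2)[unfolded mem_rect_index[OF assms(1)]]
  obtain i where i: "lf F \<le> i \<and> i < rt F \<and> x i \<le> fst z \<and> fst z \<le> x (Suc i)"
    using bracket[of x "lf F" "fst z" "rt F"] z index_bounds[OF assms(1)] by blast
  obtain j where j: "lw F \<le> j \<and> j < hg F \<and> y j \<le> snd z \<and> snd z \<le> y (Suc j)"
    using bracket[of y "lw F" "snd z" "hg F"] z index_bounds[OF assms(1)] by blast
  show ?thesis by (rule that[of i j]) (use i j assms in \<open>simp_all add: covers_def mem_gbox\<close>)
qed

lemma domain_iff: "z \<in> domain T \<longleftrightarrow> (\<exists>i j. covered i j \<and> z \<in> gbox i j)"
proof
  assume "z \<in> domain T"
  then obtain F where F: "F \<in> T" "z \<in> rect F" by (auto simp: domain_def)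
  then show "\<exists>i j. covered i j \<and> z \<in> gbox i j"
    using rect_gbox[OF F] unfolding covered_def by blast
qed (use gbox_subset_domain in blast)

lemma rect_open_gbox:
  assumes "F \<in> T" "z \<in> rect F" "x i < fst z" "fst z < x (Suc i)" "y j < snd z" "snd z < y (Suc j)"
  shows "covers F i j"
proof -
  have "x (lf F) < x (Suc i)" "x i < x (rt F)" "y (lw F) < y (Suc j)" "y j < y (hg F)"
    using assms(2-) unfolding mem_rect_index[OF assms(1)] by linarith+
  then show ?thesis using assms(1) by (auto simp: covers_def)
qed

lemma domain_open_gbox:
  assumes "z \<in> domain T" "x i < fst z" "fst z < x (Suc i)" "y j < snd z" "snd z < y (Suc j)"
  shows "covered i j"
  using assms rect_open_gbox unfolding domain_def covered_def by blast

lemma closed_domain: "closed (domain T)" and compact_domain: "compact (domain T)"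
proof -
  show "compact (domain T)"
    unfolding domain_def by (intro compact_UN finite_T) (simp add: rect_def compact_cbox)
  then show "closed (domain T)" by (rule compact_imp_closed)
qed

lemma frontier_domain: "z \<in> domain T \<Longrightarrow> z \<in> frontier (domain T) \<longleftrightarrow> z \<notin> interior (domain T)"
  using closed_domain by (simp add: frontier_def)

text \<open>Four covered boxes around the point form a neighbourhood. Conversely, a product
  neighbourhood inside the domain meets each of the four open boxes, and an open box meeting the
  domain is covered.\<close>

lemma inner_point_iff:
  assumes "1 \<le> i" "1 \<le> j"
  shows "inner_point i j \<longleftrightarrow> (x i, y j) \<in> interior (domain T)"
proof
  have i: "x (i - 1) < x i" "x i < x (Suc i)" and j: "y (j - 1) < y j" "y j < y (Suc j)"
    using assms by auto
  have s: "Suc (i - 1) = i" "Suc (j - 1) = j" using assms by auto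
  {
    assume inner: "inner_point i j"
    let ?U = "{x (i - 1)<..<x (Suc i)} \<times> {y (j - 1)<..<y (Suc j)}"
    show "(x i, y j) \<in> interior (domain T)"
    proof (rule interiorI)
      show "open ?U" by (intro open_Times) auto
      show "(x i, y j) \<in> ?U" using i j by auto
      show "?U \<subseteq> domain T"
      proof
        fix z assume z: "z \<in> ?U"
        define k where "k = (if fst z \<le> x i then i - 1 else i)"
        define l where "l = (if snd z \<le> y j then j - 1 else j)"
        have "z \<in> gbox k l" using z s by (cases z) (auto simp: mem_gbox k_def l_def)
        moreover have "covered k l" using inner by (auto simp: inner_point_def k_def l_def)
        ultimately show "z \<in> domain T" using gbox_subset_domain by blast
      qed
    qed
  }
  {
    assume "(x i, y j) \<in> interior (domain T)"
    then obtain A B where AB: "open A" "open B" "x i \<in> A" "y j \<in> B" "A \<times> B \<subseteq> domain T"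
      by (rule interior_prod_neighbourhood) auto
    obtain l where l: "l \<in> A" "x (i - 1) < l" "l < x i" using real_open_left[OF AB(1,3) i(1)] .
    obtain r where r: "r \<in> A" "x i < r" "r < x (Suc i)" using real_open_right[OF AB(1,3) i(2)] .
    obtain d where d: "d \<in> B" "y (j - 1) < d" "d < y j" using real_open_left[OF AB(2,4) j(1)] .
    obtain u where u: "u \<in> B" "y j < u" "u < y (Suc j)" using real_open_right[OF AB(2,4) j(2)] .
    have D: "(a, b) \<in> domain T" if "a \<in> A" "b \<in> B" for a b using that AB(5) by blast
    have "covered i j" by (rule domain_open_gbox[OF D[OF r(1) u(1)]]) (use r u s in simp_all)
    moreover have "covered (i - 1) j" by (rule domain_open_gbox[OF D[OF l(1) u(1)]]) (use l u s in simp_all)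
    moreover have "covered i (j - 1)" by (rule domain_open_gbox[OF D[OF r(1) d(1)]]) (use r d s in simp_all)
    moreover have "covered (i - 1) (j - 1)" by (rule domain_open_gbox[OF D[OF l(1) d(1)]]) (use l d s in simp_all)
    ultimately show "inner_point i j" by (simp add: inner_point_def)
  }
qed

lemma vertices_iff: "v \<in> vertices T \<longleftrightarrow> (\<exists>i j. v = (x i, y j) \<and> vertex i j)"
proof
  assume "v \<in> vertices T"
  then obtain F where F: "F \<in> T" "v \<in> corners F" by (auto simp: vertices_def)
  then obtain i j where "v = (x i, y j)" "i = lf F \<or> i = rt F" "j = lw F \<or> j = hg F"
    by (auto simp: corners_def index_coords[OF F(1)])
  then show "\<exists>i j. v = (x i, y j) \<and> vertex i j" using vertexI[OF F(1)] by blast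
next
  assume "\<exists>i j. v = (x i, y j) \<and> vertex i j"
  then obtain i j F where v: "v = (x i, y j)" and F: "F \<in> T" "i = lf F \<or> i = rt F" "j = lw F \<or> j = hg F"
    unfolding vertex_def by blast
  then have "v \<in> corners F" by (auto simp: corners_def index_coords[OF F(1)])
  then show "v \<in> vertices T" using F(1) by (auto simp: vertices_def)
qed

lemma grid_vertices_iff: "(x i, y j) \<in> vertices T \<longleftrightarrow> vertex i j"
  by (auto simp: vertices_iff)

lemma vertices_subset_domain: "v \<in> vertices T \<Longrightarrow> v \<in> domain T"
proof -
  assume "v \<in> vertices T"
  then obtain F where F: "F \<in> T" "v \<in> corners F" by (auto simp: vertices_def)
  then have "v \<in> rect F" using index_bounds[OF F(1)] by (auto simp: corners_def mem_rect index_coords[OF F(1)])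
  then show ?thesis using F(1) by (auto simp: domain_def)
qed

lemma interior_vertices_iff: "(x i, y j) \<in> interior_vertices T \<longleftrightarrow> vertex i j \<and> inner_point i j"
  using vertices_subset_domain[of "(x i, y j)"] frontier_domain[of "(x i, y j)"] inner_point_iff[of i j] vertex_pos[of i j]
  unfolding interior_vertices_def grid_vertices_iff[symmetric] by blast

lemma boundary_vertices_iff: "(x i, y j) \<in> boundary_vertices T \<longleftrightarrow> vertex i j \<and> \<not> inner_point i j"
  using vertices_subset_domain[of "(x i, y j)"] frontier_domain[of "(x i, y j)"] inner_point_iff[of i j] vertex_pos[of i j]
  unfolding boundary_vertices_def grid_vertices_iff[symmetric] by blast

end

subsection \<open>Simple connectivity\<close>

text \<open>The difference takes values in the integer multiples of 2 pi i, a discrete set, hence is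
  constant on a connected set.\<close>

lemma continuous_logs_differ_by_constant:
  fixes f g :: "'a::topological_space \<Rightarrow> complex"
  assumes S: "connected S" and f: "continuous_on S f" and g: "continuous_on S g"
    and eq: "\<And>z. z \<in> S \<Longrightarrow> exp (f z) = exp (g z)" and "a \<in> S" "b \<in> S"
  shows "f a - g a = f b - g b"
proof -
  have "(\<lambda>z. f z - g z) constant_on S"
  proof (rule continuous_discrete_range_constant[OF S])
    show "continuous_on S (\<lambda>z. f z - g z)" by (intro continuous_intros f g)
    fix u assume u: "u \<in> S"
    have "2 * pi \<le> norm ((f v - g v) - (f u - g u))" if v: "v \<in> S" "f v - g v \<noteq> f u - g u" for v
    proof -
      have "exp ((f v - g v) - (f u - g u)) = 1"
        by (simp add: exp_diff eq[OF u] eq[OF v(1)])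
      then obtain n :: int where n: "Re ((f v - g v) - (f u - g u)) = 0"
          "Im ((f v - g v) - (f u - g u)) = of_int (2 * n) * pi"
        unfolding exp_eq_1 by blast
      have "n \<noteq> 0" using n v(2) by (auto simp: complex_eq_iff)
      then have "1 \<le> \<bar>real_of_int n\<bar>" by linarith
      then have "2 * pi \<le> \<bar>of_int (2 * n) * pi\<bar>" by (simp add: abs_mult)
      also have "\<dots> \<le> norm ((f v - g v) - (f u - g u))"
        using abs_Im_le_cmod n(2) by metis
      finally show ?thesis .
    qed
    then show "\<exists>e>0. \<forall>v. v \<in> S \<and> f v - g v \<noteq> f u - g u \<longrightarrow> e \<le> norm ((f v - g v) - (f u - g u))"
      by (intro exI[of _ "2 * pi"]) auto
  qed
  then show ?thesis using assms(5,6) unfolding constant_on_def by metis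
qed

lemma Re_Im_closed_segment:
  fixes p q :: complex
  assumes "z \<in> closed_segment p q"
  shows "Re z \<in> closed_segment (Re p) (Re q)" "Im z \<in> closed_segment (Im p) (Im q)"
proof -
  have "Re z \<in> Re ` closed_segment p q" "Im z \<in> Im ` closed_segment p q"
    using assms by simp_all
  then show "Re z \<in> closed_segment (Re p) (Re q)" "Im z \<in> closed_segment (Im p) (Im q)"
    by (simp_all add: closed_segment_linear_image bounded_linear.linear[OF bounded_linear_Re]
        bounded_linear.linear[OF bounded_linear_Im])
qed

context mesh_grid
begin

text \<open>Absence of holes makes the complement of the compact domain connected, which in the
  plane means that the domain is Borsukian: continuous functions without zeros on it have continuous
  logarithms. Points become complex numbers in order to apply this to z - w.\<close>

lemma domain_complex_logarithm:
  assumes "without_holes T" "w \<notin> domain T"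
  obtains g where "continuous_on ((\<lambda>z. Complex (fst z) (snd z)) ` domain T) g"
    "\<And>z. z \<in> (\<lambda>z. Complex (fst z) (snd z)) ` domain T \<Longrightarrow> exp (g z) = z - Complex (fst w) (snd w)"
proof -
  let ?c = "\<lambda>z. Complex (fst z) (snd z)"
  let ?K = "?c ` domain T"
  have cont: "continuous_on S ?c" for S
    unfolding Complex_eq by (intro continuous_intros)
  have "connected (- domain T)"
  proof (rule ccontr)
    assume "\<not> connected (- domain T)"
    moreover have "bounded (- (- domain T))"
      using compact_domain compact_imp_bounded by simp
    ultimately obtain C where "C \<in> components (- domain T)" "bounded C"
      using cobounded_has_bounded_component[of "- domain T"] by auto
    then show False using assms(1) by (auto simp: without_holes_def)
  qed
  then have "connected (?c ` (- domain T))"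
    by (rule connected_continuous_image[OF cont])
  moreover have "?c ` (- domain T) = - ?K"
    by (rule bij_image_Compl_eq, rule bij_betw_byWitness[of _ "\<lambda>z. (Re z, Im z)"]) auto
  moreover have "compact ?K"
    by (intro compact_continuous_image cont compact_domain)
  ultimately have "Borsukian ?K" by (simp add: Borsukian_separation_compact)
  moreover have "?c w \<notin> ?K" using assms(2) by (auto simp: prod_eq_iff)
  ultimately have "\<exists>g. continuous_on ?K g \<and> (\<forall>z\<in>?K. z - ?c w = exp (g z))"
    unfolding Borsukian_continuous_logarithm
    by (elim allE[of _ "\<lambda>z. z - ?c w"] impE) (force intro!: continuous_intros)+
  then obtain g where "continuous_on ?K g" and g: "\<forall>z\<in>?K. z - ?c w = exp (g z)" by blast
  then show ?thesis by (intro that[of g]) (use g in force)+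
qed

lemma mx_strict_mono: "mx i < mx j \<longleftrightarrow> i < j" and my_strict_mono: "my i < my j \<longleftrightarrow> i < j"
proof -
  have "strict_mono mx"
    by (rule strict_mono_Suc_iff[THEN iffD2]) (use mx_between less_trans in blast)
  then show "mx i < mx j \<longleftrightarrow> i < j" by (simp add: strict_mono_less)
  have "strict_mono my"
    by (rule strict_mono_Suc_iff[THEN iffD2]) (use my_between less_trans in blast)
  then show "my i < my j \<longleftrightarrow> i < j" by (simp add: strict_mono_less)
qed

text \<open>One of the four boxes at the grid point is uncovered, and no point of an open uncovered
  box belongs to the domain.\<close>

lemma missing_point:
  assumes "1 \<le> a" "1 \<le> b" "\<not> inner_point a b"
  obtains w where "w \<notin> domain T" "mx (a - 1) < fst w" "fst w < mx a" "my (b - 1) < snd w" "snd w < my b"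
proof -
  have s: "Suc (a - 1) = a" "Suc (b - 1) = b" using assms by auto
  obtain k l where kl: "k = a \<or> k = a - 1" "l = b \<or> l = b - 1" "\<not> covered k l"
    using assms(3) unfolding inner_point_def by blast
  \<comment> \<open>Halfway from the grid point to the centre of the uncovered box: inside this box,
    and in each coordinate strictly between the adjacent box centres.\<close>
  define u where "u = (x a + mx k) / 2"
  define v where "v = (y b + my l) / 2"
  have "x k < u \<and> u < x (Suc k) \<and> mx (a - 1) < u \<and> u < mx a"
  proof (cases "k = a")
    case False
    then have "Suc k = a" "a - 1 = k" using kl(1) s by auto
    then show ?thesis using mx_between[of a] mx_between[of k] by (simp add: u_def field_simps)
  qed (use mx_between[of a] mx_less[of "a - 1" a] assms(1) in \<open>simp add: u_def field_simps\<close>)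
  moreover have "y l < v \<and> v < y (Suc l) \<and> my (b - 1) < v \<and> v < my b"
  proof (cases "l = b")
    case False
    then have "Suc l = b" "b - 1 = l" using kl(2) s by auto
    then show ?thesis using my_between[of b] my_between[of l] by (simp add: v_def field_simps)
  qed (use my_between[of b] my_less[of "b - 1" b] assms(2) in \<open>simp add: v_def field_simps\<close>)
  moreover have "(u, v) \<notin> domain T"
    using calculation domain_open_gbox[of "(u, v)" k l] kl(3) by auto
  ultimately show ?thesis using that[of "(u, v)"] by simp
qed

text \<open>
  The integers count the sheets between a continuous logarithm of \<open>z - w\<close> on the domain and the
  principal branch, whose cut is the half line to the left of \<open>w\<close>; here \<open>w\<close> lies outside the domain
  and so close to the grid point \<open>(a, b)\<close> that the centres of the boxes do not distinguish the two.
\<close>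

lemma winding_numbers:
  assumes "without_holes T" "1 \<le> a" "1 \<le> b" "\<not> inner_point a b"
  shows "\<exists>n :: nat \<Rightarrow> nat \<Rightarrow> int.
    (\<forall>i j. covered i j \<longrightarrow> covered i (j - 1) \<longrightarrow> n i j - n i (j - 1) = (if j = b \<and> i < a then - 1 else 0)) \<and>
    (\<forall>i j. covered i j \<longrightarrow> covered (i - 1) j \<longrightarrow> n i j = n (i - 1) j)"
proof -
  let ?K = "(\<lambda>z. Complex (fst z) (snd z)) ` domain T"
  obtain w where w: "w \<notin> domain T" "mx (a - 1) < fst w" "fst w < mx a" "my (b - 1) < snd w" "snd w < my b"
    using missing_point[OF assms(2-4)] .
  define W where "W = Complex (fst w) (snd w)"
  obtain g where g: "continuous_on ?K g" "\<And>z. z \<in> ?K \<Longrightarrow> exp (g z) = z - W"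
    using domain_complex_logarithm[OF assms(1) w(1)] unfolding W_def by blast
  define c where "c i j = Complex (mx i) (my j)" for i j
  define N where "N i j = g (c i j) - Ln (c i j - W)" for i j
  define n where "n i j = \<lfloor>Im (N i j) / (2 * pi)\<rfloor>" for i j
  have mx_w: "mx i < fst w \<longleftrightarrow> i < a" "fst w < mx i \<longleftrightarrow> a \<le> i" for i
  proof -
    have "mx i < fst w" if "i < a"
    proof -
      have "mx i \<le> mx (a - 1)" using that mx_strict_mono[of "a - 1" i] by (simp add: not_less[symmetric])
      then show ?thesis using w by simp
    qed
    moreover have "fst w < mx i" if "a \<le> i"
    proof -
      have "mx a \<le> mx i" using that mx_strict_mono[of i a] by (simp add: not_less[symmetric])
      then show ?thesis using w by simp
    qed
    ultimately show "mx i < fst w \<longleftrightarrow> i < a" "fst w < mx i \<longleftrightarrow> a \<le> i" by (meson not_less less_asym)+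
  qed
  have my_w: "my j < snd w \<longleftrightarrow> j < b" "snd w < my j \<longleftrightarrow> b \<le> j" for j
  proof -
    have "my j < snd w" if "j < b"
    proof -
      have "my j \<le> my (b - 1)" using that my_strict_mono[of "b - 1" j] by (simp add: not_less[symmetric])
      then show ?thesis using w by simp
    qed
    moreover have "snd w < my j" if "b \<le> j"
    proof -
      have "my b \<le> my j" using that my_strict_mono[of j b] by (simp add: not_less[symmetric])
      then show ?thesis using w by simp
    qed
    ultimately show "my j < snd w \<longleftrightarrow> j < b" "snd w < my j \<longleftrightarrow> b \<le> j" by (meson not_less less_asym)+
  qed
  have c_K: "z \<in> ?K" if "covered i j" "x i \<le> Re z" "Re z \<le> x (Suc i)" "y j \<le> Im z" "Im z \<le> y (Suc j)" for i j z
    using that gbox_subset_domain[of i j] by (auto simp: mem_gbox intro!: image_eqI[of _ _ "(Re z, Im z)"])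
  have Ln_const: "g p - L p = g q - L q"
    if seg: "closed_segment p q \<subseteq> ?K" and L: "continuous_on (closed_segment p q) L"
      "\<And>z. z \<in> closed_segment p q \<Longrightarrow> exp (L z) = z - W" for p q L
    by (rule continuous_logs_differ_by_constant[of "closed_segment p q" g L])
      (use seg L g(2) continuous_on_subset[OF g(1) seg] in auto)
  have W_neq: "z - W \<noteq> 0" if "z \<in> ?K" for z
    using that w(1) by (auto simp: W_def complex_eq_iff prod_eq_iff)
  have v_seg: "Re z = mx i" "my (j - 1) \<le> Im z" "Im z \<le> my j"
    if "z \<in> closed_segment (c i (j - 1)) (c i j)" "1 \<le> j" for i j z
    using Re_Im_closed_segment[OF that(1)] that(2) my_strict_mono[of "j - 1" j]
    by (auto simp: c_def closed_segment_eq_real_ivl split: if_splits)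
  have h_seg: "Im z = my j" "mx (i - 1) \<le> Re z" "Re z \<le> mx i"
    if "z \<in> closed_segment (c (i - 1) j) (c i j)" "1 \<le> i" for i j z
    using Re_Im_closed_segment[OF that(1)] that(2) mx_strict_mono[of "i - 1" i]
    by (auto simp: c_def closed_segment_eq_real_ivl split: if_splits)
  have v_seg_K: "closed_segment (c i (j - 1)) (c i j) \<subseteq> ?K" if "covered i j" "covered i (j - 1)" for i j
  proof
    have j: "1 \<le> j" "Suc (j - 1) = j" using covered_pos[OF that(1)] by simp_all
    fix z assume z: "z \<in> closed_segment (c i (j - 1)) (c i j)"
    show "z \<in> ?K"
      using c_K[OF that(1), of z] c_K[OF that(2), of z] v_seg[OF z j(1)]
        mx_between[of i] my_between[of j] my_between[of "j - 1"] unfolding j(2)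
      by (cases "y j \<le> Im z") auto
  qed
  have h_seg_K: "closed_segment (c (i - 1) j) (c i j) \<subseteq> ?K" if "covered i j" "covered (i - 1) j" for i j
  proof
    have i: "1 \<le> i" "Suc (i - 1) = i" using covered_pos[OF that(1)] by simp_all
    fix z assume z: "z \<in> closed_segment (c (i - 1) j) (c i j)"
    show "z \<in> ?K"
      using c_K[OF that(1), of z] c_K[OF that(2), of z] h_seg[OF z i(1)]
        my_between[of j] mx_between[of i] mx_between[of "i - 1"] unfolding i(2)
      by (cases "x i \<le> Re z") auto
  qed
  have N: "N i j = of_real (2 * pi * of_int (n i j)) * \<i>" if "covered i j" for i j
  proof -
    have K: "c i j \<in> ?K"
      by (rule c_K[OF that]) (use mx_between[of i] my_between[of j] in \<open>auto simp: c_def\<close>)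
    then have "exp (N i j) = 1"
      using g(2)[OF K] W_neq[OF K] by (simp add: N_def exp_diff)
    then obtain k :: int where k: "Re (N i j) = 0" "Im (N i j) = of_int (2 * k) * pi"
      unfolding exp_eq_1 by blast
    then have "n i j = k" by (simp add: n_def)
    then show ?thesis using k by (simp add: complex_eq_iff)
  qed
  have n_eqI: "n i j = n i' j'" if "covered i j" "covered i' j'" "N i j = N i' j'" for i j i' j'
    using that N[OF that(1)] N[OF that(2)] by simp
  have N_const: "N i j = N i' j'" if seg: "closed_segment (c i' j') (c i j) \<subseteq> ?K"
    and pos: "\<And>z. z \<in> closed_segment (c i' j') (c i j) \<Longrightarrow> z - W \<notin> \<real>\<^sub>\<le>\<^sub>0" for i j i' j'
    unfolding N_def
  proof (rule Ln_const[symmetric, OF seg])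
    show "continuous_on (closed_segment (c i' j') (c i j)) (\<lambda>z. Ln (z - W))"
      by (intro continuous_intros pos)
    show "exp (Ln (z - W)) = z - W" if "z \<in> closed_segment (c i' j') (c i j)" for z
      by (rule exp_Ln) (use W_neq seg that in blast)
  qed
  have vert: "n i j - n i (j - 1) = (if j = b \<and> i < a then - 1 else 0)" if c: "covered i j" "covered i (j - 1)" for i j
  proof (cases "j = b \<and> i < a")
    case False
    have j: "1 \<le> j" using covered_pos[OF c(1)] by simp
    have "N i j = N i (j - 1)"
    proof (rule N_const[OF v_seg_K[OF c]])
      fix z assume "z \<in> closed_segment (c i (j - 1)) (c i j)"
      note z = v_seg[OF this j]
      \<comment> \<open>The segment avoids the cut: it lies to the right of \<open>w\<close>, or
        entirely below, or entirely above it.\<close>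
      have "0 < Re z - fst w \<or> Im z < snd w \<or> snd w < Im z"
        using False z mx_w(2)[of i] my_w(1)[of j] my_w(2)[of "j - 1"] j by force
      then show "z - W \<notin> \<real>\<^sub>\<le>\<^sub>0" by (auto simp: complex_nonpos_Reals_iff W_def)
    qed
    then have "n i j = n i (j - 1)" by (rule n_eqI[OF c])
    then show ?thesis using False by simp
  next
    case True
    have j: "1 \<le> j" using covered_pos[OF c(1)] by simp
    let ?S = "closed_segment (c i (j - 1)) (c i j)"
    \<comment> \<open>A branch of the logarithm of z - w whose cut points to the right, so that it
      is continuous along the segment crossing the principal cut.\<close>
    let ?L = "\<lambda>z. Ln (W - z) + \<i> * pi"
    have "g (c i (j - 1)) - ?L (c i (j - 1)) = g (c i j) - ?L (c i j)"
    proof (rule Ln_const[OF v_seg_K[OF c]])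
      have "W - z \<notin> \<real>\<^sub>\<le>\<^sub>0" if "z \<in> ?S" for z
        using v_seg(1)[OF that j] mx_w(1)[of i] True by (auto simp: complex_nonpos_Reals_iff W_def)
      then show "continuous_on ?S ?L" by (intro continuous_intros)
      show "exp (?L z) = z - W" if "z \<in> ?S" for z
      proof -
        have "z - W \<noteq> 0" using W_neq v_seg_K[OF c] that by blast
        then have "exp (Ln (W - z)) = W - z" by (intro exp_Ln) simp
        then show ?thesis by (simp add: exp_add)
      qed
    qed
    \<comment> \<open>The two branches agree above the principal cut and differ by 2 pi i below it;
      hence crossing upwards lowers \<open>n\<close> by 1.\<close>
    moreover have "Ln (W - c i j) = Ln (c i j - W) - \<i> * pi"
      using Ln_minus[of "c i j - W"] my_w(2)[of j] True
      by (auto simp: c_def W_def complex_eq_iff)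
    moreover have "Ln (W - c i (j - 1)) = Ln (c i (j - 1) - W) + \<i> * pi"
      using Ln_minus[of "c i (j - 1) - W"] my_w(1)[of "j - 1"] True j
      by (auto simp: c_def W_def complex_eq_iff)
    ultimately have "N i j - N i (j - 1) = - (2 * pi * \<i>)"
      by (simp add: N_def algebra_simps)
    then have "Im (N i j - N i (j - 1)) = - (2 * pi)" by simp
    then have "2 * pi * (of_int (n i j) - of_int (n i (j - 1)) + 1) = 0"
      unfolding N[OF c(1)] N[OF c(2)] by (simp add: algebra_simps)
    then have "real_of_int (n i j - n i (j - 1) + 1) = 0" by simp
    then have "n i j - n i (j - 1) + 1 = 0" by (simp only: of_int_eq_0_iff)
    then show ?thesis using True by simp
  qed
  have hor: "n i j = n (i - 1) j" if c: "covered i j" "covered (i - 1) j" for i j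
  proof -
    have i: "1 \<le> i" using covered_pos[OF c(1)] by simp
    have "N i j = N (i - 1) j"
    proof (rule N_const[OF h_seg_K[OF c]])
      fix z assume "z \<in> closed_segment (c (i - 1) j) (c i j)"
      \<comment> \<open>No box centre is at the height of \<open>w\<close>, so horizontal segments
        miss the cut.\<close>
      from h_seg(1)[OF this i] have "Im z \<noteq> snd w" using my_w[of j] by auto
      then show "z - W \<notin> \<real>\<^sub>\<le>\<^sub>0" by (auto simp: complex_nonpos_Reals_iff W_def)
    qed
    then show ?thesis by (rule n_eqI[OF c])
  qed
  show ?thesis using vert hor by blast
qed

section \<open>Consequences of regularity\<close>

lemma cells_at_grid_point:
  assumes "F \<in> T" "(x i, y j) \<in> rect F" "1 \<le> i" "1 \<le> j"
  shows "covers F i j \<or> covers F (i - 1) j \<or> covers F i (j - 1) \<or> covers F (i - 1) (j - 1)"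
proof -
  have "lf F \<le> i" "i \<le> rt F" "lw F \<le> j" "j \<le> hg F"
    using assms(2) by (simp_all add: mem_rect_index[OF assms(1)])
  then show ?thesis using index_bounds[OF assms(1)] assms by (auto simp: covers_def)
qed

lemma center_interior:
  assumes "covers F i j" "rect F \<subseteq> U"
  shows "(mx i, my j) \<in> interior U"
proof -
  have "(mx i, my j) \<in> interior (rect F)"
    by (rule mem_interior_rect) (use assms(1) in \<open>simp_all add: covers_def less_mx less_my mx_less my_less\<close>)
  then show ?thesis using interior_mono[OF assms(2)] by blast
qed

text \<open>Otherwise the point is a common corner of just two cells in opposite quadrants, hence a
  vertex whose cells have a union with disconnected interior.\<close>

lemma diagonal:
  assumes "regular T" "1 \<le> i" "1 \<le> j" "covered i j" "covered (i - 1) (j - 1)"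
  shows "covered (i - 1) j \<or> covered i (j - 1)"
proof (rule ccontr)
  assume not: "\<not> ?thesis"
  obtain F where F: "covers F i j" using assms(4) by (auto simp: covered_def)
  obtain G where G: "covers G (i - 1) (j - 1)" using assms(5) by (auto simp: covered_def)
  have FT: "F \<in> T" "G \<in> T" using F G by (auto simp: covers_def)
  have "\<not> covers F (i - 1) j" "\<not> covers F i (j - 1)" "\<not> covers G (i - 1) j" "\<not> covers G i (j - 1)"
    using not unfolding covered_def by blast+
  then have ends: "lf F = i" "lw F = j" "rt G = i" "hg G = j"
    using F G assms(2,3) by (auto simp: covers_def)
  let ?v = "(x i, y j)"
  define U where "U = (\<Union>H\<in>{H\<in>T. ?v \<in> rect H}. rect H)"
  have "?v \<in> vertices T"
    unfolding grid_vertices_iff by (rule vertexI[OF FT(1)]) (use ends in auto)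
  then have conn: "connected (interior U)"
    using assms(1) unfolding regular_def U_def by blast
  have v: "?v \<in> rect F" "?v \<in> rect G"
    using ends index_bounds[OF FT(1)] index_bounds[OF FT(2)] by (simp_all add: mem_rect_index FT)
  have cells: "H = F \<or> H = G" if "H \<in> T" "?v \<in> rect H" for H
    using cells_at_grid_point[OF that assms(2,3)] not covers_unique[OF F] covers_unique[OF G]
    unfolding covered_def by blast
  have "\<not> connected (interior U)"
  proof (rule disconnected_at_corner[of U "x i" 1 "y j"])
    fix z assume "z \<in> U"
    then have "z \<in> rect F \<or> z \<in> rect G" using cells by (auto simp: U_def)
    then show "(x i \<le> fst z \<and> 0 \<le> 1 * (snd z - y j)) \<or> (fst z \<le> x i \<and> 1 * (snd z - y j) \<le> 0)"
      using ends by (auto simp: mem_rect_index FT)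
  next
    show "(mx (i - 1), my (j - 1)) \<in> interior U"
      by (rule center_interior[OF G]) (use v FT in \<open>auto simp: U_def\<close>)
    show "(mx i, my j) \<in> interior U"
      by (rule center_interior[OF F]) (use v FT in \<open>auto simp: U_def\<close>)
  qed (use assms in \<open>auto intro: mx_less less_mx\<close>)
  with conn show False by simp
qed

text \<open>The mirror image of \<open>diagonal\<close>, with the sign -1 selecting the other pair
  of quadrants.\<close>

lemma antidiagonal:
  assumes "regular T" "1 \<le> i" "1 \<le> j" "covered (i - 1) j" "covered i (j - 1)"
  shows "covered i j \<or> covered (i - 1) (j - 1)"
proof (rule ccontr)
  assume not: "\<not> ?thesis"
  obtain F where F: "covers F i (j - 1)" using assms(5) by (auto simp: covered_def)
  obtain G where G: "covers G (i - 1) j" using assms(4) by (auto simp: covered_def)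
  have FT: "F \<in> T" "G \<in> T" using F G by (auto simp: covers_def)
  have "\<not> covers F (i - 1) (j - 1)" "\<not> covers F i j" "\<not> covers G (i - 1) (j - 1)" "\<not> covers G i j"
    using not unfolding covered_def by blast+
  then have ends: "lf F = i" "hg F = j" "rt G = i" "lw G = j"
    using F G assms(2,3) by (auto simp: covers_def)
  let ?v = "(x i, y j)"
  define U where "U = (\<Union>H\<in>{H\<in>T. ?v \<in> rect H}. rect H)"
  have "?v \<in> vertices T"
    unfolding grid_vertices_iff by (rule vertexI[OF FT(1)]) (use ends in auto)
  then have conn: "connected (interior U)"
    using assms(1) unfolding regular_def U_def by blast
  have v: "?v \<in> rect F" "?v \<in> rect G"
    using ends index_bounds[OF FT(1)] index_bounds[OF FT(2)] by (simp_all add: mem_rect_index FT)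
  have cells: "H = F \<or> H = G" if "H \<in> T" "?v \<in> rect H" for H
    using cells_at_grid_point[OF that assms(2,3)] not covers_unique[OF F] covers_unique[OF G]
    unfolding covered_def by blast
  have "\<not> connected (interior U)"
  proof (rule disconnected_at_corner[of U "x i" "- 1" "y j"])
    fix z assume "z \<in> U"
    then have "z \<in> rect F \<or> z \<in> rect G" using cells by (auto simp: U_def)
    then show "(x i \<le> fst z \<and> 0 \<le> - 1 * (snd z - y j)) \<or> (fst z \<le> x i \<and> - 1 * (snd z - y j) \<le> 0)"
      using ends by (auto simp: mem_rect_index FT)
  next
    show "(mx (i - 1), my j) \<in> interior U"
      by (rule center_interior[OF G]) (use v FT in \<open>auto simp: U_def\<close>)
    show "(mx i, my (j - 1)) \<in> interior U"
      by (rule center_interior[OF F]) (use v FT in \<open>auto simp: U_def\<close>)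
  qed (use assms in \<open>auto intro: mx_less less_mx\<close>)
  with conn show False by simp
qed

text \<open>By regularity, two boxes meeting only in a corner are linked through a third one.\<close>

lemma touching_gboxes:
  assumes "regular T" and "covered i j" "covered i' j'" "z \<in> gbox i j" "z \<in> gbox i' j'"
    and vert: "\<And>i j. covered i j \<Longrightarrow> covered i (j - 1) \<Longrightarrow> z \<in> gbox i j \<Longrightarrow> z \<in> gbox i (j - 1) \<Longrightarrow> P i j = P i (j - 1)"
    and hor: "\<And>i j. covered i j \<Longrightarrow> covered (i - 1) j \<Longrightarrow> z \<in> gbox i j \<Longrightarrow> z \<in> gbox (i - 1) j \<Longrightarrow> P i j = P (i - 1) j"
  shows "P i j = P i' j'"
proof -
  have near: "i' \<le> i + 1 \<and> j' \<le> j + 1 \<and> (i' = i + 1 \<longrightarrow> fst z = x i') \<and> (j' = j + 1 \<longrightarrow> snd z = y j')"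
    if "z \<in> gbox i j" "z \<in> gbox i' j'" for i j i' j'
  proof -
    have "x i' \<le> x (Suc i)" "y j' \<le> y (Suc j)" using that unfolding mem_gbox by linarith+
    then have "i' \<le> i + 1" "j' \<le> j + 1" by auto
    then show ?thesis using that unfolding mem_gbox by (auto intro: antisym)
  qed
  have up: "P i j = P i (Suc j)" if "covered i j" "covered i (Suc j)" "z \<in> gbox i j" "z \<in> gbox i (Suc j)" for i j
    using vert[of i "Suc j"] that by simp
  have right: "P i j = P (Suc i) j" if "covered i j" "covered (Suc i) j" "z \<in> gbox i j" "z \<in> gbox (Suc i) j" for i j
    using hor[of "Suc i" j] that by simp
  have diag: "P i j = P (Suc i) (Suc j)"
    if c: "covered i j" "covered (Suc i) (Suc j)" and z: "z \<in> gbox i j" "z \<in> gbox (Suc i) (Suc j)" for i j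
  proof -
    have z': "z \<in> gbox i (Suc j)" "z \<in> gbox (Suc i) j"
      using z unfolding mem_gbox by auto
    from diagonal[OF assms(1), of "Suc i" "Suc j"] c have "covered i (Suc j) \<or> covered (Suc i) j" by simp
    then show ?thesis
      using up[of i j] right[of i "Suc j"] right[of i j] up[of "Suc i" j] c z z' by auto
  qed
  have anti: "P (Suc i) j = P i (Suc j)"
    if c: "covered (Suc i) j" "covered i (Suc j)" and z: "z \<in> gbox (Suc i) j" "z \<in> gbox i (Suc j)" for i j
  proof -
    have z': "z \<in> gbox i j" "z \<in> gbox (Suc i) (Suc j)"
      using z unfolding mem_gbox by auto
    from antidiagonal[OF assms(1), of "Suc i" "Suc j"] c have "covered (Suc i) (Suc j) \<or> covered i j" by simp
    then show ?thesis
      using up[of i j] right[of i "Suc j"] right[of i j] up[of "Suc i" j] c z z' by auto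
  qed
  have "i' = i \<or> i' = Suc i \<or> i = Suc i'" "j' = j \<or> j' = Suc j \<or> j = Suc j'"
    using near[OF assms(4,5)] near[OF assms(5,4)] by auto
  then show ?thesis
    using assms(2-5) up[of i j] up[of i j'] right[of i j] right[of i' j] diag[of i j] diag[of i' j']
      anti[of i j'] anti[of i' j]
    by (elim disjE) simp_all
qed

lemma covered_finite: "finite {(i, j). covered i j}"
proof -
  obtain M where M: "\<And>F i j. covers F i j \<Longrightarrow> i < M \<and> j < M" using covers_bound by blast
  show ?thesis
    by (rule finite_subset[of _ "{..<M} \<times> {..<M}"]) (use M in \<open>auto simp: covered_def\<close>)
qed

text \<open>If \<open>P\<close> took two values, the boxes with one value and those with the others
  would form two closed sets covering the domain. They are disjoint since boxes sharing a point have
  equal values, which contradicts connectedness.\<close>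

lemma covered_connected:
  assumes "regular T" "connected (domain T)" and "covered i j" "covered i' j'"
    and vert: "\<And>i j. covered i j \<Longrightarrow> covered i (j - 1) \<Longrightarrow> P i j = P i (j - 1)"
    and hor: "\<And>i j. covered i j \<Longrightarrow> covered (i - 1) j \<Longrightarrow> P i j = P (i - 1) j"
  shows "P i j = P i' j'"
proof (rule ccontr)
  assume ne: "P i j \<noteq> P i' j'"
  define A where "A = (\<Union>(k, l)\<in>{(k, l). covered k l \<and> P k l = P i j}. gbox k l)"
  define B where "B = (\<Union>(k, l)\<in>{(k, l). covered k l \<and> P k l \<noteq> P i j}. gbox k l)"
  have "closed A" "closed B" unfolding A_def B_def
    by (intro closed_UN; (rule finite_subset[OF _ covered_finite])?; auto intro: closed_gbox)+
  moreover have "domain T \<subseteq> A \<union> B"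
  proof
    fix z assume "z \<in> domain T"
    then obtain k l where "covered k l" "z \<in> gbox k l" unfolding domain_iff by blast
    then show "z \<in> A \<union> B" by (cases "P k l = P i j") (auto simp: A_def B_def)
  qed
  moreover have "A \<inter> B \<inter> domain T = {}"
  proof -
    have False if z: "z \<in> A" "z \<in> B" for z
    proof -
      obtain k l k' l' where "covered k l" "P k l = P i j" "z \<in> gbox k l" "covered k' l'" "P k' l' \<noteq> P i j" "z \<in> gbox k' l'"
        using z by (auto simp: A_def B_def)
      moreover have "P k l = P k' l'"
        by (rule touching_gboxes[OF assms(1), of k l k' l' z]) (use calculation vert hor in auto)
      ultimately show False by simp
    qed
    then show ?thesis by blast
  qed
  moreover have "A \<inter> domain T \<noteq> {}"
  proof -
    have "(x i, y j) \<in> gbox i j" by (simp add: mem_gbox)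
    then have "(x i, y j) \<in> A \<inter> domain T" using assms(3) gbox_subset_domain unfolding A_def by blast
    then show ?thesis by blast
  qed
  moreover have "B \<inter> domain T \<noteq> {}"
  proof -
    have "(x i', y j') \<in> gbox i' j'" by (simp add: mem_gbox)
    then have "(x i', y j') \<in> B \<inter> domain T" using assms(4) ne[symmetric] gbox_subset_domain unfolding B_def by blast
    then show ?thesis by blast
  qed
  ultimately show False using assms(2) unfolding connected_closed by blast
qed

end

subsection \<open>Horizontal l-edges\<close>

lemma composite_segmentI: "s = closed_segment u w \<Longrightarrow> A \<subseteq> E \<Longrightarrow> s = \<Union>A \<Longrightarrow> composite_segment E s"
  unfolding composite_segment_def by blast

lemma hedges_memI:
  assumes "u \<in> vertices T" "w \<in> vertices T" "u \<noteq> w" "F \<in> T" "s \<in> hsides F"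
    "closed_segment u w \<subseteq> s" "open_segment u w \<inter> vertices T = {}"
  shows "closed_segment u w \<in> hedges T"
  unfolding hedges_def mem_Collect_eq
  by (rule exI[of _ u], rule exI[of _ w]) (intro conjI refl bexI[of _ F] bexI[of _ s] assms)

context mesh_grid
begin

definition seg :: "nat \<Rightarrow> nat \<Rightarrow> nat \<Rightarrow> point set" where
  "seg p q j = {x p..x q} \<times> {y j}"

lemma mem_seg: "z \<in> seg p q j \<longleftrightarrow> x p \<le> fst z \<and> fst z \<le> x q \<and> snd z = y j"
  by (cases z) (auto simp: seg_def)

lemma horizontal_closed_segment:
  fixes a b c :: real
  shows "a \<le> b \<Longrightarrow> closed_segment (a, c) (b, c) = {a..b} \<times> {c}"
proof -
  assume "a \<le> b"
  have "linear (\<lambda>t. (t, 0) :: real \<times> real)" by (auto intro: linearI)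
  then have "(\<lambda>t. (t, 0)) ` closed_segment a b = closed_segment (a, 0) (b, 0 :: real)"
    by (rule closed_segment_linear_image[symmetric])
  then have "(+) (0, c) ` (\<lambda>t. (t, 0)) ` closed_segment a b = closed_segment (a, c) (b, c)"
    using closed_segment_translation[of "(0, c)" "(a, 0)" "(b, 0)"] by simp
  then show ?thesis
    using \<open>a \<le> b\<close> by (auto simp: closed_segment_eq_real_ivl image_image)
qed

lemma seg_closed_segment: "p \<le> q \<Longrightarrow> seg p q j = closed_segment (x p, y j) (x q, y j)"
  by (simp add: seg_def horizontal_closed_segment)

lemma seg_ends: "p \<le> q \<Longrightarrow> (x p, y j) \<in> seg p q j" "p \<le> q \<Longrightarrow> (x q, y j) \<in> seg p q j"
  by (simp_all add: mem_seg)

lemma grid_mem_seg [simp]: "(x k, y l) \<in> seg p q j \<longleftrightarrow> p \<le> k \<and> k \<le> q \<and> l = j"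
  by (simp add: mem_seg)

lemma seg_subset: "p \<le> q \<Longrightarrow> seg p q j \<subseteq> seg p' q' j' \<longleftrightarrow> p' \<le> p \<and> q \<le> q' \<and> j = j'"
proof
  assume "p \<le> q" "seg p q j \<subseteq> seg p' q' j'"
  then have "(x p, y j) \<in> seg p' q' j'" "(x q, y j) \<in> seg p' q' j'" using seg_ends by blast+
  then show "p' \<le> p \<and> q \<le> q' \<and> j = j'" by simp
next
  assume "p \<le> q" "p' \<le> p \<and> q \<le> q' \<and> j = j'"
  moreover from this have "x p' \<le> x p" "x q \<le> x q'" by simp_all
  ultimately show "seg p q j \<subseteq> seg p' q' j'" by (auto simp: mem_seg simp del: x_le)
qed

lemma seg_eq: "p \<le> q \<Longrightarrow> p' \<le> q' \<Longrightarrow> seg p q j = seg p' q' j' \<longleftrightarrow> p' = p \<and> q' = q \<and> j' = j"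
  using seg_subset[of p q j p' q' j'] seg_subset[of p' q' j' p q j] by auto

lemma seg_split:
  assumes "z \<in> seg p q j" "p < q"
  obtains k where "p \<le> k" "k < q" "z \<in> seg k (Suc k) j"
  using bracket[of x p "fst z" q] assms by (auto simp: mem_seg)

section \<open>From geometric edges to active segments\<close>

lemma active_mid_interior:
  assumes "active k j"
  shows "(mx k, y j) \<in> interior (domain T)"
proof (rule interiorI)
  have j: "Suc (j - 1) = j" "y (j - 1) < y j" using active_pos[OF assms] by auto
  let ?U = "{x k<..<x (Suc k)} \<times> {y (j - 1)<..<y (Suc j)}"
  show "open ?U" by (intro open_Times) auto
  show "(mx k, y j) \<in> ?U" using j(2) mx_between[of k] by auto
  show "?U \<subseteq> domain T"
  proof
    fix z assume z: "z \<in> ?U"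
    have "z \<in> gbox k j \<or> z \<in> gbox k (j - 1)" using z j(1) by (cases z) (auto simp: mem_gbox)
    then show "z \<in> domain T" using gbox_subset_domain active_covered[OF assms] by blast
  qed
qed

lemma hedgesE:
  assumes "e \<in> hedges T"
  obtains p q j F where "p < q" "e = seg p q j" "vertex p j" "vertex q j" "F \<in> T" "j = lw F \<or> j = hg F"
    "lf F \<le> p" "q \<le> rt F" "\<forall>k. p < k \<and> k < q \<longrightarrow> \<not> vertex k j"
proof -
  note result = that
  obtain u w F s where e: "e = closed_segment u w" "u \<in> vertices T" "w \<in> vertices T" "u \<noteq> w" "F \<in> T"
      "s \<in> hsides F" "closed_segment u w \<subseteq> s" "open_segment u w \<inter> vertices T = {}"
    using assms unfolding hedges_def by blast
  obtain p j where u: "u = (x p, y j)" "vertex p j" using e(2) vertices_iff by blast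
  obtain q l where w: "w = (x q, y l)" "vertex q l" using e(3) vertices_iff by blast
  obtain c where s: "s = {x (lf F)..x (rt F)} \<times> {c}" "c = y (lw F) \<or> c = y (hg F)"
    using e(6) by (auto simp: hsides_def index_coords[OF e(5)])
  have "u \<in> s" "w \<in> s" using e(7) by auto
  then have c: "c = y j" "l = j" "lf F \<le> p" "p \<le> rt F" "lf F \<le> q" "q \<le> rt F"
    using s u w by auto
  have j: "j = lw F \<or> j = hg F" using s(2) c(1) by simp
  \<comment> \<open>The segment may be given in either orientation; \<open>p' < q'\<close> are its
    ends in increasing order.\<close>
  have main: thesis if pq: "p' < q'" "closed_segment u w = closed_segment (x p', y j) (x q', y j)"
    "{p', q'} = {p, q}" for p' q'
  proof (rule result[of p' q' j F])
    show "e = seg p' q' j" using pq e(1) by (simp add: seg_closed_segment)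
    have "\<not> vertex k j" if k: "p' < k" "k < q'" for k
    proof
      assume "vertex k j"
      then have "(x k, y j) \<in> vertices T" by (simp add: grid_vertices_iff)
      moreover have "(x k, y j) \<in> closed_segment u w"
        using pq k by (simp add: seg_closed_segment[symmetric])
      moreover have "(x k, y j) \<noteq> u" "(x k, y j) \<noteq> w"
        using k pq(3) u(1) w(1) by (auto simp: doubleton_eq_iff)
      ultimately show False using e(8) by (auto simp: open_segment_def)
    qed
    then show "\<forall>k. p' < k \<and> k < q' \<longrightarrow> \<not> vertex k j" by blast
  qed (use pq u w c e j in \<open>auto simp: doubleton_eq_iff\<close>)
  show thesis
  proof (cases "p < q")
    case True
    then show thesis using main[of p q] u w c by simp
  next
    case False
    then have "q < p" using e(4) u w c by auto
    then show thesis using main[of q p] u w c by (simp add: closed_segment_commute insert_commute)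
  qed
qed

lemma hedgesI:
  assumes "p < q" "vertex p j" "vertex q j" "\<And>k. p < k \<Longrightarrow> k < q \<Longrightarrow> \<not> vertex k j"
    "F \<in> T" "j = lw F \<or> j = hg F" "lf F \<le> p" "q \<le> rt F"
  shows "seg p q j \<in> hedges T"
proof -
  let ?u = "(x p, y j)" and ?w = "(x q, y j)"
  have "{x (lf F)..x (rt F)} \<times> {y j} \<in> hsides F"
    using assms(6) by (auto simp: hsides_def index_coords[OF assms(5)])
  moreover have "closed_segment ?u ?w \<subseteq> {x (lf F)..x (rt F)} \<times> {y j}"
    using assms(1,7,8) seg_subset[of p q j "lf F" "rt F" j]
    by (simp add: seg_closed_segment[symmetric]) (simp add: seg_def)
  moreover have "open_segment ?u ?w \<inter> vertices T = {}"
  proof -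
    have False if v: "v \<in> open_segment ?u ?w" "v \<in> vertices T" for v
    proof -
      obtain k l where kl: "v = (x k, y l)" "vertex k l" using v(2) vertices_iff by blast
      have "v \<in> seg p q j" "v \<noteq> ?u" "v \<noteq> ?w"
        using v(1) assms(1) by (simp_all add: open_segment_def seg_closed_segment)
      then have "p < k" "k < q" "l = j" using kl(1) by auto
      then show False using assms(4) kl(2) by blast
    qed
    then show ?thesis by blast
  qed
  moreover have "?u \<in> vertices T" "?w \<in> vertices T" "?u \<noteq> ?w"
    using assms(1-3) by (simp_all add: grid_vertices_iff)
  ultimately show ?thesis
    unfolding seg_closed_segment[OF less_imp_le[OF assms(1)]] by (intro hedges_memI[OF _ _ _ assms(5)])
qed

text \<open>An edge off the frontier contains an interior point of the domain, so boxes on both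
  sides of it are covered, and by different cells. Activity changes only at vertices and therefore
  extends to the whole edge.\<close>

lemma interior_hedges_active:
  assumes "e \<in> interior_hedges T"
  shows "\<exists>p q j. p < q \<and> e = seg p q j \<and> vertex p j \<and> vertex q j \<and> (\<forall>k. p \<le> k \<and> k < q \<longrightarrow> active k j)"
proof -
  have hedge: "e \<in> hedges T" and not_frontier: "\<not> e \<subseteq> frontier (domain T)"
    using assms by (auto simp: interior_hedges_def)
  obtain p q j F where e: "p < q" "e = seg p q j" "vertex p j" "vertex q j" "F \<in> T" "j = lw F \<or> j = hg F"
      "lf F \<le> p" "q \<le> rt F" "\<forall>k. p < k \<and> k < q \<longrightarrow> \<not> vertex k j"
    by (rule hedgesE[OF hedge])
  have F1: "1 \<le> lf F" "lf F < rt F" "1 \<le> lw F" "lw F < hg F" by (rule index_bounds[OF e(5)])+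
  have j: "1 \<le> j" using e(6) F1 by auto
  obtain z where z: "z \<in> e" "z \<notin> frontier (domain T)" using not_frontier by blast
  obtain k where k: "p \<le> k" "k < q" "z \<in> seg k (Suc k) j"
    using seg_split z(1) e(1,2) by metis
  have "z \<in> rect F"
  proof -
    have "x (lf F) \<le> x k" "x (Suc k) \<le> x (rt F)" "y (lw F) \<le> y j" "y j \<le> y (hg F)"
      using k e(6-8) F1 by auto
    then show ?thesis using k(3) unfolding mem_rect_index[OF e(5)] mem_seg
      by (metis order_trans)
  qed
  then have "z \<in> domain T" using e(5) by (auto simp: domain_def)
  then have "z \<in> interior (domain T)" using z(2) frontier_domain by blast
  then obtain A B where AB: "open A" "open B" "fst z \<in> A" "snd z \<in> B" "A \<times> B \<subseteq> domain T"
    by (rule interior_prod_neighbourhood)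
  have snd: "snd z = y j" using k(3) by (simp add: mem_seg)
  \<comment> \<open>The point is moved off the vertical grid lines, and then up and down, to reach
    open boxes.\<close>
  obtain a where a: "a \<in> A" "x k < a" "a < x (Suc k)"
  proof (cases "fst z = x (Suc k)")
    case True
    then show thesis using real_open_left[OF AB(1,3), of "x k"] that by auto
  next
    case False
    then have "x k \<le> fst z" "fst z < x (Suc k)" using k(3) by (auto simp: mem_seg)
    then show thesis using real_open_right[OF AB(1,3), of "x (Suc k)"] that by force
  qed
  obtain t where t: "t \<in> B" "y j < t" "t < y (Suc j)"
    using real_open_right[OF AB(2,4), of "y (Suc j)"] snd by auto
  have j': "y (j - 1) < y j" "Suc (j - 1) = j" using j by auto
  obtain d where d: "d \<in> B" "y (j - 1) < d" "d < y j"
    using real_open_left[OF AB(2,4), of "y (j - 1)"] snd j' by auto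
  have "covered k j" "covered k (j - 1)"
    by (rule domain_open_gbox[of "(a, t)"] domain_open_gbox[of "(a, d)"], use AB(5) a t d j' in auto)+
  then obtain G H where GH: "covers G k j" "covers H k (j - 1)" by (auto simp: covered_def)
  have "G \<noteq> H"
  proof
    assume "G = H"
    then have G: "lw G < j" "j < hg G" using GH j by (auto simp: covers_def)
    \<comment> \<open>One of the two boxes belongs to the cell whose side carries the edge, and this
      cell ends at \<open>j\<close>.\<close>
    have "covers F k j \<or> covers F k (j - 1)" using e(5-8) k F1 by (auto simp: covers_def)
    then have "F = G" using covers_unique GH \<open>G = H\<close> by blast
    then show False using G e(6) by auto
  qed
  then have active_k: "active k j" using GH by (intro activeI)
  have step: "active i j = active (i - 1) j" if "p < i" "i < q" for i
    using vertex_if_active_changes[of i j] e(9) that by auto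
  have up: "active i j" if "k \<le> i" "i < q" for i
    using that
  proof (induction i)
    case (Suc i)
    show ?case
    proof (cases "k = Suc i")
      case False
      then have "active i j" using Suc by simp
      then show ?thesis using step[of "Suc i"] Suc.prems k False by simp
    qed (use active_k in simp)
  qed (use active_k k in auto)
  have down: "active (k - n) j" if "p \<le> k - n" for n
    using that
  proof (induction n)
    case (Suc n)
    then have "active (k - n) j" by simp
    then show ?case
      using step[of "k - n"] Suc.prems k by (cases "k - n \<le> p") (auto simp: le_diff_conv)
  qed (use active_k in simp)
  have "active i j" if "p \<le> i" "i < q" for i
    using up[of i] down[of "k - i"] that k by (cases "k \<le> i") auto
  then show ?thesis using e(1-4) by blast
qed

text \<open>The edge runs between the vertices nearest to segment \<open>k\<close> on both sides.
  They exist because \<open>F\<close> and \<open>G\<close> have corners on the line, and for the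
  same reason the edge does not reach beyond either cell.\<close>

lemma edge_containing:
  assumes "active k j" "covers F k j" "covers G k (j - 1)"
  obtains p q where "p \<le> k" "k < q" "seg p q j \<in> interior_hedges T"
    "lf F \<le> p" "q \<le> rt F" "lf G \<le> p" "q \<le> rt G"
    "\<And>l. l \<le> k \<Longrightarrow> vertex l j \<Longrightarrow> l \<le> p" "\<And>l. k < l \<Longrightarrow> vertex l j \<Longrightarrow> q \<le> l"
proof -
  have "F \<noteq> G" using assms covers_unique unfolding active_def by blast
  note lwhg = active_above_below[OF assms(2,3) this]
  have FG: "F \<in> T" "lf F \<le> k" "k < rt F" "G \<in> T" "lf G \<le> k" "k < rt G"
    using assms by (auto simp: covers_def)
  have vF: "vertex (lf F) j" "vertex (rt F) j" "vertex (lf G) j" "vertex (rt G) j"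
    using FG lwhg by (auto intro: vertexI)
  define p where "p = (GREATEST l. l \<le> k \<and> vertex l j)"
  define q where "q = (LEAST l. k < l \<and> vertex l j)"
  have p: "p \<le> k \<and> vertex p j" unfolding p_def
    by (rule GreatestI_nat[of _ "lf F" k]) (use vF FG in auto)
  have p': "l \<le> p" if "l \<le> k" "vertex l j" for l unfolding p_def
    by (rule Greatest_le_nat[of _ _ k]) (use that in auto)
  have q: "k < q \<and> vertex q j" unfolding q_def
    by (rule LeastI[of _ "rt F"]) (use vF FG in auto)
  have q': "q \<le> l" if "k < l" "vertex l j" for l unfolding q_def
    by (rule Least_le) (use that in auto)
  have b: "lf F \<le> p" "q \<le> rt F" "lf G \<le> p" "q \<le> rt G"
    using p'[OF FG(2) vF(1)] q'[OF FG(3) vF(2)] p'[OF FG(5) vF(3)] q'[OF FG(6) vF(4)] by auto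
  have "seg p q j \<in> hedges T"
  proof (rule hedgesI[of p q j F])
    fix i assume "p < i" "i < q"
    then show "\<not> vertex i j" using p'[of i] q'[of i] by (cases "i \<le> k") auto
  qed (use p q b FG lwhg in auto)
  moreover have "(mx k, y j) \<in> seg p q j"
    using p q by (simp add: mem_seg less_imp_le less_mx mx_less)
  then have "\<not> seg p q j \<subseteq> frontier (domain T)"
    using active_mid_interior[OF assms(1)] by (auto simp: frontier_def)
  ultimately have "seg p q j \<in> interior_hedges T" by (simp add: interior_hedges_def)
  then show thesis using that[of p q] p q p' q' b by blast
qed

text \<open>\<open>composite_segment\<close> demands neither a horizontal nor a nondegenerate
  segment. Both follow because a point of the segment lies on some edge, and this edge fixes the
  line.\<close>

lemma composite_hedges_iff:
  "composite_segment (interior_hedges T) s \<longleftrightarrow>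
     (\<exists>p q j. p < q \<and> s = seg p q j \<and> vertex p j \<and> vertex q j \<and> (\<forall>k. p \<le> k \<and> k < q \<longrightarrow> active k j))"
proof
  assume "composite_segment (interior_hedges T) s"
  then obtain u w A where s: "s = closed_segment u w" "A \<subseteq> interior_hedges T" "s = \<Union>A"
    unfolding composite_segment_def by blast
  have edge: "\<exists>p q j. p < q \<and> e = seg p q j \<and> vertex p j \<and> vertex q j \<and> (\<forall>k. p \<le> k \<and> k < q \<longrightarrow> active k j)"
    if "e \<in> A" for e
    by (rule interior_hedges_active) (use s(2) that in blast)
  have "u \<in> s" "w \<in> s" using s(1) by auto
  obtain e where "e \<in> A" using \<open>u \<in> s\<close> s(3) by blast
  then obtain p0 q0 j where e: "p0 < q0" "e = seg p0 q0 j" using edge by blast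
  \<comment> \<open>The ends of the edge are two different points of the segment at the same height,
    so the whole segment has this height.\<close>
  have line: "snd z = y j" if z: "z \<in> s" for z
  proof -
    have sub: "(x p0, y j) \<in> closed_segment u w" "(x q0, y j) \<in> closed_segment u w"
    proof -
      have "e \<subseteq> closed_segment u w" using \<open>e \<in> A\<close> s(1,3) by blast
      then show "(x p0, y j) \<in> closed_segment u w" "(x q0, y j) \<in> closed_segment u w"
        using seg_ends[of p0 q0 j] e by auto
    qed
    obtain a where a: "(x p0, y j) = (1 - a) *\<^sub>R u + a *\<^sub>R w"
      using sub(1) by (auto simp: in_segment)
    obtain b where b: "(x q0, y j) = (1 - b) *\<^sub>R u + b *\<^sub>R w"
      using sub(2) by (auto simp: in_segment)
    have "a \<noteq> b" using a b e(1) by (metis Pair_inject less_irrefl x_eq)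
    have "(1 - a) * snd u + a * snd w = y j" "(1 - b) * snd u + b * snd w = y j"
      using arg_cong[OF a, of snd] arg_cong[OF b, of snd] by simp_all
    then have "(a - b) * (snd w - snd u) = 0" by (simp add: algebra_simps)
    then have eq: "snd w = snd u" using \<open>a \<noteq> b\<close> by simp
    then have "snd u = y j" using arg_cong[OF a, of snd] by (simp add: algebra_simps)
    moreover obtain t where t: "z = (1 - t) *\<^sub>R u + t *\<^sub>R w"
      using z s(1) by (auto simp: in_segment)
    have "snd z = (1 - t) * snd u + t * snd w" by (simp add: t)
    ultimately show ?thesis using eq by (simp add: left_diff_distrib)
  qed
  have edge': "\<exists>p q. p < q \<and> e = seg p q j \<and> vertex p j \<and> vertex q j \<and> (\<forall>k. p \<le> k \<and> k < q \<longrightarrow> active k j)"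
    if eA: "e \<in> A" for e
  proof -
    obtain p q j' where e: "p < q" "e = seg p q j'" "vertex p j'" "vertex q j'" "\<forall>k. p \<le> k \<and> k < q \<longrightarrow> active k j'"
      using edge[OF eA] by blast
    have "e \<subseteq> s" using eA s(3) by blast
    then have "(x p, y j') \<in> s" using e(1,2) seg_ends[of p q j'] by auto
    then have "j' = j" using line by fastforce
    then show ?thesis using e by blast
  qed
  have main: "\<exists>p q j. p < q \<and> s = seg p q j \<and> vertex p j \<and> vertex q j \<and> (\<forall>k. p \<le> k \<and> k < q \<longrightarrow> active k j)"
    if uw: "s = closed_segment u w" "fst u \<le> fst w" for u w
  proof -
    have "u \<in> s" "w \<in> s" using uw by auto
    then have u: "u = (fst u, y j)" and w: "w = (fst w, y j)" using line by (metis prod.collapse)+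
    have s_eq: "s = {fst u..fst w} \<times> {y j}"
      using uw horizontal_closed_segment[OF uw(2), of "y j"] u w by metis
    obtain e1 where e1: "e1 \<in> A" "u \<in> e1" using \<open>u \<in> s\<close> s(3) by blast
    obtain p q1 where p: "p < q1" "e1 = seg p q1 j" "vertex p j" using edge'[OF e1(1)] by blast
    obtain e2 where e2: "e2 \<in> A" "w \<in> e2" using \<open>w \<in> s\<close> s(3) by blast
    obtain p2 q where q: "p2 < q" "e2 = seg p2 q j" "vertex q j" using edge'[OF e2(1)] by blast
    have sub: "e1 \<subseteq> s" "e2 \<subseteq> s" using e1 e2 s(3) by blast+
    have "(x p, y j) \<in> s" "(x q1, y j) \<in> s" using p sub seg_ends[of p q1 j] by auto
    then have fu: "fst u = x p" "x q1 \<le> fst w" using e1(2) p(2) unfolding s_eq by (auto simp: mem_seg)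
    have "(x q, y j) \<in> s" using q sub seg_ends[of p2 q j] by auto
    then have fw: "fst w = x q" using e2(2) q(2) unfolding s_eq by (auto simp: mem_seg)
    have "p < q" using fu fw p(1) by simp
    have "active k j" if k: "p \<le> k" "k < q" for k
    proof -
      \<comment> \<open>The midpoint of a unit segment is not a grid point, so an edge through it
        contains the unit segment and makes it active.\<close>
      have "(mx k, y j) \<in> s"
        using k by (simp add: s_eq fu fw less_imp_le less_mx mx_less)
      then obtain e where e: "e \<in> A" "(mx k, y j) \<in> e" using s(3) by blast
      obtain a b where ab: "e = seg a b j" "\<forall>k. a \<le> k \<and> k < b \<longrightarrow> active k j" using edge'[OF e(1)] by blast
      have "x a \<le> mx k" "mx k \<le> x b" using e(2) ab(1) by (simp_all add: mem_seg)
      then have "x a < x (Suc k)" "x k < x b" using mx_between[of k] by linarith+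
      then show ?thesis using ab(2) by simp
    qed
    moreover have "s = seg p q j" by (simp add: s_eq fu fw seg_def)
    ultimately show ?thesis using \<open>p < q\<close> p(3) q(3) by blast
  qed
  show "\<exists>p q j. p < q \<and> s = seg p q j \<and> vertex p j \<and> vertex q j \<and> (\<forall>k. p \<le> k \<and> k < q \<longrightarrow> active k j)"
    using main[of u w] main[of w u] s(1) by (cases "fst u \<le> fst w") (auto simp: closed_segment_commute)
next
  assume "\<exists>p q j. p < q \<and> s = seg p q j \<and> vertex p j \<and> vertex q j \<and> (\<forall>k. p \<le> k \<and> k < q \<longrightarrow> active k j)"
  then obtain p q j where s: "p < q" "s = seg p q j" "vertex p j" "vertex q j" "\<And>k. p \<le> k \<Longrightarrow> k < q \<Longrightarrow> active k j"
    by blast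
  let ?A = "{e \<in> interior_hedges T. e \<subseteq> s}"
  have "s \<subseteq> \<Union>?A"
  proof
    fix z assume "z \<in> s"
    then obtain k where k: "p \<le> k" "k < q" "z \<in> seg k (Suc k) j"
      using seg_split s(1,2) by metis
    obtain F G where "covers F k j" "covers G k (j - 1)" using s(5)[OF k(1,2)] unfolding active_def by blast
    then obtain p' q' where e: "p' \<le> k" "k < q'" "seg p' q' j \<in> interior_hedges T"
        "\<And>l. l \<le> k \<Longrightarrow> vertex l j \<Longrightarrow> l \<le> p'" "\<And>l. k < l \<Longrightarrow> vertex l j \<Longrightarrow> q' \<le> l"
      using edge_containing[OF s(5)[OF k(1,2)]] by metis
    have "seg p' q' j \<subseteq> s" using s(1,2) e(1,2) e(4)[OF k(1) s(3)] e(5)[OF k(2) s(4)]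
      by (simp add: seg_subset)
    moreover have "z \<in> seg p' q' j" using k(3) e(1,2) seg_subset[of k "Suc k" j p' q' j] by auto
    ultimately show "z \<in> \<Union>?A" using e(3) by blast
  qed
  then have "s = \<Union>?A" by blast
  then show "composite_segment (interior_hedges T) s"
    using s(1,2) seg_closed_segment[of p q j] by (intro composite_segmentI[of s _ _ ?A]) auto
qed

text \<open>Maximality of the segment amounts to inactivity of the two unit segments just beyond its
  ends.\<close>

lemma hl_edges_iff: "e \<in> hl_edges T \<longleftrightarrow> (\<exists>p q j. e = seg p q j \<and> run p q j)"
proof
  assume "e \<in> hl_edges T"
  then have comp: "composite_segment (interior_hedges T) e"
    and max: "\<And>s. composite_segment (interior_hedges T) s \<Longrightarrow> e \<subseteq> s \<Longrightarrow> s = e"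
    by (auto simp: hl_edges_def maximal_segments_def)
  obtain p q j where e: "p < q" "e = seg p q j" "\<forall>k. p \<le> k \<and> k < q \<longrightarrow> active k j"
    using comp unfolding composite_hedges_iff by blast
  obtain p' q' where r: "run p' q' j" "p' \<le> p" "p < q'" using run_exists[of p j] e(1,3) by auto
  have "q \<le> q'"
  proof (rule ccontr)
    assume "\<not> q \<le> q'"
    then have "active q' j" using e(3) r(3) by auto
    then show False using r(1) by (auto simp: run_def)
  qed
  then have "e \<subseteq> seg p' q' j" using e r by (simp add: seg_subset)
  moreover have "composite_segment (interior_hedges T) (seg p' q' j)"
    using r(1) run_ends_vertex[OF r(1)] unfolding composite_hedges_iff run_def by blast
  ultimately have "e = seg p' q' j" using max by blast
  then show "\<exists>p q j. e = seg p q j \<and> run p q j" using r(1) by blast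
next
  assume "\<exists>p q j. e = seg p q j \<and> run p q j"
  then obtain p q j where e: "e = seg p q j" and r: "run p q j" by blast
  have pq: "p < q" using r by (simp add: run_def)
  have "composite_segment (interior_hedges T) e"
    using r run_ends_vertex[OF r] e unfolding composite_hedges_iff run_def by blast
  moreover have "s = e" if s: "composite_segment (interior_hedges T) s" "e \<subseteq> s" for s
  proof -
    obtain p' q' j' where s': "p' < q'" "s = seg p' q' j'" "\<forall>k. p' \<le> k \<and> k < q' \<longrightarrow> active k j'"
      using s(1) unfolding composite_hedges_iff by blast
    have sub: "p' \<le> p" "q \<le> q'" "j = j'" using s(2) e s' pq by (simp_all add: seg_subset)
    have "1 \<le> p" using run_pos[OF r] by simp
    have "p' = p"
    proof (rule ccontr)
      assume "p' \<noteq> p"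
      then have "p' \<le> p - 1" "p - 1 < q'" using sub pq by auto
      then have "active (p - 1) j" using s'(3) sub(3) by blast
      then show False using r by (simp add: run_def)
    qed
    moreover have "q' = q"
    proof (rule ccontr)
      assume "q' \<noteq> q"
      then have "p' \<le> q" "q < q'" using sub pq by auto
      then have "active q j" using s'(3) sub(3) by blast
      then show False using r by (simp add: run_def)
    qed
    ultimately show ?thesis using e s'(2) sub(3) by simp
  qed
  ultimately show "e \<in> hl_edges T" by (auto simp: hl_edges_def maximal_segments_def)
qed

text \<open>A segment determines its end points up to order, so its type can be read off from the
  two ends of the run.\<close>

lemma l_edge_types:
  assumes "run p q j"
  shows "is_interior_l_edge T (seg p q j) \<longleftrightarrow> inner_point p j \<and> inner_point q j"
    and "is_cross_cut T (seg p q j) \<longleftrightarrow> \<not> inner_point p j \<and> \<not> inner_point q j"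
    and "is_ray T (seg p q j) \<longleftrightarrow> inner_point p j \<noteq> inner_point q j"
proof -
  have pq: "p < q" using assms by (simp add: run_def)
  note v = run_ends_vertex[OF assms]
  let ?u = "(x p, y j)" and ?w = "(x q, y j)"
  have eq: "seg p q j = closed_segment u w \<longleftrightarrow> (u = ?u \<and> w = ?w) \<or> (u = ?w \<and> w = ?u)" for u w
    using pq by (auto simp: seg_closed_segment closed_segment_eq doubleton_eq_iff)
  have ex: "(\<exists>u w. (u = ?u \<and> w = ?w \<or> u = ?w \<and> w = ?u) \<and> P u \<and> Q w) \<longleftrightarrow>
      P ?u \<and> Q ?w \<or> P ?w \<and> Q ?u" for P Q :: "point \<Rightarrow> bool"
    by blast
  show "is_interior_l_edge T (seg p q j) \<longleftrightarrow> inner_point p j \<and> inner_point q j"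
    unfolding is_interior_l_edge_def eq ex using v by (auto simp: interior_vertices_iff)
  show "is_cross_cut T (seg p q j) \<longleftrightarrow> \<not> inner_point p j \<and> \<not> inner_point q j"
    unfolding is_cross_cut_def eq ex using v by (auto simp: boundary_vertices_iff)
  show "is_ray T (seg p q j) \<longleftrightarrow> inner_point p j \<noteq> inner_point q j"
    unfolding is_ray_def eq ex using v by (auto simp: interior_vertices_iff boundary_vertices_iff)
qed

end

subsection \<open>Vertical l-edges\<close>

text \<open>Reflection in the diagonal; it carries the geometric facts about horizontal edges over
  to vertical ones.\<close>

definition swap_cell :: "cell \<Rightarrow> cell" where
  "swap_cell F = (prod.swap (fst F), prod.swap (snd F))"

definition swap_mesh :: "cell set \<Rightarrow> cell set" where
  "swap_mesh T = swap_cell ` T"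

lemma swap_cell_simps [simp]: "fst (swap_cell F) = prod.swap (fst F)" "snd (swap_cell F) = prod.swap (snd F)"
    "swap_cell (swap_cell F) = F"
  by (simp_all add: swap_cell_def)

lemma swap_cell_mem: "swap_cell F \<in> swap_mesh T \<longleftrightarrow> F \<in> T"
  unfolding swap_mesh_def by (metis image_iff swap_cell_simps(3))

lemma linear_swap: "linear (prod.swap :: point \<Rightarrow> point)"
  by (auto intro!: linearI)

lemma inj_swap': "inj (prod.swap :: point \<Rightarrow> point)"
  by simp

lemma swap_image_image [simp]: "prod.swap ` prod.swap ` S = S"
  by (simp add: image_image)

lemma mem_swap_image: "z \<in> prod.swap ` S \<longleftrightarrow> prod.swap z \<in> S"
  by (metis image_eqI imageE swap_swap)

lemma rect_swap: "rect (swap_cell F) = prod.swap ` rect F"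
  by (auto simp: mem_rect mem_swap_image set_eq_iff)

lemma domain_swap: "domain (swap_mesh T) = prod.swap ` domain T"
  by (auto simp: domain_def swap_mesh_def rect_swap)

lemma interior_swap: "interior (prod.swap ` S) = prod.swap ` interior (S :: point set)"
  by (rule interior_injective_linear_image[OF linear_swap inj_swap'])

lemma frontier_swap: "frontier (prod.swap ` S) = prod.swap ` frontier (S :: point set)"
proof -
  have "closure (prod.swap ` S) = prod.swap ` closure S"
    by (rule closure_injective_linear_image[OF linear_swap inj_swap', symmetric])
  then show ?thesis by (simp add: frontier_def interior_swap image_set_diff[OF inj_swap'])
qed

lemma vertices_swap: "vertices (swap_mesh T) = prod.swap ` vertices T"
proof -
  have "corners (swap_cell F) = prod.swap ` corners F" for F
    by (simp only: corners_def product_swap swap_cell_simps fst_swap snd_swap)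
  then show ?thesis by (auto simp: vertices_def swap_mesh_def)
qed

lemma interior_vertices_swap: "interior_vertices (swap_mesh T) = prod.swap ` interior_vertices T"
  by (auto simp: interior_vertices_def vertices_swap domain_swap frontier_swap mem_swap_image)

lemma boundary_vertices_swap: "boundary_vertices (swap_mesh T) = prod.swap ` boundary_vertices T"
  by (auto simp: boundary_vertices_def vertices_swap domain_swap frontier_swap mem_swap_image)

lemma t_mesh_swap:
  assumes "t_mesh T"
  shows "t_mesh (swap_mesh T)"
proof -
  have "rect F \<inter> rect G \<subseteq> frontier (rect F) \<inter> frontier (rect G)"
    if "F \<in> swap_mesh T" "G \<in> swap_mesh T" "F \<noteq> G" for F G
  proof -
    have "swap_cell F \<in> T" "swap_cell G \<in> T" "swap_cell F \<noteq> swap_cell G"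
      using that by (auto simp: swap_mesh_def)
    then have "rect (swap_cell F) \<inter> rect (swap_cell G) \<subseteq> frontier (rect (swap_cell F)) \<inter> frontier (rect (swap_cell G))"
      using assms unfolding t_mesh_def by blast
    then have "prod.swap ` (rect F \<inter> rect G) \<subseteq> prod.swap ` (frontier (rect F) \<inter> frontier (rect G))"
      by (simp add: rect_swap frontier_swap image_Int[OF inj_swap'])
    then show ?thesis by (simp add: inj_image_subset_iff[OF inj_swap'])
  qed
  then show ?thesis using assms unfolding t_mesh_def by (auto simp: swap_mesh_def)
qed

lemma closed_segment_swap: "prod.swap ` closed_segment u w = closed_segment (prod.swap u) (prod.swap (w :: point))"
  by (rule closed_segment_linear_image[OF linear_swap, symmetric])

lemma open_segment_swap: "prod.swap ` open_segment u w = open_segment (prod.swap u) (prod.swap (w :: point))"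
  by (rule open_segment_linear_image[OF linear_swap inj_swap', symmetric])

lemma hsides_swap: "hsides (swap_cell F) = (`) prod.swap ` vsides F"
proof -
  have "hsides G = (\<lambda>y. {fst (fst G)..fst (snd G)} \<times> {y}) ` {snd (fst G), snd (snd G)}" for G
    by (auto simp: hsides_def)
  moreover have "vsides F = (\<lambda>x. {x} \<times> {snd (fst F)..snd (snd F)}) ` {fst (fst F), fst (snd F)}"
    by (auto simp: vsides_def)
  ultimately show ?thesis
    by (simp only: swap_cell_simps fst_swap snd_swap image_image product_swap)
qed

lemma hedges_swap: "hedges (swap_mesh T) = (`) prod.swap ` vedges T"
proof
  show "(`) prod.swap ` vedges T \<subseteq> hedges (swap_mesh T)"
  proof clarify
    fix e assume "e \<in> vedges T"
    then obtain u w F s where e: "e = closed_segment u w" "u \<in> vertices T" "w \<in> vertices T" "u \<noteq> w" "F \<in> T"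
        "s \<in> vsides F" "closed_segment u w \<subseteq> s" "open_segment u w \<inter> vertices T = {}"
      unfolding vedges_def by blast
    show "prod.swap ` e \<in> hedges (swap_mesh T)"
      unfolding e(1) closed_segment_swap
    proof (rule hedges_memI)
      show "prod.swap ` s \<in> hsides (swap_cell F)" using e(6) by (simp add: hsides_swap)
      show "open_segment (prod.swap u) (prod.swap w) \<inter> vertices (swap_mesh T) = {}"
        using e(8) by (simp add: open_segment_swap[symmetric] vertices_swap image_Int[OF inj_swap', symmetric])
      show "swap_cell F \<in> swap_mesh T" using e(5) by (simp add: swap_mesh_def)
    qed (use e in \<open>auto simp: vertices_swap closed_segment_swap[symmetric] prod_eq_iff\<close>)
  qed
  show "hedges (swap_mesh T) \<subseteq> (`) prod.swap ` vedges T"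
  proof
    fix e assume "e \<in> hedges (swap_mesh T)"
    then obtain u w F s where e: "e = closed_segment u w" "u \<in> vertices (swap_mesh T)" "w \<in> vertices (swap_mesh T)"
        "u \<noteq> w" "F \<in> swap_mesh T" "s \<in> hsides F" "closed_segment u w \<subseteq> s"
        "open_segment u w \<inter> vertices (swap_mesh T) = {}"
      unfolding hedges_def by blast
    let ?u = "prod.swap u" and ?w = "prod.swap w"
    have "closed_segment ?u ?w \<in> vedges T"
      unfolding vedges_def mem_Collect_eq
    proof (rule exI[of _ ?u], rule exI[of _ ?w], intro conjI refl bexI[of _ "swap_cell F"] bexI[of _ "prod.swap ` s"])
      show "?u \<in> vertices T" "?w \<in> vertices T" using e(2,3) by (simp_all add: vertices_swap mem_swap_image)
      show "?u \<noteq> ?w" using e(4) by (auto simp: prod_eq_iff)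
      show "swap_cell F \<in> T" using e(5) by (auto simp: swap_mesh_def)
      have "s \<in> hsides (swap_cell (swap_cell F))" using e(6) by simp
      then show "prod.swap ` s \<in> vsides (swap_cell F)" unfolding hsides_swap by auto
      show "closed_segment ?u ?w \<subseteq> prod.swap ` s" using e(7) by (simp add: closed_segment_swap[symmetric] image_mono)
      have "prod.swap ` (open_segment u w \<inter> vertices (swap_mesh T)) = {}" using e(8) by simp
      then show "open_segment ?u ?w \<inter> vertices T = {}"
        by (simp add: image_Int[OF inj_swap'] open_segment_swap vertices_swap)
    qed
    moreover have "e = prod.swap ` closed_segment ?u ?w" by (simp add: closed_segment_swap e(1))
    ultimately show "e \<in> (`) prod.swap ` vedges T" by blast
  qed
qed

lemma interior_hedges_swap: "interior_hedges (swap_mesh T) = (`) prod.swap ` interior_vedges T"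
  by (auto simp: interior_hedges_def interior_vedges_def hedges_swap domain_swap frontier_swap
      inj_image_subset_iff[OF inj_swap'])

lemma composite_segment_swap:
  assumes "composite_segment E s"
  shows "composite_segment ((`) prod.swap ` E) (prod.swap ` (s :: point set))"
proof -
  obtain u w A where s: "s = closed_segment u w" "A \<subseteq> E" "s = \<Union>A"
    using assms unfolding composite_segment_def by blast
  show ?thesis
  proof (rule composite_segmentI)
    show "prod.swap ` s = closed_segment (prod.swap u) (prod.swap w)"
      unfolding s(1) by (rule closed_segment_swap)
    show "(`) prod.swap ` A \<subseteq> (`) prod.swap ` E" by (rule image_mono[OF s(2)])
    show "prod.swap ` s = \<Union>((`) prod.swap ` A)" unfolding s(3) by (rule image_Union)
  qed
qed

text \<open>Reflection is an involution, so a larger composite segment of the reflected edges would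
  reflect back to a larger one of the original edges.\<close>

lemma maximal_segments_swap_subset:
  fixes E :: "point set set"
  assumes "s \<in> maximal_segments E"
  shows "prod.swap ` s \<in> maximal_segments ((`) prod.swap ` E)"
proof -
  have E: "(`) prod.swap ` (`) prod.swap ` E = E" by (simp add: image_image)
  have "s' = prod.swap ` s" if "composite_segment ((`) prod.swap ` E) s'" "prod.swap ` s \<subseteq> s'" for s'
  proof -
    have "composite_segment E (prod.swap ` s')"
      using composite_segment_swap[OF that(1)] unfolding E .
    moreover have "s \<subseteq> prod.swap ` s'"
      using image_mono[OF that(2), of prod.swap] by simp
    ultimately have "prod.swap ` s' = s" using assms by (auto simp: maximal_segments_def)
    then show ?thesis by (metis swap_image_image)
  qed
  then show ?thesis
    using assms composite_segment_swap by (auto simp: maximal_segments_def)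
qed

lemma hl_edges_swap: "e \<in> hl_edges (swap_mesh T) \<longleftrightarrow> prod.swap ` e \<in> vl_edges T"
proof -
  have E: "(`) prod.swap ` interior_hedges (swap_mesh T) = interior_vedges T"
    by (simp add: interior_hedges_swap image_image)
  show ?thesis
    using maximal_segments_swap_subset[of e "interior_hedges (swap_mesh T)"]
      maximal_segments_swap_subset[of "prod.swap ` e" "interior_vedges T"]
    by (auto simp: hl_edges_def vl_edges_def E interior_hedges_swap[symmetric])
qed

lemma l_edge_types_swap:
  "is_interior_l_edge (swap_mesh T) (prod.swap ` e) \<longleftrightarrow> is_interior_l_edge T e"
  "is_cross_cut (swap_mesh T) (prod.swap ` e) \<longleftrightarrow> is_cross_cut T e"
  "is_ray (swap_mesh T) (prod.swap ` e) \<longleftrightarrow> is_ray T e"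
proof -
  have *: "(\<exists>u w. prod.swap ` e = closed_segment u w \<and> u \<in> prod.swap ` U \<and> w \<in> prod.swap ` W) \<longleftrightarrow>
      (\<exists>u w. e = closed_segment u w \<and> u \<in> U \<and> w \<in> W)" (is "?L \<longleftrightarrow> ?R") for U W
  proof
    assume ?L
    then obtain u w where "prod.swap ` e = closed_segment u w" "prod.swap u \<in> U" "prod.swap w \<in> W"
      by (auto simp: mem_swap_image)
    moreover from this have "e = closed_segment (prod.swap u) (prod.swap w)"
      by (metis closed_segment_swap swap_image_image)
    ultimately show ?R by blast
  next
    assume ?R
    then show ?L using closed_segment_swap by blast
  qed
  show "is_interior_l_edge (swap_mesh T) (prod.swap ` e) \<longleftrightarrow> is_interior_l_edge T e"
    unfolding is_interior_l_edge_def interior_vertices_swap by (rule *)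
  show "is_cross_cut (swap_mesh T) (prod.swap ` e) \<longleftrightarrow> is_cross_cut T e"
    unfolding is_cross_cut_def boundary_vertices_swap by (rule *)
  show "is_ray (swap_mesh T) (prod.swap ` e) \<longleftrightarrow> is_ray T e"
    unfolding is_ray_def boundary_vertices_swap interior_vertices_swap by (rule *)
qed

context mesh_grid
begin

lemma seg_subset_rect:
  assumes "F \<in> T" "p < q"
  shows "seg p q j \<subseteq> rect F \<longleftrightarrow> lf F \<le> p \<and> q \<le> rt F \<and> lw F \<le> j \<and> j \<le> hg F"
proof
  assume "seg p q j \<subseteq> rect F"
  then have "(x p, y j) \<in> rect F" "(x q, y j) \<in> rect F" using seg_ends[of p q j] assms(2) by auto
  then show "lf F \<le> p \<and> q \<le> rt F \<and> lw F \<le> j \<and> j \<le> hg F" by (simp add: mem_rect_index[OF assms(1)])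
next
  assume "lf F \<le> p \<and> q \<le> rt F \<and> lw F \<le> j \<and> j \<le> hg F"
  then have "x (lf F) \<le> x p" "x q \<le> x (rt F)" "y (lw F) \<le> y j" "y j \<le> y (hg F)" by auto
  then show "seg p q j \<subseteq> rect F" by (auto simp: mem_seg mem_rect_index[OF assms(1)] simp del: x_le y_le)
qed

text \<open>Only the cells above and below its first unit segment contain an interior edge;
  conversely each active segment is part of an edge lying in both adjacent cells. Symmetry of
  \<open>R\<close> is required because the definition of splines names the two cells in no
  order.\<close>

lemma hedge_condition:
  assumes sym: "\<And>c F G. R c F G \<Longrightarrow> R c G F"
  shows "(\<forall>e\<in>interior_hedges T. \<forall>F\<in>T. \<forall>G\<in>T. \<forall>c. F \<noteq> G \<and> e \<subseteq> rect F \<and> e \<subseteq> rect G \<and>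
        e \<subseteq> {z. snd z = c} \<longrightarrow> R c F G) \<longleftrightarrow>
      (\<forall>i j F G. covers F i j \<and> covers G i (j - 1) \<and> F \<noteq> G \<longrightarrow> R (y j) F G)" (is "?L \<longleftrightarrow> ?R")
proof
  assume L: ?L
  show ?R
  proof (intro allI impI, elim conjE)
    fix i j F G assume FG: "covers F i j" "covers G i (j - 1)" "F \<noteq> G"
    note FG' = active_above_below[OF FG]
    have T: "F \<in> T" "G \<in> T" using FG by (simp_all add: covers_def)
    obtain p q where e: "p \<le> i" "i < q" "seg p q j \<in> interior_hedges T"
      "lf F \<le> p" "q \<le> rt F" "lf G \<le> p" "q \<le> rt G"
      by (rule edge_containing[OF activeI[OF FG] FG(1,2)]) (rule that; assumption)
    have pq: "p < q" using e by simp
    have "seg p q j \<subseteq> rect F" "seg p q j \<subseteq> rect G"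
      using e FG' index_bounds[OF T(1)] index_bounds[OF T(2)] T pq by (simp_all add: seg_subset_rect)
    moreover have "seg p q j \<subseteq> {z. snd z = y j}" by (auto simp: mem_seg)
    ultimately show "R (y j) F G" using L e(3) T FG(3) by blast
  qed
next
  assume R: ?R
  show ?L
  proof (intro ballI allI impI, elim conjE)
    fix e F G c
    assume e: "e \<in> interior_hedges T" and T: "F \<in> T" "G \<in> T" "F \<noteq> G"
      and sub: "e \<subseteq> rect F" "e \<subseteq> rect G" and c: "e \<subseteq> {z. snd z = c}"
    obtain p q j where pq: "p < q" "e = seg p q j" "\<forall>k. p \<le> k \<and> k < q \<longrightarrow> active k j"
      using interior_hedges_active[OF e] by blast
    have "(x p, y j) \<in> e" using pq(1,2) by simp
    then have cj: "c = y j" using c by auto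
    have "active p j" using pq by simp
    then obtain A B where AB: "covers A p j" "covers B p (j - 1)" "A \<noteq> B" unfolding active_def by blast
    have j: "1 \<le> j" using covers_pos[OF AB(1)] by simp
    have AB_cases: "H = A \<or> H = B" if "H \<in> T" "e \<subseteq> rect H" for H
    proof -
      have "lf H \<le> p" "q \<le> rt H" "lw H \<le> j" "j \<le> hg H"
        using that pq(1,2) by (simp_all add: seg_subset_rect)
      then have "covers H p j \<or> covers H p (j - 1)"
        using that(1) pq(1) j index_bounds[OF that(1)] by (auto simp: covers_def)
      then show ?thesis using covers_unique AB by blast
    qed
    have "R (y j) A B" using R AB by blast
    then show "R c F G"
      using AB_cases[OF T(1) sub(1)] AB_cases[OF T(2) sub(2)] T(3) sym unfolding cj by blast
  qed
qed

section \<open>Transfer of the horizontal results by reflection\<close>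

definition vseg :: "nat \<Rightarrow> nat \<Rightarrow> nat \<Rightarrow> point set" where
  "vseg p q i = {x i} \<times> {y p..y q}"

text \<open>With the coordinate sequences exchanged as well, the reflected mesh has the same indices
  as the transposed mesh \<open>tr\<close>.\<close>

lemma swap_grid: "mesh_grid (swap_mesh T) y x"
proof
  show "t_mesh (swap_mesh T)" by (rule t_mesh_swap[OF mesh])
  show "strict_mono y" "strict_mono x" by (rule y_mono x_mono)+
  fix F assume "F \<in> swap_mesh T"
  then obtain G where "G \<in> T" "F = swap_cell G" by (auto simp: swap_mesh_def)
  then show "fst (fst F) \<in> y ` {1..} \<and> fst (snd F) \<in> y ` {1..} \<and> snd (fst F) \<in> x ` {1..} \<and> snd (snd F) \<in> x ` {1..}"
    using grid by simp
qed

interpretation sw: mesh_grid "swap_mesh T" y x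
  by (rule swap_grid)

lemma sw_index: "sw.lf (swap_cell F) = lw F" "sw.rt (swap_cell F) = hg F"
    "sw.lw (swap_cell F) = lf F" "sw.hg (swap_cell F) = rt F"
  by (simp_all add: sw.lf_def sw.rt_def sw.lw_def sw.hg_def lf_def rt_def lw_def hg_def)

lemma sw_covers: "sw.covers (swap_cell F) j i \<longleftrightarrow> covers F i j"
  by (auto simp: sw.covers_def covers_def sw_index swap_cell_mem)

lemma sw_covers': "sw.covers F j i \<longleftrightarrow> covers (swap_cell F) i j"
  using sw_covers[of "swap_cell F"] by simp

lemma sw_covered: "sw.covered j i \<longleftrightarrow> tr.covered j i"
  unfolding sw.covered_def tr.covered_def sw_covers' tr_covers by (metis swap_cell_simps(3))

lemma swap_cell_eq_iff: "swap_cell F = swap_cell G \<longleftrightarrow> F = G"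
  by (metis swap_cell_simps(3))

lemma sw_active: "sw.active j i \<longleftrightarrow> tr.active j i"
  unfolding sw.active_def tr.active_def sw_covers' tr_covers by (metis swap_cell_simps(3))

lemma sw_run: "sw.run p q i \<longleftrightarrow> tr.run p q i"
  by (simp add: sw.run_def tr.run_def sw_active)

lemma sw_inner: "sw.inner_point j i \<longleftrightarrow> inner_point i j"
  by (auto simp: sw.inner_point_def inner_point_def sw_covered tr_covered)

lemma sw_seg: "sw.seg p q i = prod.swap ` vseg p q i"
  by (auto simp: sw.seg_def vseg_def)

lemma vseg_sw: "vseg p q i = prod.swap ` sw.seg p q i"
  by (simp add: sw_seg)

lemma vl_edges_iff: "e \<in> vl_edges T \<longleftrightarrow> (\<exists>p q i. e = vseg p q i \<and> tr.run p q i)"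
proof -
  have "e \<in> vl_edges T \<longleftrightarrow> prod.swap ` e \<in> hl_edges (swap_mesh T)"
    by (simp add: hl_edges_swap)
  also have "\<dots> \<longleftrightarrow> (\<exists>p q i. prod.swap ` e = sw.seg p q i \<and> tr.run p q i)"
    unfolding sw.hl_edges_iff sw_run ..
  also have "\<dots> \<longleftrightarrow> (\<exists>p q i. e = vseg p q i \<and> tr.run p q i)"
    unfolding vseg_sw by (metis swap_image_image)
  finally show ?thesis .
qed

lemma vl_edge_types:
  assumes "tr.run p q i"
  shows "is_interior_l_edge T (vseg p q i) \<longleftrightarrow> inner_point i p \<and> inner_point i q"
    and "is_cross_cut T (vseg p q i) \<longleftrightarrow> \<not> inner_point i p \<and> \<not> inner_point i q"
    and "is_ray T (vseg p q i) \<longleftrightarrow> inner_point i p \<noteq> inner_point i q"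
  using sw.l_edge_types[of p q i] assms
  unfolding sw_run sw_seg l_edge_types_swap sw_inner by simp_all

lemma vseg_eq: "p \<le> q \<Longrightarrow> p' \<le> q' \<Longrightarrow> vseg p q i = vseg p' q' i' \<longleftrightarrow> p' = p \<and> q' = q \<and> i' = i"
  using sw.seg_eq[of p q p' q' i i'] unfolding sw_seg by (simp add: inj_image_eq_iff[OF inj_swap'])

lemma grid_mem_vseg [simp]: "(x l, y k) \<in> vseg p q i \<longleftrightarrow> p \<le> k \<and> k \<le> q \<and> l = i"
  by (auto simp: vseg_def)

lemma vedge_condition:
  assumes sym: "\<And>c F G. R c F G \<Longrightarrow> R c G F"
  shows "(\<forall>e\<in>interior_vedges T. \<forall>F\<in>T. \<forall>G\<in>T. \<forall>c. F \<noteq> G \<and> e \<subseteq> rect F \<and> e \<subseteq> rect G \<and>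
        e \<subseteq> {z. fst z = c} \<longrightarrow> R c F G) \<longleftrightarrow>
      (\<forall>i j F G. covers F i j \<and> covers G (i - 1) j \<and> F \<noteq> G \<longrightarrow> R (x i) F G)"
proof -
  have ball: "(\<forall>F\<in>swap_mesh T. P F) \<longleftrightarrow> (\<forall>F\<in>T. P (swap_cell F))" for P
    by (simp add: swap_mesh_def)
  have line: "prod.swap ` e \<subseteq> {z. snd z = c} \<longleftrightarrow> e \<subseteq> {z. fst z = c}" for e :: "point set" and c
    by auto
  have "(\<forall>e\<in>interior_vedges T. \<forall>F\<in>T. \<forall>G\<in>T. \<forall>c. F \<noteq> G \<and> e \<subseteq> rect F \<and> e \<subseteq> rect G \<and>
        e \<subseteq> {z. fst z = c} \<longrightarrow> R c F G) \<longleftrightarrow>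
      (\<forall>e\<in>interior_hedges (swap_mesh T). \<forall>F\<in>swap_mesh T. \<forall>G\<in>swap_mesh T. \<forall>c. F \<noteq> G \<and> e \<subseteq> rect F \<and>
        e \<subseteq> rect G \<and> e \<subseteq> {z. snd z = c} \<longrightarrow> R c (swap_cell F) (swap_cell G))"
    by (simp add: interior_hedges_swap ball rect_swap swap_cell_eq_iff inj_image_subset_iff[OF inj_swap'] line)
  also have "\<dots> \<longleftrightarrow> (\<forall>j i F G. sw.covers F j i \<and> sw.covers G j (i - 1) \<and> F \<noteq> G \<longrightarrow> R (x i) (swap_cell F) (swap_cell G))"
    by (rule sw.hedge_condition) (rule sym)
  also have "\<dots> \<longleftrightarrow> (\<forall>i j F G. covers F i j \<and> covers G (i - 1) j \<and> F \<noteq> G \<longrightarrow> R (x i) F G)"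
    unfolding sw_covers' by (metis swap_cell_simps(3))
  finally show ?thesis .
qed

end

subsection \<open>Splines on the grid\<close>

text \<open>For fixed y the polynomial in x has infinitely many roots; then \<open>p\<close>, as a
  polynomial in y over the polynomials in x, has infinitely many constant roots.\<close>

lemma bieval_eq_0_on_box:
  assumes "a < b" "c < d" "\<And>s t. s \<in> {a..b} \<Longrightarrow> t \<in> {c..d} \<Longrightarrow> bieval p (s, t) = 0"
  shows "p = 0"
proof -
  have *: "poly p [:t:] = 0" if "t \<in> {c..d}" for t
  proof (rule ccontr)
    assume "poly p [:t:] \<noteq> 0"
    then have "finite {s. poly (poly p [:t:]) s = 0}" by (rule poly_roots_finite)
    moreover have "{a..b} \<subseteq> {s. poly (poly p [:t:]) s = 0}"
      using assms(3) that by (auto simp: bieval_def)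
    ultimately show False using infinite_Icc[OF assms(1)] finite_subset by blast
  qed
  show "p = 0"
  proof (rule ccontr)
    assume "p \<noteq> 0"
    then have "finite {q. poly p q = 0}" by (rule poly_roots_finite)
    moreover have "(\<lambda>t. [:t:]) ` {c..d} \<subseteq> {q. poly p q = 0}" using * by auto
    ultimately have "finite ((\<lambda>t. [:t:] :: real poly) ` {c..d})" using finite_subset by blast
    then have "finite {c..d}" by (rule finite_imageD) (auto simp: inj_on_def)
    then show False using infinite_Icc[OF assms(2)] by blast
  qed
qed

locale spline_mesh = mesh_grid +
  fixes d1 d2 \<alpha> \<beta> :: nat
  assumes \<alpha>: "\<alpha> < d1" and \<beta>: "\<beta> < d2" and reg: "regular T" and holes: "without_holes T"
begin

abbreviation xpow :: "nat \<Rightarrow> bipoly" where "xpow i \<equiv> X_minus (x i) ^ (\<alpha> + 1)"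
abbreviation ypow :: "nat \<Rightarrow> bipoly" where "ypow j \<equiv> Y_minus (y j) ^ (\<beta> + 1)"

text \<open>The pieces belong to boxes rather than cells and the edge cofactors to unit segments.
  Setting the cofactors to 0 on inactive segments makes them determined by \<open>f\<close>, also
  inside cells and outside the domain.\<close>

definition grid_spline :: "(nat \<Rightarrow> nat \<Rightarrow> bipoly) \<Rightarrow> (nat \<Rightarrow> nat \<Rightarrow> bipoly) \<Rightarrow> (nat \<Rightarrow> nat \<Rightarrow> bipoly) \<Rightarrow>
    (point \<Rightarrow> real) \<Rightarrow> bool" where
  "grid_spline Q h v f \<longleftrightarrow>
    (\<forall>z. z \<notin> domain T \<longrightarrow> f z = 0) \<and>
    (\<forall>i j. covered i j \<longrightarrow> bidegree_le d1 d2 (Q i j) \<and> (\<forall>z\<in>gbox i j. f z = bieval (Q i j) z)) \<and>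
    (\<forall>i j. covered i j \<and> covered i (j - 1) \<longrightarrow> Q i j - Q i (j - 1) = h i j * ypow j) \<and>
    (\<forall>i j. covered i j \<and> covered (i - 1) j \<longrightarrow> Q i j - Q (i - 1) j = v i j * xpow i) \<and>
    (\<forall>i j. \<not> active i j \<longrightarrow> h i j = 0) \<and> (\<forall>i j. \<not> tr.active j i \<longrightarrow> v i j = 0)"

lemma grid_splineD:
  assumes "grid_spline Q h v f"
  shows "z \<notin> domain T \<Longrightarrow> f z = 0"
    and "covered i j \<Longrightarrow> bidegree_le d1 d2 (Q i j)"
    and "covered i j \<Longrightarrow> z \<in> gbox i j \<Longrightarrow> f z = bieval (Q i j) z"
    and "covered i j \<Longrightarrow> covered i (j - 1) \<Longrightarrow> Q i j - Q i (j - 1) = h i j * ypow j"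
    and "covered i j \<Longrightarrow> covered (i - 1) j \<Longrightarrow> Q i j - Q (i - 1) j = v i j * xpow i"
    and "\<not> active i j \<Longrightarrow> h i j = 0" and "\<not> tr.active j i \<Longrightarrow> v i j = 0"
  using assms unfolding grid_spline_def by blast+

lemma spline_space_iff_pieces:
  "f \<in> spline_space d1 d2 \<alpha> \<beta> T \<longleftrightarrow>
     (\<forall>z. z \<notin> domain T \<longrightarrow> f z = 0) \<and>
     (\<exists>P. (\<forall>F\<in>T. bidegree_le d1 d2 (P F) \<and> (\<forall>z\<in>rect F. f z = bieval (P F) z)) \<and>
       (\<forall>i j F G. covers F i j \<and> covers G (i - 1) j \<and> F \<noteq> G \<longrightarrow> xpow i dvd P F - P G) \<and>
       (\<forall>i j F G. covers F i j \<and> covers G i (j - 1) \<and> F \<noteq> G \<longrightarrow> ypow j dvd P F - P G))"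
proof -
  have sym: "q dvd P G - P F" if "q dvd P F - P G" for q :: bipoly and P :: "cell \<Rightarrow> bipoly" and F G
    using that by (metis dvd_minus_iff minus_diff_eq)
  have v: "(\<forall>e\<in>interior_vedges T. \<forall>F\<in>T. \<forall>G\<in>T. \<forall>c. F \<noteq> G \<and> e \<subseteq> rect F \<and> e \<subseteq> rect G \<and>
        e \<subseteq> {z. fst z = c} \<longrightarrow> X_minus c ^ (\<alpha> + 1) dvd P F - P G) \<longleftrightarrow>
      (\<forall>i j F G. covers F i j \<and> covers G (i - 1) j \<and> F \<noteq> G \<longrightarrow> xpow i dvd P F - P G)" for P
    by (rule vedge_condition) (rule sym)
  have h: "(\<forall>e\<in>interior_hedges T. \<forall>F\<in>T. \<forall>G\<in>T. \<forall>c. F \<noteq> G \<and> e \<subseteq> rect F \<and> e \<subseteq> rect G \<and>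
        e \<subseteq> {z. snd z = c} \<longrightarrow> Y_minus c ^ (\<beta> + 1) dvd P F - P G) \<longleftrightarrow>
      (\<forall>i j F G. covers F i j \<and> covers G i (j - 1) \<and> F \<noteq> G \<longrightarrow> ypow j dvd P F - P G)" for P
    by (rule hedge_condition) (rule sym)
  show ?thesis unfolding spline_space_def mem_Collect_eq v h by (rule refl)
qed

text \<open>Each covered box receives the polynomial of its cell. Across active segments
  divisibility provides the cofactor; elsewhere two covered neighbours share a cell and 0 is a valid
  choice.\<close>

lemma grid_spline_exists:
  assumes "f \<in> spline_space d1 d2 \<alpha> \<beta> T"
  shows "\<exists>Q h v. grid_spline Q h v f"
proof -
  note spline = assms[unfolded spline_space_iff_pieces]
  have supp: "f z = 0" if "z \<notin> domain T" for z by (rule conjunct1[OF spline, rule_format, OF that])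
  obtain P where
    "(\<forall>F\<in>T. bidegree_le d1 d2 (P F) \<and> (\<forall>z\<in>rect F. f z = bieval (P F) z)) \<and>
     (\<forall>i j F G. covers F i j \<and> covers G (i - 1) j \<and> F \<noteq> G \<longrightarrow> xpow i dvd P F - P G) \<and>
     (\<forall>i j F G. covers F i j \<and> covers G i (j - 1) \<and> F \<noteq> G \<longrightarrow> ypow j dvd P F - P G)"
    using conjunct2[OF spline] by (rule exE)
  note pieces = conjunct1[OF this] conjunct1[OF conjunct2[OF this]] conjunct2[OF conjunct2[OF this]]
  have P: "\<And>F. F \<in> T \<Longrightarrow> bidegree_le d1 d2 (P F)" "\<And>F z. F \<in> T \<Longrightarrow> z \<in> rect F \<Longrightarrow> f z = bieval (P F) z"
    using pieces(1) by simp_all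
  have PX: "xpow i dvd P F - P G" if "covers F i j" "covers G (i - 1) j" "F \<noteq> G" for i j F G
    using pieces(2)[rule_format, OF conjI[OF that(1) conjI[OF that(2,3)]]] .
  have PY: "ypow j dvd P F - P G" if "covers F i j" "covers G i (j - 1)" "F \<noteq> G" for i j F G
    using pieces(3)[rule_format, OF conjI[OF that(1) conjI[OF that(2,3)]]] .
  define c where "c i j = (SOME F. covers F i j)" for i j
  have c: "covers (c i j) i j" if "covered i j" for i j
    using that unfolding c_def covered_def by (rule someI_ex)
  define Q where "Q i j = P (c i j)" for i j
  have "\<exists>k. (covered i j \<and> covered i (j - 1) \<longrightarrow> Q i j - Q i (j - 1) = k * ypow j) \<and> (\<not> active i j \<longrightarrow> k = 0)" for i j
  proof (cases "active i j")
    case True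
    have covered: "covered i j" "covered i (j - 1)" using active_covered[OF True] by simp_all
    have "c i j \<noteq> c i (j - 1)"
      using True c[OF covered(1)] c[OF covered(2)] covers_unique unfolding active_def by metis
    then have "ypow j dvd Q i j - Q i (j - 1)"
      unfolding Q_def by (intro PY[OF c[OF covered(1)] c[OF covered(2)]])
    then obtain k where "Q i j - Q i (j - 1) = ypow j * k" by (elim dvdE)
    then show ?thesis using True by (intro exI[of _ k]) (simp add: mult.commute)
  next
    case False
    have "Q i j - Q i (j - 1) = 0" if "covered i j" "covered i (j - 1)"
      using covers_same_if_not_active[OF False c[OF that(1)] c[OF that(2)]] by (simp add: Q_def)
    then show ?thesis by (intro exI[of _ 0]) simp
  qed
  then obtain h where h: "\<And>i j. (covered i j \<and> covered i (j - 1) \<longrightarrow> Q i j - Q i (j - 1) = h i j * ypow j) \<and> (\<not> active i j \<longrightarrow> h i j = 0)"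
    by metis
  have "\<exists>k. (covered i j \<and> covered (i - 1) j \<longrightarrow> Q i j - Q (i - 1) j = k * xpow i) \<and> (\<not> tr.active j i \<longrightarrow> k = 0)" for i j
  proof (cases "tr.active j i")
    case True
    have covered: "covered i j" "covered (i - 1) j" using tr.active_covered[OF True] by (simp_all add: tr_covered)
    have "c i j \<noteq> c (i - 1) j"
      using True c[OF covered(1)] c[OF covered(2)] covers_unique unfolding tr.active_def tr_covers by metis
    then have "xpow i dvd Q i j - Q (i - 1) j"
      unfolding Q_def by (intro PX[OF c[OF covered(1)] c[OF covered(2)]])
    then obtain k where "Q i j - Q (i - 1) j = xpow i * k" by (elim dvdE)
    then show ?thesis using True by (intro exI[of _ k]) (simp add: mult.commute)
  next
    case False
    have "Q i j - Q (i - 1) j = 0" if "covered i j" "covered (i - 1) j"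
    proof -
      have "c i j = c (i - 1) j"
        using tr.covers_same_if_not_active[OF False, unfolded tr_covers] c[OF that(1)] c[OF that(2)] by blast
      then show ?thesis by (simp only: Q_def diff_self)
    qed
    then show ?thesis by (intro exI[of _ 0]) simp
  qed
  then obtain v where v: "\<And>i j. (covered i j \<and> covered (i - 1) j \<longrightarrow> Q i j - Q (i - 1) j = v i j * xpow i) \<and> (\<not> tr.active j i \<longrightarrow> v i j = 0)"
    by metis
  have "bidegree_le d1 d2 (Q i j)" "\<forall>z\<in>gbox i j. f z = bieval (Q i j) z" if "covered i j" for i j
  proof -
    have "c i j \<in> T" using c[OF that] by (simp add: covers_def)
    then show "bidegree_le d1 d2 (Q i j)" "\<forall>z\<in>gbox i j. f z = bieval (Q i j) z"
      using P(1)[of "c i j"] P(2)[of "c i j"] gbox_subset_rect[OF c[OF that]] unfolding Q_def by blast+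
  qed
  then have "grid_spline Q h v f"
    unfolding grid_spline_def using supp h v by blast
  then show ?thesis by blast
qed

text \<open>Segments inside a cell are inactive and carry no jump, so \<open>Q\<close> is constant
  on each cell and yields one piece per cell.\<close>

lemma grid_spline_in_spline_space:
  assumes "grid_spline Q h v f"
  shows "f \<in> spline_space d1 d2 \<alpha> \<beta> T"
proof -
  note Q = grid_splineD[OF assms]
  have coveredI: "covered i j" if "covers F i j" for F i j using that unfolding covered_def by blast
  define P where "P F = Q (lf F) (lw F)" for F :: cell
  have QP: "Q i j = P F" if "covers F i j" for i j F
    unfolding P_def
  proof (rule constant_on_cell[OF _ _ that])
    fix i j
    show "Q i j = Q i (j - 1)" if F: "covers F i j" "covers F i (j - 1)"
    proof -
      have "\<not> active i j" using F covers_unique unfolding active_def by blast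
      then show ?thesis using Q(4)[OF coveredI[OF F(1)] coveredI[OF F(2)]] Q(6)[of i j] by simp
    qed
    show "Q i j = Q (i - 1) j" if F: "covers F i j" "covers F (i - 1) j"
    proof -
      have "\<not> tr.active j i" using F covers_unique unfolding tr.active_def tr_covers by blast
      then show ?thesis using Q(5)[OF coveredI[OF F(1)] coveredI[OF F(2)]] Q(7)[of j i] by simp
    qed
  qed
  show ?thesis
    unfolding spline_space_iff_pieces
  proof (intro conjI exI[of _ P] allI ballI impI; (elim conjE)?)
    fix z assume "z \<notin> domain T" then show "f z = 0" by (rule Q(1))
  next
    fix F assume F: "F \<in> T"
    have "covers F (lf F) (lw F)" using index_bounds[OF F] F by (simp add: covers_def)
    then show "bidegree_le d1 d2 (P F)" using Q(2) coveredI by (simp add: P_def)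
  next
    fix F z assume F: "F \<in> T" "z \<in> rect F"
    then obtain i j where ij: "covers F i j" "z \<in> gbox i j" by (rule rect_gbox)
    then show "f z = bieval (P F) z" using Q(3)[OF coveredI[OF ij(1)] ij(2)] QP[OF ij(1)] by simp
  next
    fix i j F G assume FG: "covers F i j" "covers G (i - 1) j"
    show "xpow i dvd P F - P G"
      using Q(5)[OF coveredI[OF FG(1)] coveredI[OF FG(2)]] QP[OF FG(1)] QP[OF FG(2)] by simp
  next
    fix i j F G assume FG: "covers F i j" "covers G i (j - 1)"
    show "ypow j dvd P F - P G"
      using Q(4)[OF coveredI[OF FG(1)] coveredI[OF FG(2)]] QP[OF FG(1)] QP[OF FG(2)] by simp
  qed
qed

text \<open>Both sides are the mixed second difference of \<open>Q\<close> over the four boxes at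
  the point.\<close>

lemma grid_spline_curl:
  assumes "grid_spline Q h v f" "inner_point i j"
  shows "(h i j - h (i - 1) j) * ypow j = (v i j - v i (j - 1)) * xpow i"
proof -
  have c: "covered i j" "covered (i - 1) j" "covered i (j - 1)" "covered (i - 1) (j - 1)"
    using assms(2) by (simp_all add: inner_point_def)
  have "(h i j - h (i - 1) j) * ypow j =
      (Q i j - Q i (j - 1)) - (Q (i - 1) j - Q (i - 1) (j - 1))"
    unfolding grid_splineD(4)[OF assms(1) c(1,3)] grid_splineD(4)[OF assms(1) c(2,4)] left_diff_distrib ..
  also have "\<dots> = (Q i j - Q (i - 1) j) - (Q i (j - 1) - Q (i - 1) (j - 1))" by simp
  also have "\<dots> = (v i j - v i (j - 1)) * xpow i"
    unfolding grid_splineD(5)[OF assms(1) c(1,2)] grid_splineD(5)[OF assms(1) c(3,4)] left_diff_distrib ..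
  finally show ?thesis .
qed

lemma grid_spline_bidegree:
  assumes "grid_spline Q h v f"
  shows "bidegree_le d1 (d2 - \<beta> - 1) (h i j)" "bidegree_le (d1 - \<alpha> - 1) d2 (v i j)"
proof -
  show "bidegree_le d1 (d2 - \<beta> - 1) (h i j)"
  proof (cases "active i j")
    case True
    have c: "covered i j" "covered i (j - 1)" using active_covered[OF True] by simp_all
    have "bidegree_le d1 d2 (h i j * ypow j)"
      unfolding grid_splineD(4)[OF assms c, symmetric]
      by (intro bidegree_le_diff grid_splineD(2)[OF assms] c)
    from bidegree_le_Y_minus_cancel[OF this] show ?thesis by simp
  qed (simp add: grid_splineD(6)[OF assms])
  show "bidegree_le (d1 - \<alpha> - 1) d2 (v i j)"
  proof (cases "tr.active j i")
    case True
    have c: "covered i j" "covered (i - 1) j" using tr.active_covered[OF True] by (simp_all add: tr_covered)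
    have "bidegree_le d1 d2 (v i j * xpow i)"
      unfolding grid_splineD(5)[OF assms c, symmetric]
      by (intro bidegree_le_diff grid_splineD(2)[OF assms] c)
    from bidegree_le_X_minus_cancel[OF this] \<alpha> show ?thesis by simp
  qed (simp add: grid_splineD(7)[OF assms])
qed

text \<open>On a common side the factor \<open>xpow\<close> or \<open>ypow\<close> vanishes, so the
  pieces agree there. Boxes meeting only in a corner are covered by \<open>touching_gboxes\<close>,
  which makes \<open>f\<close> well defined.\<close>

lemma grid_spline_from_pieces:
  assumes deg: "\<And>i j. covered i j \<Longrightarrow> bidegree_le d1 d2 (Q i j)"
    and Qh: "\<And>i j. covered i j \<Longrightarrow> covered i (j - 1) \<Longrightarrow> Q i j - Q i (j - 1) = h i j * ypow j"
    and Qv: "\<And>i j. covered i j \<Longrightarrow> covered (i - 1) j \<Longrightarrow> Q i j - Q (i - 1) j = v i j * xpow i"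
    and h0: "\<And>i j. \<not> active i j \<Longrightarrow> h i j = 0" and v0: "\<And>i j. \<not> tr.active j i \<Longrightarrow> v i j = 0"
  shows "\<exists>f. grid_spline Q h v f"
proof -
  define f where "f z = (if z \<in> domain T then (SOME r. \<exists>i j. covered i j \<and> z \<in> gbox i j \<and> r = bieval (Q i j) z) else 0)" for z
  have f: "f z = bieval (Q i j) z" if ij: "covered i j" "z \<in> gbox i j" for i j z
  proof -
    have "z \<in> domain T" using gbox_subset_domain[OF ij(1)] ij(2) by blast
    have "\<exists>i' j'. covered i' j' \<and> z \<in> gbox i' j' \<and> f z = bieval (Q i' j') z"
      unfolding f_def using \<open>z \<in> domain T\<close> ij
      by simp (rule someI_ex[of "\<lambda>r. \<exists>i j. covered i j \<and> z \<in> gbox i j \<and> r = bieval (Q i j) z"], blast)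
    then obtain i' j' where ij': "covered i' j'" "z \<in> gbox i' j'" "f z = bieval (Q i' j') z" by blast
    have "bieval (Q i j) z = bieval (Q i' j') z"
    proof (rule touching_gboxes[OF reg ij(1) ij'(1) ij(2) ij'(2)])
      fix i j assume c: "covered i j" "covered i (j - 1)" and z: "z \<in> gbox i j" "z \<in> gbox i (j - 1)"
      have "1 \<le> j" using covered_pos[OF c(1)] by simp
      then have "snd z = y j" using z by (simp add: mem_gbox)
      then have "bieval (Q i j - Q i (j - 1)) z = 0" unfolding Qh[OF c] by simp
      then show "bieval (Q i j) z = bieval (Q i (j - 1)) z" by simp
    next
      fix i j assume c: "covered i j" "covered (i - 1) j" and z: "z \<in> gbox i j" "z \<in> gbox (i - 1) j"
      have "1 \<le> i" using covered_pos[OF c(1)] by simp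
      then have "fst z = x i" using z by (simp add: mem_gbox)
      then have "bieval (Q i j - Q (i - 1) j) z = 0" unfolding Qv[OF c] by simp
      then show "bieval (Q i j) z = bieval (Q (i - 1) j) z" by simp
    qed
    then show ?thesis using ij'(3) by simp
  qed
  have "grid_spline Q h v f"
    unfolding grid_spline_def using deg Qh Qv h0 v0 f by (auto simp: f_def[of z for z])
  then show ?thesis by blast
qed

section \<open>Linear combinations and the zero spline\<close>

lemma grid_spline_add:
  assumes "grid_spline Q h v f" "grid_spline Q' h' v' f'"
  shows "grid_spline (\<lambda>i j. Q i j + Q' i j) (\<lambda>i j. h i j + h' i j) (\<lambda>i j. v i j + v' i j) (f + f')"
proof -
  note 1 = grid_splineD[OF assms(1)] and 2 = grid_splineD[OF assms(2)]
  show ?thesis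
    unfolding grid_spline_def
  proof (intro conjI allI impI ballI; (elim conjE)?)
    fix i j assume c: "covered i j" "covered i (j - 1)"
    have "Q i j + Q' i j - (Q i (j - 1) + Q' i (j - 1)) = (Q i j - Q i (j - 1)) + (Q' i j - Q' i (j - 1))" by simp
    then show "Q i j + Q' i j - (Q i (j - 1) + Q' i (j - 1)) = (h i j + h' i j) * ypow j"
      unfolding 1(4)[OF c] 2(4)[OF c] by (simp only: distrib_right)
  next
    fix i j assume c: "covered i j" "covered (i - 1) j"
    have "Q i j + Q' i j - (Q (i - 1) j + Q' (i - 1) j) = (Q i j - Q (i - 1) j) + (Q' i j - Q' (i - 1) j)" by simp
    then show "Q i j + Q' i j - (Q (i - 1) j + Q' (i - 1) j) = (v i j + v' i j) * xpow i"
      unfolding 1(5)[OF c] 2(5)[OF c] by (simp only: distrib_right)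
  qed (use 1(1-3,6,7) 2(1-3,6,7) in \<open>simp_all add: bidegree_le_add\<close>)
qed

lemma grid_spline_scale:
  assumes "grid_spline Q h v f"
  shows "grid_spline (\<lambda>i j. cst r * Q i j) (\<lambda>i j. cst r * h i j) (\<lambda>i j. cst r * v i j) (r *\<^sub>R f)"
proof -
  note 1 = grid_splineD[OF assms(1)]
  show ?thesis
    unfolding grid_spline_def
  proof (intro conjI allI impI ballI; (elim conjE)?)
    fix i j assume c: "covered i j" "covered i (j - 1)"
    show "cst r * Q i j - cst r * Q i (j - 1) = cst r * h i j * ypow j"
      unfolding mult.assoc 1(4)[OF c, symmetric] by (simp only: right_diff_distrib)
  next
    fix i j assume c: "covered i j" "covered (i - 1) j"
    show "cst r * Q i j - cst r * Q (i - 1) j = cst r * v i j * xpow i"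
      unfolding mult.assoc 1(5)[OF c, symmetric] by (simp only: right_diff_distrib)
  next
    fix i j assume "covered i j"
    then show "bidegree_le d1 d2 (cst r * Q i j)"
      using bidegree_le_mult[OF bidegree_le_cst[of 0 0 r] 1(2)] by simp
  qed (use 1(1-3,6,7) in \<open>simp_all add: scaleR_fun_def\<close>)
qed

lemma grid_spline_zero:
  assumes "grid_spline Q h v f" "\<And>i j. h i j = 0" "\<And>i j. v i j = 0" "covered i0 j0" "Q i0 j0 = 0"
  shows "f = 0"
proof
  fix z
  show "f z = 0 z"
  proof (cases "z \<in> domain T")
    case True
    then obtain i j where ij: "covered i j" "z \<in> gbox i j" unfolding domain_iff by blast
    have conn: "connected (domain T)" using holes by (simp add: without_holes_def)
    have "Q i j = Q i0 j0"
    proof (rule covered_connected[OF reg conn ij(1) assms(4)])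
      show "Q i j = Q i (j - 1)" if "covered i j" "covered i (j - 1)" for i j
        using grid_splineD(4)[OF assms(1) that] assms(2) by simp
      show "Q i j = Q (i - 1) j" if "covered i j" "covered (i - 1) j" for i j
        using grid_splineD(5)[OF assms(1) that] assms(3) by simp
    qed
    then show ?thesis using grid_splineD(3)[OF assms(1) ij] assms(5) by simp
  qed (use grid_splineD(1)[OF assms(1)] in simp)
qed

text \<open>A polynomial vanishing on a box is 0; then the jumps are 0, and the powers of the linear
  factors cancel.\<close>

lemma grid_spline_of_zero:
  assumes "grid_spline Q h v 0"
  shows "covered i j \<Longrightarrow> Q i j = 0" "h i j = 0" "v i j = 0"
proof -
  have Q: "Q i j = 0" if "covered i j" for i j
  proof (rule bieval_eq_0_on_box[of "x i" "x (Suc i)" "y j" "y (Suc j)"])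
    fix s t assume "s \<in> {x i..x (Suc i)}" "t \<in> {y j..y (Suc j)}"
    then show "bieval (Q i j) (s, t) = 0"
      using grid_splineD(3)[OF assms that, of "(s, t)"] by (simp add: mem_gbox)
  qed simp_all
  then show "covered i j \<Longrightarrow> Q i j = 0" .
  show "h i j = 0"
  proof (cases "active i j")
    case True
    have c: "covered i j" "covered i (j - 1)" using active_covered[OF True] by simp_all
    have "h i j * ypow j = 0"
      unfolding grid_splineD(4)[OF assms c, symmetric] using Q[OF c(1)] Q[OF c(2)] by simp
    then show ?thesis using Y_minus_power_neq_0 by (simp only: mult_eq_0_iff) blast
  qed (rule grid_splineD(6)[OF assms])
  show "v i j = 0"
  proof (cases "tr.active j i")
    case True
    have c: "covered i j" "covered (i - 1) j" using tr.active_covered[OF True] by (simp_all add: tr_covered)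
    have "v i j * xpow i = 0"
      unfolding grid_splineD(5)[OF assms c, symmetric] using Q[OF c(1)] Q[OF c(2)] by simp
    then show ?thesis using X_minus_power_neq_0 by (simp only: mult_eq_0_iff) blast
  qed (rule grid_splineD(7)[OF assms])
qed

end

subsection \<open>The conformality conditions\<close>

lemma coeff_cst_mult: "coeff (coeff (cst r * p) j) i = r * coeff (coeff p j) i"
  by (simp add: cst_def)

lemma bipoly_eq_0_iff_coeffs:
  assumes "bidegree_le k l p"
  shows "p = 0 \<longleftrightarrow> (\<forall>i\<le>k. \<forall>j\<le>l. coeff (coeff p j) i = 0)"
proof
  assume z: "\<forall>i\<le>k. \<forall>j\<le>l. coeff (coeff p j) i = 0"
  have "coeff (coeff p j) i = 0" for i j
  proof (cases "i \<le> k \<and> j \<le> l")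
    case False
    then show ?thesis
    proof (cases "j \<le> l")
      case True
      then have "degree (coeff p j) < i" using False assms by (auto simp: bidegree_le_def intro: le_less_trans)
      then show ?thesis by (rule coeff_eq_0)
    next
      case False
      then have "degree p < j" using assms by (auto simp: bidegree_le_def)
      then have "coeff p j = 0" by (rule coeff_eq_0)
      then show ?thesis by simp
    qed
  qed (use z in simp)
  then show "p = 0" by (simp add: poly_eq_iff)
qed simp

text \<open>Extracting a coefficient is linear, so a matrix row applied to a vector is a coefficient
  of one polynomial. The monomials \<open>M\<close> are left open to serve rows of both
  directions.\<close>

lemma sum_columns:
  assumes "finite N"
  shows "(\<Sum>c\<in>N \<times> {..<k} \<times> {..<l}. (if fst c \<in> e then coeff (coeff (M (fst c) (fst (snd c)) (snd (snd c))) j) i else 0) * f c) =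
    coeff (coeff (\<Sum>v\<in>N \<inter> e. \<Sum>p<k. \<Sum>q<l. cst (f (v, p, q)) * M v p q) j) i"
proof -
  have "(\<Sum>c\<in>N \<times> {..<k} \<times> {..<l}. (if fst c \<in> e then coeff (coeff (M (fst c) (fst (snd c)) (snd (snd c))) j) i else 0) * f c) =
      (\<Sum>v\<in>N. \<Sum>p<k. \<Sum>q<l. (if v \<in> e then coeff (coeff (M v p q) j) i else 0) * f (v, p, q))"
    by (simp add: sum.cartesian_product case_prod_beta)
  also have "\<dots> = (\<Sum>v\<in>N. if v \<in> e then \<Sum>p<k. \<Sum>q<l. f (v, p, q) * coeff (coeff (M v p q) j) i else 0)"
    by (intro sum.cong refl) (simp add: mult.commute)
  also have "\<dots> = (\<Sum>v\<in>N \<inter> e. \<Sum>p<k. \<Sum>q<l. f (v, p, q) * coeff (coeff (M v p q) j) i)"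
    by (rule sum.inter_restrict[OF assms, symmetric])
  also have "\<dots> = coeff (coeff (\<Sum>v\<in>N \<inter> e. \<Sum>p<k. \<Sum>q<l. cst (f (v, p, q)) * M v p q) j) i"
    by (simp add: coeff_sum coeff_cst_mult)
  finally show ?thesis .
qed

context spline_mesh
begin

text \<open>The value 0 at all other grid points allows sums over all indices of a run.\<close>

definition vertex_cofactor :: "(mat_col \<Rightarrow> real) \<Rightarrow> nat \<Rightarrow> nat \<Rightarrow> bipoly" where
  "vertex_cofactor c i j = (if vertex i j \<and> inner_point i j
     then cofactor_poly (x i) (y j) (d1 - \<alpha>) (d2 - \<beta>) (\<lambda>p q. c ((x i, y j), p, q)) else 0)"

lemma vertex_cofactor_add: "vertex_cofactor (c + c') i j = vertex_cofactor c i j + vertex_cofactor c' i j"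
  by (simp add: vertex_cofactor_def cofactor_poly_add)

lemma vertex_cofactor_scale: "vertex_cofactor (r *\<^sub>R c) i j = cst r * vertex_cofactor c i j"
  by (simp add: vertex_cofactor_def cofactor_poly_scale scaleR_fun_def)

lemma bidegree_le_vertex_cofactor: "bidegree_le (d1 - \<alpha> - 1) (d2 - \<beta> - 1) (vertex_cofactor c i j)"
  unfolding vertex_cofactor_def using bidegree_le_cofactor_poly[of "d1 - \<alpha>" "d2 - \<beta>"] by simp

lemma bidegree_le_row_jump: "bidegree_le d1 (d2 - \<beta> - 1) (vertex_cofactor c i j * X_minus a ^ (\<alpha> + 1))"
  using bidegree_le_mult[OF bidegree_le_vertex_cofactor bidegree_le_X_minus_power[of "\<alpha> + 1" a]] \<alpha>
  by (simp del: power_Suc)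

lemma bidegree_le_column_jump: "bidegree_le (d1 - \<alpha> - 1) d2 (vertex_cofactor c i j * Y_minus b ^ (\<beta> + 1))"
  using bidegree_le_mult[OF bidegree_le_vertex_cofactor bidegree_le_Y_minus_power[of "\<beta> + 1" b]] \<beta>
  by (simp del: power_Suc)

lemma finite_vertices: "finite (vertices T)"
  using finite_T by (auto simp: vertices_def corners_def)

lemma finite_interior_vertices: "finite (interior_vertices T)" and finite_free_vertices: "finite (free_vertices T)"
  using finite_vertices by (auto simp: interior_vertices_def free_vertices_def)

lemma finite_ccm_cols: "finite (ccm_cols d1 d2 \<alpha> \<beta> T)"
  by (simp add: ccm_cols_def finite_interior_vertices)

lemma interior_vertices_cases:
  assumes "v \<in> interior_vertices T"
  obtains i j where "v = (x i, y j)" "vertex i j" "inner_point i j"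
proof -
  have "v \<in> vertices T" using assms by (simp add: interior_vertices_def)
  then obtain i j where "v = (x i, y j)" "vertex i j" unfolding vertices_iff by blast
  then show ?thesis using that assms interior_vertices_iff by blast
qed

text \<open>The interior l-edge is the only horizontal l-edge through the point, whereas a
  free-vertex needs a cross-cut or a ray there.\<close>

lemma free_vertex_not_on_interior_row:
  assumes "run p q j" "inner_point p j" "inner_point q j" "p \<le> k" "k \<le> q"
  shows "(x k, y j) \<notin> free_vertices T"
proof
  assume "(x k, y j) \<in> free_vertices T"
  then obtain e where e: "e \<in> hl_edges T" "(x k, y j) \<in> e" "is_cross_cut T e \<or> is_ray T e"
    by (auto simp: free_vertices_def)
  then obtain p' q' j' where r: "e = seg p' q' j'" "run p' q' j'" unfolding hl_edges_iff by blast
  then have k: "p' \<le> k" "k \<le> q'" "j' = j" using e(2) by auto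
  then have "p' = p" "q' = q" using run_unique[OF assms(1), of p' q' k] r(2) assms by auto
  then show False using e(3) l_edge_types(2,3)[OF assms(1)] assms(2,3) r(1) k(3) by simp
qed

lemma free_vertex_not_on_interior_column:
  assumes "tr.run p q i" "inner_point i p" "inner_point i q" "p \<le> k" "k \<le> q"
  shows "(x i, y k) \<notin> free_vertices T"
proof
  assume "(x i, y k) \<in> free_vertices T"
  then obtain e where e: "e \<in> vl_edges T" "(x i, y k) \<in> e" "is_cross_cut T e \<or> is_ray T e"
    by (auto simp: free_vertices_def)
  then obtain p' q' i' where r: "e = vseg p' q' i'" "tr.run p' q' i'" unfolding vl_edges_iff by blast
  then have k: "p' \<le> k" "k \<le> q'" "i' = i" using e(2) by auto
  then have "p' = p" "q' = q" using tr.run_unique[OF assms(1), of p' q' k] r(2) assms by auto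
  then show False using e(3) vl_edge_types(2,3)[OF assms(1)] assms(2,3) r(1) k(3) by simp
qed

lemma row_equations:
  assumes "run p q j" "inner_point p j" "inner_point q j"
  shows "(\<Sum>c\<in>ccm_cols d1 d2 \<alpha> \<beta> T. ccm \<alpha> \<beta> (Inl (seg p q j, i, l)) c * f c) =
    coeff (coeff (\<Sum>k=p..q. vertex_cofactor f k j * xpow k) l) i"
proof -
  let ?N = "interior_vertices T - free_vertices T" and ?e = "seg p q j"
  let ?M = "\<lambda>v a b. X_minus (fst v) ^ a * Y_minus (snd v) ^ b * X_minus (fst v) ^ (\<alpha> + 1)"
  let ?K = "{k \<in> {p..q}. vertex k j \<and> inner_point k j}"
  \<comment> \<open>Excluding the free-vertices from the columns loses nothing on an interior
    l-edge, since none of them lies on it.\<close>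
  have N: "?N \<inter> ?e = (\<lambda>k. (x k, y j)) ` ?K"
  proof (intro equalityI subsetI)
    fix v assume v: "v \<in> ?N \<inter> ?e"
    then obtain k l where "v = (x k, y l)" "vertex k l" "inner_point k l"
      using interior_vertices_cases[of v] by blast
    then show "v \<in> (\<lambda>k. (x k, y j)) ` ?K" using v by auto
  next
    fix v assume "v \<in> (\<lambda>k. (x k, y j)) ` ?K"
    then show "v \<in> ?N \<inter> ?e"
      using free_vertex_not_on_interior_row[OF assms] by (auto simp: interior_vertices_iff)
  qed
  have "ccm \<alpha> \<beta> (Inl (?e, i, l)) c =
      (if fst c \<in> ?e then coeff (coeff (?M (fst c) (fst (snd c)) (snd (snd c))) l) i else 0)" for c
    by (cases c) (simp del: power_Suc)
  then have "(\<Sum>c\<in>ccm_cols d1 d2 \<alpha> \<beta> T. ccm \<alpha> \<beta> (Inl (?e, i, l)) c * f c) =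
      coeff (coeff (\<Sum>v\<in>?N \<inter> ?e. \<Sum>a<d1 - \<alpha>. \<Sum>b<d2 - \<beta>. cst (f (v, a, b)) * ?M v a b) l) i"
    unfolding ccm_cols_def using sum_columns[where N = ?N and e = ?e and M = ?M and f = f] finite_interior_vertices by simp
  also have "(\<Sum>v\<in>?N \<inter> ?e. \<Sum>a<d1 - \<alpha>. \<Sum>b<d2 - \<beta>. cst (f (v, a, b)) * ?M v a b) =
      (\<Sum>k\<in>?K. \<Sum>a<d1 - \<alpha>. \<Sum>b<d2 - \<beta>. cst (f ((x k, y j), a, b)) * ?M (x k, y j) a b)"
    unfolding N by (rule sum.reindex_cong[of "\<lambda>k. (x k, y j)"]) (auto simp: inj_on_def)
  also have "\<dots> = (\<Sum>k\<in>?K. vertex_cofactor f k j * xpow k)"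
    by (intro sum.cong refl) (simp add: vertex_cofactor_def cofactor_poly_def sum_distrib_right mult.assoc del: power_Suc)
  also have "\<dots> = (\<Sum>k=p..q. vertex_cofactor f k j * xpow k)"
    by (rule sum.mono_neutral_left) (auto simp: vertex_cofactor_def)
  finally show ?thesis .
qed

lemma column_equations:
  assumes "tr.run p q i" "inner_point i p" "inner_point i q"
  shows "(\<Sum>c\<in>ccm_cols d1 d2 \<alpha> \<beta> T. ccm \<alpha> \<beta> (Inr (vseg p q i, m, l)) c * f c) =
    coeff (coeff (\<Sum>k=p..q. vertex_cofactor f i k * ypow k) l) m"
proof -
  let ?N = "interior_vertices T - free_vertices T" and ?e = "vseg p q i"
  let ?M = "\<lambda>v a b. X_minus (fst v) ^ a * Y_minus (snd v) ^ b * Y_minus (snd v) ^ (\<beta> + 1)"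
  let ?K = "{k \<in> {p..q}. vertex i k \<and> inner_point i k}"
  have N: "?N \<inter> ?e = (\<lambda>k. (x i, y k)) ` ?K"
  proof (intro equalityI subsetI)
    fix v assume v: "v \<in> ?N \<inter> ?e"
    then obtain l k where "v = (x l, y k)" "vertex l k" "inner_point l k"
      using interior_vertices_cases[of v] by blast
    then show "v \<in> (\<lambda>k. (x i, y k)) ` ?K" using v by auto
  next
    fix v assume "v \<in> (\<lambda>k. (x i, y k)) ` ?K"
    then show "v \<in> ?N \<inter> ?e"
      using free_vertex_not_on_interior_column[OF assms] by (auto simp: interior_vertices_iff)
  qed
  have "ccm \<alpha> \<beta> (Inr (?e, m, l)) c =
      (if fst c \<in> ?e then coeff (coeff (?M (fst c) (fst (snd c)) (snd (snd c))) l) m else 0)" for c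
    by (cases c) (simp del: power_Suc)
  then have "(\<Sum>c\<in>ccm_cols d1 d2 \<alpha> \<beta> T. ccm \<alpha> \<beta> (Inr (?e, m, l)) c * f c) =
      coeff (coeff (\<Sum>v\<in>?N \<inter> ?e. \<Sum>a<d1 - \<alpha>. \<Sum>b<d2 - \<beta>. cst (f (v, a, b)) * ?M v a b) l) m"
    unfolding ccm_cols_def using sum_columns[where N = ?N and e = ?e and M = ?M and f = f] finite_interior_vertices by simp
  also have "(\<Sum>v\<in>?N \<inter> ?e. \<Sum>a<d1 - \<alpha>. \<Sum>b<d2 - \<beta>. cst (f (v, a, b)) * ?M v a b) =
      (\<Sum>k\<in>?K. \<Sum>a<d1 - \<alpha>. \<Sum>b<d2 - \<beta>. cst (f ((x i, y k), a, b)) * ?M (x i, y k) a b)"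
    unfolding N by (rule sum.reindex_cong[of "\<lambda>k. (x i, y k)"]) (auto simp: inj_on_def)
  also have "\<dots> = (\<Sum>k\<in>?K. vertex_cofactor f i k * ypow k)"
    by (intro sum.cong refl) (simp add: vertex_cofactor_def cofactor_poly_def sum_distrib_right mult.assoc del: power_Suc)
  also have "\<dots> = (\<Sum>k=p..q. vertex_cofactor f i k * ypow k)"
    by (rule sum.mono_neutral_left) (auto simp: vertex_cofactor_def)
  finally show ?thesis .
qed

text \<open>The scalar rows of an l-edge test all coefficients within the bidegree of its
  conformality sum, so together they say that this polynomial is 0.\<close>

lemma ccm_kernel_iff:
  "f \<in> ccm_kernel d1 d2 \<alpha> \<beta> T \<longleftrightarrow> f \<in> supported_on (ccm_cols d1 d2 \<alpha> \<beta> T) \<and>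
    (\<forall>p q j. run p q j \<and> inner_point p j \<and> inner_point q j \<longrightarrow>
       (\<Sum>k=p..q. vertex_cofactor f k j * xpow k) = 0) \<and>
    (\<forall>p q i. tr.run p q i \<and> inner_point i p \<and> inner_point i q \<longrightarrow>
       (\<Sum>k=p..q. vertex_cofactor f i k * ypow k) = 0)"
proof -
  let ?cols = "ccm_cols d1 d2 \<alpha> \<beta> T"
  have h: "e \<in> interior_hl_edges T \<longleftrightarrow> (\<exists>p q j. e = seg p q j \<and> run p q j \<and> inner_point p j \<and> inner_point q j)" for e
    unfolding interior_hl_edges_def mem_Collect_eq hl_edges_iff using l_edge_types(1) by blast
  have v: "e \<in> interior_vl_edges T \<longleftrightarrow> (\<exists>p q i. e = vseg p q i \<and> tr.run p q i \<and> inner_point i p \<and> inner_point i q)" for e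
    unfolding interior_vl_edges_def mem_Collect_eq vl_edges_iff using vl_edge_types(1) by blast
  have rows: "(\<forall>r\<in>ccm_rows d1 d2 \<alpha> \<beta> T. (\<Sum>c\<in>?cols. ccm \<alpha> \<beta> r c * f c) = 0) \<longleftrightarrow>
    (\<forall>e\<in>interior_hl_edges T. \<forall>i\<le>d1. \<forall>l<d2 - \<beta>. (\<Sum>c\<in>?cols. ccm \<alpha> \<beta> (Inl (e, i, l)) c * f c) = 0) \<and>
    (\<forall>e\<in>interior_vl_edges T. \<forall>i<d1 - \<alpha>. \<forall>l\<le>d2. (\<Sum>c\<in>?cols. ccm \<alpha> \<beta> (Inr (e, i, l)) c * f c) = 0)"
    unfolding ccm_rows_def by (auto simp: Plus_def)
  have hrow: "(\<forall>i\<le>d1. \<forall>l<d2 - \<beta>. (\<Sum>c\<in>?cols. ccm \<alpha> \<beta> (Inl (seg p q j, i, l)) c * f c) = 0) \<longleftrightarrow>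
      (\<Sum>k=p..q. vertex_cofactor f k j * xpow k) = 0"
    if "run p q j" "inner_point p j" "inner_point q j" for p q j
  proof -
    \<comment> \<open>The rows use a strict bound and \<open>bidegree_le\<close> a weak one; the two
      agree because \<beta> is less than d2.\<close>
    have "l < d2 - \<beta> \<longleftrightarrow> l \<le> d2 - \<beta> - 1" for l using \<beta> by auto
    moreover have "bidegree_le d1 (d2 - \<beta> - 1) (\<Sum>k=p..q. vertex_cofactor f k j * xpow k)"
      by (intro bidegree_le_sum bidegree_le_row_jump)
    ultimately show ?thesis
      unfolding row_equations[OF that] by (simp only: bipoly_eq_0_iff_coeffs)
  qed
  have vrow: "(\<forall>i<d1 - \<alpha>. \<forall>l\<le>d2. (\<Sum>c\<in>?cols. ccm \<alpha> \<beta> (Inr (vseg p q m, i, l)) c * f c) = 0) \<longleftrightarrow>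
      (\<Sum>k=p..q. vertex_cofactor f m k * ypow k) = 0"
    if "tr.run p q m" "inner_point m p" "inner_point m q" for p q m
  proof -
    have "l < d1 - \<alpha> \<longleftrightarrow> l \<le> d1 - \<alpha> - 1" for l using \<alpha> by auto
    moreover have "bidegree_le (d1 - \<alpha> - 1) d2 (\<Sum>k=p..q. vertex_cofactor f m k * ypow k)"
      by (intro bidegree_le_sum bidegree_le_column_jump)
    ultimately show ?thesis
      unfolding column_equations[OF that] by (simp only: bipoly_eq_0_iff_coeffs)
  qed
  have "(\<forall>e\<in>interior_hl_edges T. P e) \<longleftrightarrow>
      (\<forall>p q j. run p q j \<and> inner_point p j \<and> inner_point q j \<longrightarrow> P (seg p q j))" for P
    unfolding Ball_def h by blast
  moreover have "(\<forall>e\<in>interior_vl_edges T. P e) \<longleftrightarrow>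
      (\<forall>p q i. tr.run p q i \<and> inner_point i p \<and> inner_point i q \<longrightarrow> P (vseg p q i))" for P
    unfolding Ball_def v by blast
  ultimately show ?thesis
    unfolding ccm_kernel_def matrix_kernel_def mem_Collect_eq rows supported_on_def
    by (simp only: hrow vrow cong: conj_cong imp_cong)
qed

end

subsection \<open>Parametrising splines\<close>

lemma sum_jumps:
  fixes f :: "nat \<Rightarrow> 'a::ab_group_add"
  assumes "1 \<le> p" "p \<le> q"
  shows "(\<Sum>k=p..q. f k - f (k - 1)) = f q - f (p - 1)"
  using assms(2)
proof (induction rule: dec_induct)
  case (step n)
  then show ?case using assms(1) sum_split_last[of "Suc n" p "\<lambda>k. f k - f (k - 1)"] by simp
qed simp

lemma cofactor_poly_cong:
  assumes "\<And>p q. p < k \<Longrightarrow> q < l \<Longrightarrow> f p q = g p q"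
  shows "cofactor_poly a b k l f = cofactor_poly a b k l g"
  unfolding cofactor_poly_def by (intro sum.cong refl) (use assms in auto)

lemma subspace_matrix_kernel: "subspace (matrix_kernel R C M)"
proof (rule subspaceI)
  fix f g assume "f \<in> matrix_kernel R C M" "g \<in> matrix_kernel R C M"
  then show "f + g \<in> matrix_kernel R C M"
    by (auto simp: matrix_kernel_def distrib_left sum.distrib)
next
  fix r f assume "f \<in> matrix_kernel R C M"
  then show "r *\<^sub>R f \<in> matrix_kernel R C M"
    by (auto simp: matrix_kernel_def scaleR_fun_def mult.left_commute[of _ r] sum_distrib_left[symmetric])
qed (auto simp: matrix_kernel_def)

context spline_mesh
begin

text \<open>A horizontal edge cofactor has bidegree (d1, d2 - \<beta> - 1), hence
  \<open>(d1 + 1) * (d2 - \<beta>)\<close> coefficients, which are stored under the point set of the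
  cross-cut.\<close>

definition row_start :: "(point set \<times> nat \<times> nat \<Rightarrow> real) \<Rightarrow> nat \<Rightarrow> nat \<Rightarrow> nat \<Rightarrow> bipoly" where
  "row_start a p q j = cofactor_poly 0 0 (d1 + 1) (d2 - \<beta>) (\<lambda>k l. a (seg p q j, k, l))"

definition column_start :: "(point set \<times> nat \<times> nat \<Rightarrow> real) \<Rightarrow> nat \<Rightarrow> nat \<Rightarrow> nat \<Rightarrow> bipoly" where
  "column_start a p q i = cofactor_poly 0 0 (d1 - \<alpha>) (d2 + 1) (\<lambda>k l. a (vseg p q i, k, l))"

definition base_poly :: "(nat \<times> nat \<Rightarrow> real) \<Rightarrow> bipoly" where
  "base_poly a = cofactor_poly 0 0 (d1 + 1) (d2 + 1) (\<lambda>k l. a (k, l))"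

text \<open>The jumps determine a spline only up to a global polynomial, which the piece on the
  reference box (i0, j0) fixes.\<close>

definition param_data :: "nat \<Rightarrow> nat \<Rightarrow> (nat \<times> nat \<Rightarrow> real) \<Rightarrow> (point set \<times> nat \<times> nat \<Rightarrow> real) \<Rightarrow>
    (point set \<times> nat \<times> nat \<Rightarrow> real) \<Rightarrow> (mat_col \<Rightarrow> real) \<Rightarrow>
    (nat \<Rightarrow> nat \<Rightarrow> bipoly) \<Rightarrow> (nat \<Rightarrow> nat \<Rightarrow> bipoly) \<Rightarrow> (nat \<Rightarrow> nat \<Rightarrow> bipoly) \<Rightarrow> bool" where
  "param_data i0 j0 a ah av c Q h v \<longleftrightarrow>
    (\<forall>i j. inner_point i j \<longrightarrow> h i j - h (i - 1) j = vertex_cofactor c i j * xpow i) \<and>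
    (\<forall>i j. inner_point i j \<longrightarrow> v i j - v i (j - 1) = vertex_cofactor c i j * ypow j) \<and>
    (\<forall>p q j. run p q j \<longrightarrow> \<not> inner_point p j \<longrightarrow> \<not> inner_point q j \<longrightarrow> h p j = row_start ah p q j) \<and>
    (\<forall>p q i. tr.run p q i \<longrightarrow> \<not> inner_point i p \<longrightarrow> \<not> inner_point i q \<longrightarrow> v i p = column_start av p q i) \<and>
    Q i0 j0 = base_poly a"

lemma param_dataD:
  assumes "param_data i0 j0 a ah av c Q h v"
  shows "inner_point i j \<Longrightarrow> h i j - h (i - 1) j = vertex_cofactor c i j * xpow i"
    "inner_point i j \<Longrightarrow> v i j - v i (j - 1) = vertex_cofactor c i j * ypow j"
    "run p q j \<Longrightarrow> \<not> inner_point p j \<Longrightarrow> \<not> inner_point q j \<Longrightarrow> h p j = row_start ah p q j"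
    "tr.run p q i \<Longrightarrow> \<not> inner_point i p \<Longrightarrow> \<not> inner_point i q \<Longrightarrow> v i p = column_start av p q i"
    "Q i0 j0 = base_poly a"
  using assms unfolding param_data_def by blast+

definition param_spline :: "nat \<Rightarrow> nat \<Rightarrow> (nat \<times> nat \<Rightarrow> real) \<Rightarrow> (point set \<times> nat \<times> nat \<Rightarrow> real) \<Rightarrow>
    (point set \<times> nat \<times> nat \<Rightarrow> real) \<Rightarrow> (mat_col \<Rightarrow> real) \<Rightarrow> (point \<Rightarrow> real) \<Rightarrow> bool" where
  "param_spline i0 j0 a ah av c f \<longleftrightarrow> (\<exists>Q h v. grid_spline Q h v f \<and> param_data i0 j0 a ah av c Q h v)"

lemma param_splineI:
  assumes "grid_spline Q h v f"
    "\<And>i j. inner_point i j \<Longrightarrow> h i j - h (i - 1) j = vertex_cofactor c i j * xpow i"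
    "\<And>i j. inner_point i j \<Longrightarrow> v i j - v i (j - 1) = vertex_cofactor c i j * ypow j"
    "\<And>p q j. run p q j \<Longrightarrow> \<not> inner_point p j \<Longrightarrow> \<not> inner_point q j \<Longrightarrow> h p j = row_start ah p q j"
    "\<And>p q i. tr.run p q i \<Longrightarrow> \<not> inner_point i p \<Longrightarrow> \<not> inner_point i q \<Longrightarrow> v i p = column_start av p q i"
    "Q i0 j0 = base_poly a"
  shows "param_spline i0 j0 a ah av c f"
proof -
  have "param_data i0 j0 a ah av c Q h v"
    unfolding param_data_def by (intro conjI allI impI) (rule assms(2-6); assumption)+
  then show ?thesis unfolding param_spline_def using assms(1) by blast
qed

lemma param_spline_in_spline_space:
  "param_spline i0 j0 a ah av c f \<Longrightarrow> f \<in> spline_space d1 d2 \<alpha> \<beta> T"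
  unfolding param_spline_def using grid_spline_in_spline_space by blast

lemma param_spline_add:
  assumes "param_spline i0 j0 a ah av c f" "param_spline i0 j0 a' ah' av' c' f'"
  shows "param_spline i0 j0 (a + a') (ah + ah') (av + av') (c + c') (f + f')"
proof -
  obtain Q h v where G1: "grid_spline Q h v f" and D1: "param_data i0 j0 a ah av c Q h v"
    using assms(1) unfolding param_spline_def by blast
  note 1 = G1 param_dataD[OF D1]
  obtain Q' h' v' where G2: "grid_spline Q' h' v' f'" and D2: "param_data i0 j0 a' ah' av' c' Q' h' v'"
    using assms(2) unfolding param_spline_def by blast
  note 2 = G2 param_dataD[OF D2]
  show ?thesis
  proof (rule param_splineI[OF grid_spline_add[OF 1(1) 2(1)]])
    fix i j assume ij: "inner_point i j"
    have "h i j + h' i j - (h (i - 1) j + h' (i - 1) j) = (h i j - h (i - 1) j) + (h' i j - h' (i - 1) j)" by simp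
    then show "h i j + h' i j - (h (i - 1) j + h' (i - 1) j) = vertex_cofactor (c + c') i j * xpow i"
      unfolding 1(2)[OF ij] 2(2)[OF ij] vertex_cofactor_add by (simp only: distrib_right)
    have "v i j + v' i j - (v i (j - 1) + v' i (j - 1)) = (v i j - v i (j - 1)) + (v' i j - v' i (j - 1))" by simp
    then show "v i j + v' i j - (v i (j - 1) + v' i (j - 1)) = vertex_cofactor (c + c') i j * ypow j"
      unfolding 1(3)[OF ij] 2(3)[OF ij] vertex_cofactor_add by (simp only: distrib_right)
  next
    fix p q j assume r: "run p q j" "\<not> inner_point p j" "\<not> inner_point q j"
    show "h p j + h' p j = row_start (ah + ah') p q j"
      unfolding 1(4)[OF r] 2(4)[OF r] by (simp only: row_start_def plus_fun_apply cofactor_poly_add)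
  next
    fix p q i assume r: "tr.run p q i" "\<not> inner_point i p" "\<not> inner_point i q"
    show "v i p + v' i p = column_start (av + av') p q i"
      unfolding 1(5)[OF r] 2(5)[OF r] by (simp only: column_start_def plus_fun_apply cofactor_poly_add)
  next
    show "Q i0 j0 + Q' i0 j0 = base_poly (a + a')"
      unfolding 1(6) 2(6) by (simp only: base_poly_def plus_fun_apply cofactor_poly_add)
  qed
qed

lemma param_spline_scale:
  assumes "param_spline i0 j0 a ah av c f"
  shows "param_spline i0 j0 (r *\<^sub>R a) (r *\<^sub>R ah) (r *\<^sub>R av) (r *\<^sub>R c) (r *\<^sub>R f)"
proof -
  obtain Q h v where G1: "grid_spline Q h v f" and D1: "param_data i0 j0 a ah av c Q h v"
    using assms(1) unfolding param_spline_def by blast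
  note 1 = G1 param_dataD[OF D1]
  show ?thesis
  proof (rule param_splineI[OF grid_spline_scale[OF 1(1)]])
    fix i j assume ij: "inner_point i j"
    show "cst r * h i j - cst r * h (i - 1) j = vertex_cofactor (r *\<^sub>R c) i j * xpow i"
      unfolding right_diff_distrib[symmetric] 1(2)[OF ij] vertex_cofactor_scale mult.assoc ..
    show "cst r * v i j - cst r * v i (j - 1) = vertex_cofactor (r *\<^sub>R c) i j * ypow j"
      unfolding right_diff_distrib[symmetric] 1(3)[OF ij] vertex_cofactor_scale mult.assoc ..
  next
    fix p q j assume run: "run p q j" "\<not> inner_point p j" "\<not> inner_point q j"
    show "cst r * h p j = row_start (r *\<^sub>R ah) p q j"
      unfolding 1(4)[OF run] by (simp only: row_start_def scaleR_fun_def real_scaleR_def cofactor_poly_scale)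
  next
    fix p q i assume run: "tr.run p q i" "\<not> inner_point i p" "\<not> inner_point i q"
    show "cst r * v i p = column_start (r *\<^sub>R av) p q i"
      unfolding 1(5)[OF run] by (simp only: column_start_def scaleR_fun_def real_scaleR_def cofactor_poly_scale)
  next
    show "cst r * Q i0 j0 = base_poly (r *\<^sub>R a)"
      unfolding 1(6) by (simp only: base_poly_def scaleR_fun_def real_scaleR_def cofactor_poly_scale)
  qed
qed

text \<open>Zero jumps and zero start values leave one global polynomial, which is 0 on the
  reference box.\<close>

lemma param_spline_right_zero:
  assumes "param_spline i0 j0 0 0 0 0 f" "covered i0 j0"
  shows "f = 0"
proof -
  obtain Q h v where G1: "grid_spline Q h v f" and D1: "param_data i0 j0 0 0 0 0 Q h v"
    using assms(1) unfolding param_spline_def by blast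
  note 1 = G1 param_dataD[OF D1]
  have z: "vertex_cofactor 0 i j = 0" "row_start 0 p q j = 0" "column_start 0 p q j = 0" "base_poly 0 = 0" for i j p q
    by (simp_all add: vertex_cofactor_def row_start_def column_start_def base_poly_def)
  have "h i j = 0" for i j
  proof (rule row_uniqueness)
    show "h i j - h (i - 1) j = 0" if "inner_point i j" for i j
      unfolding 1(2)[OF that] z by simp
    show "h p j = 0" if "run p q j" "\<not> inner_point p j" "\<not> inner_point q j" for p q j
      unfolding 1(4)[OF that] z ..
  qed (rule grid_splineD(6)[OF 1(1)])
  moreover have "v j i = 0" for i j
  proof (rule tr.row_uniqueness[of "\<lambda>i j. v j i"], unfold tr_inner)
    show "v i j - v i (j - 1) = 0" if "inner_point i j" for i j
      unfolding 1(3)[OF that] z by simp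
    show "v i p = 0" if "tr.run p q i" "\<not> inner_point i p" "\<not> inner_point i q" for p q i
      unfolding 1(5)[OF that] z ..
  qed (rule grid_splineD(7)[OF 1(1)])
  ultimately show ?thesis
    using grid_spline_zero[OF 1(1) _ _ assms(2)] 1(6) z by simp
qed

section \<open>Cross-cuts as runs\<close>

lemma cross_cutI: "run p q j \<Longrightarrow> \<not> inner_point p j \<Longrightarrow> \<not> inner_point q j \<Longrightarrow> seg p q j \<in> hcross_cuts T"
  using l_edge_types(2) hl_edges_iff by (auto simp: hcross_cuts_def)

lemma vcross_cutI: "tr.run p q i \<Longrightarrow> \<not> inner_point i p \<Longrightarrow> \<not> inner_point i q \<Longrightarrow> vseg p q i \<in> vcross_cuts T"
  using vl_edge_types(2) vl_edges_iff by (auto simp: vcross_cuts_def)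

lemma cross_cutE:
  assumes "e \<in> hcross_cuts T"
  obtains p q j where "e = seg p q j" "run p q j" "\<not> inner_point p j" "\<not> inner_point q j"
proof -
  obtain p q j where "e = seg p q j" "run p q j"
    using assms hl_edges_iff by (auto simp: hcross_cuts_def)
  then show ?thesis using that l_edge_types(2)[of p q j] assms by (auto simp: hcross_cuts_def)
qed

lemma vcross_cutE:
  assumes "e \<in> vcross_cuts T"
  obtains p q i where "e = vseg p q i" "tr.run p q i" "\<not> inner_point i p" "\<not> inner_point i q"
proof -
  obtain p q i where "e = vseg p q i" "tr.run p q i"
    using assms vl_edges_iff by (auto simp: vcross_cuts_def)
  then show ?thesis using that vl_edge_types(2)[of p q i] assms by (auto simp: vcross_cuts_def)
qed

lemma (in index_mesh) finite_runs: "finite {(p, q, j). run p q j}"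
proof -
  obtain M where M: "\<And>i j. active i j \<Longrightarrow> i < M \<and> j < M" using active_bound by blast
  have "p < M \<and> q \<le> M \<and> j < M" if "run p q j" for p q j
  proof -
    have "p < q" using that by (simp add: run_def)
    then have "active p j" "active (q - 1) j" using run_active[OF that] by simp_all
    then show ?thesis using M[of p j] M[of "q - 1" j] by linarith
  qed
  then have "{(p, q, j). run p q j} \<subseteq> {..M} \<times> {..M} \<times> {..M}" by fastforce
  then show ?thesis by (rule finite_subset) simp
qed

lemma finite_cross_cuts: "finite (hcross_cuts T)" and finite_vcross_cuts: "finite (vcross_cuts T)"
proof -
  have "hcross_cuts T \<subseteq> (\<lambda>(p, q, j). seg p q j) ` {(p, q, j). run p q j}"
    by (auto simp: hcross_cuts_def hl_edges_iff)
  then show "finite (hcross_cuts T)" by (rule finite_subset) (intro finite_imageI finite_runs)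
  have "vcross_cuts T \<subseteq> (\<lambda>(p, q, i). vseg p q i) ` {(p, q, i). tr.run p q i}"
    by (auto simp: vcross_cuts_def vl_edges_iff)
  then show "finite (vcross_cuts T)" by (rule finite_subset) (intro finite_imageI tr.finite_runs)
qed

text \<open>The pieces and edge cofactors of the zero spline are 0, and every parameter is an
  expansion coefficient of one of them or of a vertex cofactor obtained from their jumps.\<close>

lemma param_spline_left_zero:
  assumes "param_spline i0 j0 a ah av c 0" "covered i0 j0"
  shows "k < d1 + 1 \<Longrightarrow> l < d2 + 1 \<Longrightarrow> a (k, l) = 0"
    and "e \<in> hcross_cuts T \<Longrightarrow> k < d1 + 1 \<Longrightarrow> l < d2 - \<beta> \<Longrightarrow> ah (e, k, l) = 0"
    and "e \<in> vcross_cuts T \<Longrightarrow> k < d1 - \<alpha> \<Longrightarrow> l < d2 + 1 \<Longrightarrow> av (e, k, l) = 0"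
    and "w \<in> interior_vertices T \<Longrightarrow> k < d1 - \<alpha> \<Longrightarrow> l < d2 - \<beta> \<Longrightarrow> c (w, k, l) = 0"
proof -
  obtain Q h v where G1: "grid_spline Q h v 0" and D1: "param_data i0 j0 a ah av c Q h v"
    using assms(1) unfolding param_spline_def by blast
  note 1 = G1 param_dataD[OF D1]
  note z = grid_spline_of_zero[OF 1(1)]
  show "a (k, l) = 0" if "k < d1 + 1" "l < d2 + 1"
    by (rule cofactor_poly_eq_0[OF _ that, where g = "\<lambda>k l. a (k, l)"])
      (use 1(6) z(1)[OF assms(2)] in \<open>simp add: base_poly_def\<close>)
  show "ah (e, k, l) = 0" if e: "e \<in> hcross_cuts T" and kl: "k < d1 + 1" "l < d2 - \<beta>"
  proof -
    obtain p q j where p: "e = seg p q j" "run p q j" "\<not> inner_point p j" "\<not> inner_point q j"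
      using cross_cutE[OF e] .
    show ?thesis
      by (rule cofactor_poly_eq_0[OF _ kl, where g = "\<lambda>k l. ah (e, k, l)"])
        (use 1(4)[OF p(2-4)] z(2) p(1) in \<open>simp add: row_start_def\<close>)
  qed
  show "av (e, k, l) = 0" if e: "e \<in> vcross_cuts T" and kl: "k < d1 - \<alpha>" "l < d2 + 1"
  proof -
    obtain p q i where p: "e = vseg p q i" "tr.run p q i" "\<not> inner_point i p" "\<not> inner_point i q"
      using vcross_cutE[OF e] .
    show ?thesis
      by (rule cofactor_poly_eq_0[OF _ kl, where g = "\<lambda>k l. av (e, k, l)"])
        (use 1(5)[OF p(2-4)] z(3) p(1) in \<open>simp add: column_start_def\<close>)
  qed
  show "c (w, k, l) = 0" if w: "w \<in> interior_vertices T" and kl: "k < d1 - \<alpha>" "l < d2 - \<beta>"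
  proof -
    obtain i j where ij: "w = (x i, y j)" "vertex i j" "inner_point i j"
      using interior_vertices_cases[OF w] .
    have "vertex_cofactor c i j * xpow i = 0"
      using 1(2)[OF ij(3)] z(2) by simp
    then have "vertex_cofactor c i j = 0" using X_minus_power_neq_0 by (simp only: mult_eq_0_iff) blast
    then show ?thesis
      by (intro cofactor_poly_eq_0[OF _ kl, where g = "\<lambda>k l. c (w, k, l)"]) (use ij in \<open>simp add: vertex_cofactor_def\<close>)
  qed
qed

text \<open>Rows and columns are integrated separately; the common \<open>vertex_cofactor\<close>
  makes the jumps curl-free at inner points, and \<open>potential_exists\<close> then supplies the
  pieces.\<close>

lemma param_spline_exists:
  assumes ker_h: "\<And>p q j. run p q j \<Longrightarrow> inner_point p j \<Longrightarrow> inner_point q j \<Longrightarrow>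
      (\<Sum>k=p..q. vertex_cofactor c k j * xpow k) = 0"
    and ker_v: "\<And>p q i. tr.run p q i \<Longrightarrow> inner_point i p \<Longrightarrow> inner_point i q \<Longrightarrow>
      (\<Sum>k=p..q. vertex_cofactor c i k * ypow k) = 0"
    and "covered i0 j0"
  shows "\<exists>f. param_spline i0 j0 a ah av c f"
proof -
  have w0: "vertex_cofactor c i j * xpow i = 0" if "\<not> (inner_point i j \<and> vertex i j)" for i j
    using that by (auto simp: vertex_cofactor_def)
  have w0': "vertex_cofactor c i j * ypow j = 0" if "\<not> (tr.inner_point j i \<and> tr.vertex j i)" for j i
    using that by (auto simp: vertex_cofactor_def tr_inner tr_vertex)
  have ker_v': "(\<Sum>k=p..q. vertex_cofactor c i k * ypow k) = 0"
    if "tr.run p q i" "tr.inner_point p i" "tr.inner_point q i" for p q i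
    using ker_v[of p q i] that by (simp only: tr_inner)
  have B_zero: "0 \<in> {p. bidegree_le k l p}"
    and B_add: "\<And>p q. p \<in> {p. bidegree_le k l p} \<Longrightarrow> q \<in> {p. bidegree_le k l p} \<Longrightarrow> p + q \<in> {p. bidegree_le k l p}"
    and B_minus: "\<And>p. p \<in> {p. bidegree_le k l p} \<Longrightarrow> - p \<in> {p. bidegree_le k l p}" for k l
    by (simp_all add: bidegree_le_add bidegree_le_minus)
  have wB: "vertex_cofactor c i j * xpow i \<in> {p. bidegree_le d1 (d2 - \<beta> - 1) p}" for i j
    using bidegree_le_row_jump by blast
  have sB: "row_start ah p q j \<in> {p. bidegree_le d1 (d2 - \<beta> - 1) p}" for p q j
    using bidegree_le_cofactor_poly[of "d1 + 1" "d2 - \<beta>"] by (simp add: row_start_def)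
  have wB': "vertex_cofactor c i j * ypow j \<in> {p. bidegree_le (d1 - \<alpha> - 1) d2 p}" for j i
    using bidegree_le_column_jump by blast
  have sB': "column_start av p q j \<in> {p. bidegree_le (d1 - \<alpha> - 1) d2 p}" for p q j
    using bidegree_le_cofactor_poly[of "d1 - \<alpha>" "d2 + 1"] by (simp add: column_start_def)
  obtain h where h: "\<And>i j. \<not> active i j \<Longrightarrow> h i j = 0"
    "\<And>i j. inner_point i j \<Longrightarrow> h i j - h (i - 1) j = vertex_cofactor c i j * xpow i"
    "\<And>p q j. run p q j \<Longrightarrow> \<not> inner_point p j \<Longrightarrow> \<not> inner_point q j \<Longrightarrow> h p j = row_start ah p q j"
    "\<And>i j. h i j \<in> {p. bidegree_le d1 (d2 - \<beta> - 1) p}"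
    by (rule row_integration[where w = "\<lambda>i j. vertex_cofactor c i j * xpow i"
        and s = "row_start ah" and B = "{p. bidegree_le d1 (d2 - \<beta> - 1) p}", OF w0 ker_h B_zero B_add B_minus wB sB];
        (assumption | (rule that; assumption)))
  obtain v where v: "\<And>j i. \<not> tr.active j i \<Longrightarrow> v j i = 0"
    "\<And>j i. tr.inner_point j i \<Longrightarrow> v j i - v (j - 1) i = vertex_cofactor c i j * ypow j"
    "\<And>p q i. tr.run p q i \<Longrightarrow> \<not> tr.inner_point p i \<Longrightarrow> \<not> tr.inner_point q i \<Longrightarrow> v p i = column_start av p q i"
    "\<And>j i. v j i \<in> {p. bidegree_le (d1 - \<alpha> - 1) d2 p}"
    by (rule tr.row_integration[where w = "\<lambda>j i. vertex_cofactor c i j * ypow j"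
        and s = "column_start av" and B = "{p. bidegree_le (d1 - \<alpha> - 1) d2 p}", OF w0' ker_v' B_zero B_add B_minus wB' sB'];
        (assumption | (rule that; assumption)))
  define H where "H i j = h i j * ypow j" for i j
  \<comment> \<open>Integration in \<open>tr\<close> yields \<open>v\<close> with transposed
    indices. \<open>H\<close> and \<open>V\<close> are the full jumps; their differences at an inner
    point are both the vertex cofactor times \<open>xpow i * ypow j\<close>.\<close>
  define V where "V i j = v j i * xpow i" for i j
  obtain M1 where M1: "\<And>i j. active i j \<Longrightarrow> i < M1 \<and> j < M1" using active_bound by blast
  obtain M2 where M2: "\<And>i j. tr.active i j \<Longrightarrow> i < M2 \<and> j < M2" using tr.active_bound by blast
  have boundH: "i < max M1 M2 \<and> j < max M1 M2" if "H i j \<noteq> 0" for i j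
  proof -
    have "active i j" using that h(1)[of i j] by (auto simp: H_def)
    then show ?thesis using M1 by (simp add: less_max_iff_disj)
  qed
  have boundV: "i < max M1 M2 \<and> j < max M1 M2" if "V i j \<noteq> 0" for i j
  proof -
    have "tr.active j i" using that v(1)[of j i] by (auto simp: V_def)
    then show ?thesis using M2[of j i] by (simp add: less_max_iff_disj)
  qed
  have curl: "H i j - H (i - 1) j = V i j - V i (j - 1)" if ij: "inner_point i j" for i j
  proof -
    have "tr.inner_point j i" using ij by (simp add: tr_inner)
    from v(2)[OF this] h(2)[OF ij] show ?thesis
      unfolding H_def V_def left_diff_distrib[symmetric] by (simp only: ac_simps)
  qed
  obtain Q where Q: "\<And>i j. covered i j \<Longrightarrow> covered i (j - 1) \<Longrightarrow> Q i j - Q i (j - 1) = H i j"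
    "\<And>i j. covered i j \<Longrightarrow> covered (i - 1) j \<Longrightarrow> Q i j - Q (i - 1) j = V i j"
    by (rule potential_exists[where h = H and v = V, OF winding_numbers[OF holes] boundH boundV curl];
        (assumption | (rule that; assumption)))
  \<comment> \<open>Adding a constant keeps all jumps; this one gives the prescribed polynomial on
    the reference box.\<close>
  define Q' where "Q' i j = Q i j - Q i0 j0 + base_poly a" for i j
  have QH: "Q' i j - Q' i (j - 1) = h i j * ypow j" if "covered i j" "covered i (j - 1)" for i j
    using Q(1)[OF that] by (simp add: Q'_def H_def)
  have QV: "Q' i j - Q' (i - 1) j = v j i * xpow i" if "covered i j" "covered (i - 1) j" for i j
    using Q(2)[OF that] by (simp add: Q'_def V_def)
  have degH: "bidegree_le d1 d2 (h i j * ypow j)" for i j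
  proof -
    have "bidegree_le (d1 + 0) (d2 - \<beta> - 1 + (\<beta> + 1)) (h i j * ypow j)"
      by (intro bidegree_le_mult bidegree_le_Y_minus_power) (use h(4) in blast)
    then show ?thesis using \<beta> by (simp del: power_Suc)
  qed
  have degV: "bidegree_le d1 d2 (v j i * xpow i)" for i j
  proof -
    have "bidegree_le (d1 - \<alpha> - 1 + (\<alpha> + 1)) (d2 + 0) (v j i * xpow i)"
      by (intro bidegree_le_mult bidegree_le_X_minus_power) (use v(4) in blast)
    then show ?thesis using \<alpha> by (simp del: power_Suc)
  qed
  \<comment> \<open>\<open>potential_exists\<close> gives no degree bound. The bound holds on the
    reference box and crosses every side, because the jumps have bounded bidegree; connectedness
    then spreads it.\<close>
  have deg_iff: "bidegree_le d1 d2 p = bidegree_le d1 d2 q" if "bidegree_le d1 d2 (p - q)" for p q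
    using bidegree_le_diff[OF _ that, of p] bidegree_le_add[OF _ that, of q] by auto
  have deg: "bidegree_le d1 d2 (Q' i j)" if "covered i j" for i j
  proof -
    have "bidegree_le d1 d2 (Q' i j) = bidegree_le d1 d2 (Q' i0 j0)"
    proof (rule covered_connected[OF reg _ that assms(3)])
      show "connected (domain T)" using holes by (simp add: without_holes_def)
      show "bidegree_le d1 d2 (Q' i j) = bidegree_le d1 d2 (Q' i (j - 1))" if "covered i j" "covered i (j - 1)" for i j
        by (rule deg_iff) (use degH QH[OF that] in metis)
      show "bidegree_le d1 d2 (Q' i j) = bidegree_le d1 d2 (Q' (i - 1) j)" if "covered i j" "covered (i - 1) j" for i j
        by (rule deg_iff) (use degV QV[OF that] in metis)
    qed
    moreover have "bidegree_le d1 d2 (Q' i0 j0)"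
      using bidegree_le_cofactor_poly[of "d1 + 1" "d2 + 1"] by (simp add: Q'_def base_poly_def)
    ultimately show ?thesis by simp
  qed
  obtain f where f: "grid_spline Q' h (\<lambda>i j. v j i) f"
    using grid_spline_from_pieces[of Q' h "\<lambda>i j. v j i", OF deg QH QV h(1) v(1)] by blast
  have "param_spline i0 j0 a ah av c f"
    by (rule param_splineI[OF f]) (use h v in \<open>simp_all add: tr_inner Q'_def del: power_Suc One_nat_def\<close>)
  then show ?thesis by blast
qed

text \<open>If the horizontal line is active next to such a point, one cell lies above it and one
  below, so no vertical segment is active there and \<open>v\<close> is 0; otherwise
  \<open>h\<close> is 0. The curl identity then removes the other jump.\<close>

lemma nonvertex_jumps:
  assumes "grid_spline Q h v f" "inner_point i j" "\<not> vertex i j"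
  shows "h i j - h (i - 1) j = 0" "v i j - v i (j - 1) = 0"
proof -
  note curl = grid_spline_curl[OF assms(1,2)]
  have pos: "1 \<le> i" using inner_pos[OF assms(2)] by simp
  have "h i j - h (i - 1) j = 0 \<or> v i j - v i (j - 1) = 0"
  proof (cases "active i j \<or> active (i - 1) j")
    case True
    obtain F G where FG: "covers F i j" "covers F (i - 1) j" "covers G i (j - 1)" "covers G (i - 1) (j - 1)" "F \<noteq> G"
      by (rule active_not_vertex[OF True assms(3) pos])
    have "\<not> tr.active j i" "\<not> tr.active (j - 1) i"
      using FG covers_unique unfolding tr.active_def tr_covers by blast+
    then show ?thesis using grid_splineD(7)[OF assms(1)] by simp
  next
    case False
    then have "\<not> active i j" "\<not> active (i - 1) j" by auto
    then have "h i j = 0" "h (i - 1) j = 0" by (auto intro: grid_splineD(6)[OF assms(1)])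
    then show ?thesis by simp
  qed
  then have "(h i j - h (i - 1) j = 0) \<and> (v i j - v i (j - 1) = 0)"
    using curl X_minus_power_neq_0 Y_minus_power_neq_0 by (metis mult_eq_0_iff)
  then show "h i j - h (i - 1) j = 0" "v i j - v i (j - 1) = 0" by blast+
qed

lemma vertex_cofactor_without_free:
  assumes "xf \<in> supported_on (free_vertices T \<times> K)" "(x i, y j) \<notin> free_vertices T"
  shows "vertex_cofactor (xf + xk) i j = vertex_cofactor xk i j"
proof -
  have "xf ((x i, y j), p, q) = 0" for p q
    using assms unfolding supported_on_def by blast
  then show ?thesis by (simp add: vertex_cofactor_def)
qed

text \<open>The quotient from \<open>common_cofactor\<close> inherits its bidegree from the
  horizontal jump and can therefore be expanded. At points that are no vertices both jumps vanish,
  in agreement with \<open>vertex_cofactor\<close>.\<close>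

lemma grid_spline_cofactors:
  assumes "grid_spline Q h v f"
  obtains c where "c \<in> supported_on (interior_vertices T \<times> {..<d1 - \<alpha>} \<times> {..<d2 - \<beta>})"
    "\<And>i j. inner_point i j \<Longrightarrow> h i j - h (i - 1) j = vertex_cofactor c i j * xpow i"
    "\<And>i j. inner_point i j \<Longrightarrow> v i j - v i (j - 1) = vertex_cofactor c i j * ypow j"
proof -
  have "\<exists>g. inner_point i j \<longrightarrow>
      h i j - h (i - 1) j = cofactor_poly (x i) (y j) (d1 - \<alpha>) (d2 - \<beta>) g * xpow i \<and>
      v i j - v i (j - 1) = cofactor_poly (x i) (y j) (d1 - \<alpha>) (d2 - \<beta>) g * ypow j" for i j
  proof (cases "inner_point i j")
    case True
    obtain D where D: "h i j - h (i - 1) j = D * xpow i"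
      "v i j - v i (j - 1) = D * ypow j"
      by (rule common_cofactor[OF grid_spline_curl[OF assms True]])
    have "bidegree_le d1 (d2 - \<beta> - 1) (D * xpow i)"
      unfolding D(1)[symmetric] by (intro bidegree_le_diff grid_spline_bidegree[OF assms])
    then have "bidegree_le (d1 - (\<alpha> + 1)) (d2 - \<beta> - 1) D"
      by (rule bidegree_le_X_minus_cancel) (use \<alpha> in simp)
    then have "bidegree_le (d1 - \<alpha> - 1) (d2 - \<beta> - 1) D" by simp
    then obtain g where "D = cofactor_poly (x i) (y j) (d1 - \<alpha>) (d2 - \<beta>) g"
      using cofactor_poly_exists[of "d1 - \<alpha>" "d2 - \<beta>" D] \<alpha> \<beta> by auto
    then show ?thesis using D by (intro exI[of _ g]) blast
  qed simp
  then obtain g where g: "\<And>i j. inner_point i j \<longrightarrow>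
      h i j - h (i - 1) j = cofactor_poly (x i) (y j) (d1 - \<alpha>) (d2 - \<beta>) (g i j) * xpow i \<and>
      v i j - v i (j - 1) = cofactor_poly (x i) (y j) (d1 - \<alpha>) (d2 - \<beta>) (g i j) * ypow j"
    by metis
  \<comment> \<open>Columns are indexed by points of the plane, so the grid indices are recovered
    with \<open>inv x\<close> and \<open>inv y\<close>.\<close>
  define c where "c = (\<lambda>(w, p, q). if w \<in> interior_vertices T \<and> p < d1 - \<alpha> \<and> q < d2 - \<beta>
    then g (inv x (fst w)) (inv y (snd w)) p q else 0)"
  have inv: "inv x (x i) = i" "inv y (y j) = j" for i j
    by (rule inv_f_f, simp add: inj_def)+
  have c: "vertex_cofactor c i j = cofactor_poly (x i) (y j) (d1 - \<alpha>) (d2 - \<beta>) (g i j)" if "inner_point i j" "vertex i j" for i j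
    using that by (auto simp: vertex_cofactor_def c_def inv interior_vertices_iff intro!: cofactor_poly_cong)
  show ?thesis
  proof (rule that[of c])
    show "c \<in> supported_on (interior_vertices T \<times> {..<d1 - \<alpha>} \<times> {..<d2 - \<beta>})"
      by (auto simp: supported_on_def c_def)
    fix i j assume ij: "inner_point i j"
    show "h i j - h (i - 1) j = vertex_cofactor c i j * xpow i"
    proof (cases "vertex i j")
      case True
      then show ?thesis using g c[OF ij] ij by simp
    next
      case False
      then have "vertex_cofactor c i j = 0" by (simp add: vertex_cofactor_def)
      then show ?thesis using nonvertex_jumps(1)[OF assms ij False] by (simp only: mult_zero_left)
    qed
    show "v i j - v i (j - 1) = vertex_cofactor c i j * ypow j"
    proof (cases "vertex i j")
      case True
      then show ?thesis using g c[OF ij] ij by simp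
    next
      case False
      then have "vertex_cofactor c i j = 0" by (simp add: vertex_cofactor_def)
      then show ?thesis using nonvertex_jumps(2)[OF assms ij False] by (simp only: mult_zero_left)
    qed
  qed
qed

lemma inner_on_interior_run:
  "run p q j \<Longrightarrow> inner_point p j \<Longrightarrow> inner_point q j \<Longrightarrow> p \<le> k \<Longrightarrow> k \<le> q \<Longrightarrow> inner_point k j"
  using run_inner[of p q j k] by (cases "k = p"; cases "k = q") auto

lemma inner_on_interior_tr_run:
  "tr.run p q i \<Longrightarrow> inner_point i p \<Longrightarrow> inner_point i q \<Longrightarrow> p \<le> k \<Longrightarrow> k \<le> q \<Longrightarrow> inner_point i k"
  using tr.run_inner[of p q i k] unfolding tr_inner by (cases "k = p"; cases "k = q") auto

text \<open>The vertex cofactors are split at the free-vertices. The rest lies in the kernel because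
  along an interior l-edge the jumps telescope to the difference of two edge cofactors on inactive
  segments.\<close>

lemma param_spline_onto:
  assumes "f \<in> spline_space d1 d2 \<alpha> \<beta> T" "covered i0 j0"
  shows "\<exists>a\<in>supported_on ({..<d1 + 1} \<times> {..<d2 + 1}).
    \<exists>ah\<in>supported_on (hcross_cuts T \<times> {..<d1 + 1} \<times> {..<d2 - \<beta>}).
    \<exists>av\<in>supported_on (vcross_cuts T \<times> {..<d1 - \<alpha>} \<times> {..<d2 + 1}).
    \<exists>xf\<in>supported_on (free_vertices T \<times> {..<d1 - \<alpha>} \<times> {..<d2 - \<beta>}).
    \<exists>xk\<in>ccm_kernel d1 d2 \<alpha> \<beta> T. param_spline i0 j0 a ah av (xf + xk) f"
proof -
  obtain Q h v where G: "grid_spline Q h v f" using grid_spline_exists[OF assms(1)] by blast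
  obtain c where c: "c \<in> supported_on (interior_vertices T \<times> {..<d1 - \<alpha>} \<times> {..<d2 - \<beta>})"
    "\<And>i j. inner_point i j \<Longrightarrow> h i j - h (i - 1) j = vertex_cofactor c i j * xpow i"
    "\<And>i j. inner_point i j \<Longrightarrow> v i j - v i (j - 1) = vertex_cofactor c i j * ypow j"
    by (rule grid_spline_cofactors[OF G]) (rule that; assumption)
  define xf where "xf = (\<lambda>m. if fst m \<in> free_vertices T then c m else 0)"
  define xk where "xk = (\<lambda>m. if fst m \<in> free_vertices T then 0 else c m)"
  have sum: "xf + xk = c" by (auto simp: xf_def xk_def)
  have xf: "xf \<in> supported_on (free_vertices T \<times> {..<d1 - \<alpha>} \<times> {..<d2 - \<beta>})"
    using c(1) by (auto simp: supported_on_def xf_def)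
  have xk_supp: "xk \<in> supported_on (ccm_cols d1 d2 \<alpha> \<beta> T)"
    using c(1) by (auto simp: supported_on_def xk_def ccm_cols_def)
  have "xk \<in> ccm_kernel d1 d2 \<alpha> \<beta> T"
    unfolding ccm_kernel_iff
  proof (intro conjI xk_supp allI impI; elim conjE)
    fix p q j assume r: "run p q j" "inner_point p j" "inner_point q j"
    have pq: "1 \<le> p" "p \<le> q" using run_pos[OF r(1)] r(1) by (auto simp: run_def)
    have "(\<Sum>k=p..q. vertex_cofactor xk k j * xpow k) = (\<Sum>k=p..q. h k j - h (k - 1) j)"
    proof (rule sum.cong[OF refl])
      fix k assume k: "k \<in> {p..q}"
      then have "(x k, y j) \<notin> free_vertices T" using free_vertex_not_on_interior_row[OF r] by simp
      from vertex_cofactor_without_free[OF xf this, of xk]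
      have "vertex_cofactor xk k j = vertex_cofactor c k j" by (simp add: sum)
      then show "vertex_cofactor xk k j * xpow k = h k j - h (k - 1) j"
        using c(2) inner_on_interior_run[OF r, of k] k by simp
    qed
    also have "\<dots> = h q j - h (p - 1) j" by (rule sum_jumps[OF pq])
    also have "\<dots> = 0" using r(1) grid_splineD(6)[OF G] by (simp add: run_def)
    finally show "(\<Sum>k=p..q. vertex_cofactor xk k j * xpow k) = 0" .
  next
    fix p q i assume r: "tr.run p q i" "inner_point i p" "inner_point i q"
    have pq: "1 \<le> p" "p \<le> q" using tr.run_pos[OF r(1)] r(1) by (auto simp: tr.run_def)
    have "(\<Sum>k=p..q. vertex_cofactor xk i k * ypow k) = (\<Sum>k=p..q. v i k - v i (k - 1))"
    proof (rule sum.cong[OF refl])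
      fix k assume k: "k \<in> {p..q}"
      then have "(x i, y k) \<notin> free_vertices T" using free_vertex_not_on_interior_column[OF r] by simp
      from vertex_cofactor_without_free[OF xf this, of xk]
      have "vertex_cofactor xk i k = vertex_cofactor c i k" by (simp add: sum)
      then show "vertex_cofactor xk i k * ypow k = v i k - v i (k - 1)"
        using c(3) inner_on_interior_tr_run[OF r, of k] k by simp
    qed
    also have "\<dots> = v i q - v i (p - 1)" by (rule sum_jumps[OF pq])
    also have "\<dots> = 0" using r(1) grid_splineD(7)[OF G] by (simp add: tr.run_def)
    finally show "(\<Sum>k=p..q. vertex_cofactor xk i k * ypow k) = 0" .
  qed
  moreover obtain a where "a \<in> supported_on ({..<d1 + 1} \<times> {..<d2 + 1})" "Q i0 j0 = base_poly a"
  proof -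
    obtain g where "Q i0 j0 = cofactor_poly 0 0 (d1 + 1) (d2 + 1) g"
      using cofactor_poly_exists[of "d1 + 1" "d2 + 1" "Q i0 j0" 0 0] grid_splineD(2)[OF G assms(2)] by auto
    then have "Q i0 j0 = base_poly (\<lambda>(k, l). if k < d1 + 1 \<and> l < d2 + 1 then g k l else 0)"
      unfolding base_poly_def by (auto intro: cofactor_poly_cong)
    then show ?thesis by (rule that[rotated]) (auto simp: supported_on_def)
  qed
  moreover obtain ah where "ah \<in> supported_on (hcross_cuts T \<times> {..<d1 + 1} \<times> {..<d2 - \<beta>})"
    "\<forall>p q j. run p q j \<longrightarrow> \<not> inner_point p j \<longrightarrow> \<not> inner_point q j \<longrightarrow> h p j = row_start ah p q j"
  proof -
    \<comment> \<open>A segment determines its run, so the coefficients of the initial cofactor can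
      be indexed by the point set.\<close>
    have "\<exists>g. \<forall>p q j. e = seg p q j \<longrightarrow> run p q j \<longrightarrow> h p j = cofactor_poly 0 0 (d1 + 1) (d2 - \<beta>) g" for e
    proof (cases "\<exists>p q j. e = seg p q j \<and> run p q j")
      case True
      then obtain p q j where e: "e = seg p q j" "run p q j" by blast
      obtain g where g: "h p j = cofactor_poly 0 0 (d1 + 1) (d2 - \<beta>) g"
        using cofactor_poly_exists[of "d1 + 1" "d2 - \<beta>" "h p j" 0 0] grid_spline_bidegree(1)[OF G] \<beta> by auto
      have "p' = p \<and> j' = j" if "e = seg p' q' j'" "run p' q' j'" for p' q' j'
        using that e seg_eq[of p q p' q' j j'] by (auto simp: run_def)
      then show ?thesis using g by blast
    qed blast
    then obtain g where g: "\<And>e p q j. e = seg p q j \<longrightarrow> run p q j \<longrightarrow> h p j = cofactor_poly 0 0 (d1 + 1) (d2 - \<beta>) (g e)"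
      by metis
    define ah where "ah = (\<lambda>(e, k, l). if e \<in> hcross_cuts T \<and> k < d1 + 1 \<and> l < d2 - \<beta> then g e k l else 0)"
    have "h p j = row_start ah p q j" if r: "run p q j" "\<not> inner_point p j" "\<not> inner_point q j" for p q j
      using g[of "seg p q j" p q j] r cross_cutI[OF r] unfolding row_start_def ah_def
      by (auto intro: cofactor_poly_cong)
    then show ?thesis by (intro that[of ah]) (auto simp: ah_def supported_on_def)
  qed
  moreover obtain av where "av \<in> supported_on (vcross_cuts T \<times> {..<d1 - \<alpha>} \<times> {..<d2 + 1})"
    "\<forall>p q i. tr.run p q i \<longrightarrow> \<not> inner_point i p \<longrightarrow> \<not> inner_point i q \<longrightarrow> v i p = column_start av p q i"
  proof -
    have "\<exists>g. \<forall>p q i. e = vseg p q i \<longrightarrow> tr.run p q i \<longrightarrow> v i p = cofactor_poly 0 0 (d1 - \<alpha>) (d2 + 1) g" for e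
    proof (cases "\<exists>p q i. e = vseg p q i \<and> tr.run p q i")
      case True
      then obtain p q i where e: "e = vseg p q i" "tr.run p q i" by blast
      obtain g where g: "v i p = cofactor_poly 0 0 (d1 - \<alpha>) (d2 + 1) g"
        using cofactor_poly_exists[of "d1 - \<alpha>" "d2 + 1" "v i p" 0 0] grid_spline_bidegree(2)[OF G] \<alpha> by auto
      have "p' = p \<and> i' = i" if "e = vseg p' q' i'" "tr.run p' q' i'" for p' q' i'
        using that e vseg_eq[of p q p' q' i i'] by (auto simp: tr.run_def)
      then show ?thesis using g by blast
    qed blast
    then obtain g where g: "\<And>e p q i. e = vseg p q i \<longrightarrow> tr.run p q i \<longrightarrow> v i p = cofactor_poly 0 0 (d1 - \<alpha>) (d2 + 1) (g e)"
      by metis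
    define av where "av = (\<lambda>(e, k, l). if e \<in> vcross_cuts T \<and> k < d1 - \<alpha> \<and> l < d2 + 1 then g e k l else 0)"
    have "v i p = column_start av p q i" if r: "tr.run p q i" "\<not> inner_point i p" "\<not> inner_point i q" for p q i
      using g[of "vseg p q i" p q i] r vcross_cutI[OF r] unfolding column_start_def av_def
      by (auto intro: cofactor_poly_cong)
    then show ?thesis by (intro that[of av]) (auto simp: av_def supported_on_def)
  qed
  moreover have "param_spline i0 j0 a ah av (xf + xk) f"
    unfolding sum by (rule param_splineI[OF G c(2,3)]) (use calculation in blast)+
  ultimately show ?thesis using xf by blast
qed

end

subsection \<open>The dimension formula\<close>

text \<open>The set is enumerated in increasing order and continued beyond its maximum. Indices
  start at 1 because row and column 0 of the grid are to stay empty.\<close>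

lemma finite_set_in_sequence:
  fixes S :: "real set"
  assumes "finite S"
  obtains u :: "nat \<Rightarrow> real" where "strict_mono u" "S \<subseteq> u ` {1..}"
proof -
  have "\<exists>(u :: nat \<Rightarrow> real) m. strict_mono u \<and> S = u ` {1..m}"
    using assms
  proof (induction rule: finite_linorder_max_induct)
    case empty
    show ?case by (rule exI[of _ real], rule exI[of _ 0]) (simp add: strict_mono_def)
  next
    case (insert b S)
    then obtain u :: "nat \<Rightarrow> real" and m where u: "strict_mono u" "S = u ` {1..m}" by blast
    show ?case
    proof (cases "m = 0")
      case True
      then show ?thesis
        using u by (intro exI[of _ "\<lambda>i. b + real i - 1"] exI[of _ 1]) (auto simp: strict_mono_def)
    next
      case False
      \<comment> \<open>The constant is chosen so that \<open>v (Suc m) = b\<close>; from there on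
        the steps are 1.\<close>
      define v where "v i = (if i \<le> m then u i else b + real i - real (Suc m))" for i
      have um: "u m < b" using insert.hyps u(2) False by auto
      have "strict_mono v"
      proof (rule strict_mono_Suc_iff[THEN iffD2], rule allI)
        fix i
        show "v i < v (Suc i)"
        proof (cases "Suc i \<le> m")
          case True
          then show ?thesis using u(1) by (simp add: v_def strict_mono_Suc_iff)
        next
          case False
          then show ?thesis using um by (cases "i = m") (auto simp: v_def)
        qed
      qed
      moreover have "insert b S = v ` {1..Suc m}"
      proof -
        have "v ` {1..Suc m} = insert (v (Suc m)) (v ` {1..m})"
          by (simp add: atLeastAtMostSuc_conv)
        also have "v ` {1..m} = u ` {1..m}" by (rule image_cong) (auto simp: v_def)
        finally show ?thesis using u(2) by (simp add: v_def)
      qed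
      ultimately show ?thesis by blast
    qed
  qed
  then obtain u :: "nat \<Rightarrow> real" and m where "strict_mono u" "S = u ` {1..m}" by blast
  then show ?thesis by (intro that[of u]) auto
qed

lemma spline_mesh_exists:
  assumes "t_mesh T" "regular T" "without_holes T" "\<alpha> < d1" "\<beta> < d2"
  obtains x y where "spline_mesh T x y d1 d2 \<alpha> \<beta>"
proof -
  have fin: "finite (vertices T)"
    using assms(1) by (auto simp: t_mesh_def vertices_def corners_def)
  obtain x :: "nat \<Rightarrow> real" where x: "strict_mono x" "fst ` vertices T \<subseteq> x ` {1..}"
    by (rule finite_set_in_sequence[OF finite_imageI[OF fin, of fst]])
  obtain y :: "nat \<Rightarrow> real" where y: "strict_mono y" "snd ` vertices T \<subseteq> y ` {1..}"
    by (rule finite_set_in_sequence[OF finite_imageI[OF fin, of snd]])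
  have "spline_mesh T x y d1 d2 \<alpha> \<beta>"
  proof
    fix F assume "F \<in> T"
    then have "fst F \<in> vertices T" "snd F \<in> vertices T"
      by (auto simp: vertices_def corners_def mem_Times_iff)
    then have "fst (fst F) \<in> fst ` vertices T" "fst (snd F) \<in> fst ` vertices T"
      "snd (fst F) \<in> snd ` vertices T" "snd (snd F) \<in> snd ` vertices T" by simp_all
    then show "fst (fst F) \<in> x ` {1..} \<and> fst (snd F) \<in> x ` {1..} \<and> snd (fst F) \<in> y ` {1..} \<and> snd (snd F) \<in> y ` {1..}"
      using x(2) y(2) by blast
  qed (use assms x(1) y(1) in auto)
  then show ?thesis by (rule that)
qed

context spline_mesh
begin

text \<open>Splines correspond linearly and bijectively to the five parameter blocks, whose
  dimensions are the five summands.\<close>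

lemma dim_spline_space:
  "dim (spline_space d1 d2 \<alpha> \<beta> T) =
     (d1 + 1) * (d2 + 1) + card (hcross_cuts T) * (d1 + 1) * (d2 - \<beta>)
     + card (vcross_cuts T) * (d2 + 1) * (d1 - \<alpha>)
     + card (free_vertices T) * (d1 - \<alpha>) * (d2 - \<beta>) + dim (ccm_kernel d1 d2 \<alpha> \<beta> T)"
proof -
  let ?A = "supported_on ({..<d1 + 1} \<times> {..<d2 + 1}) :: (nat \<times> nat \<Rightarrow> real) set"
  let ?H = "supported_on (hcross_cuts T \<times> {..<d1 + 1} \<times> {..<d2 - \<beta>})"
  let ?V = "supported_on (vcross_cuts T \<times> {..<d1 - \<alpha>} \<times> {..<d2 + 1})"
  let ?F = "supported_on (free_vertices T \<times> {..<d1 - \<alpha>} \<times> {..<d2 - \<beta>})"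
  let ?K = "ccm_kernel d1 d2 \<alpha> \<beta> T"
  let ?P = "?A \<times> ?H \<times> ?V \<times> ?F \<times> ?K"
  have K: "subspace ?K" unfolding ccm_kernel_def by (rule subspace_matrix_kernel)
  note S = subspace_supported_on
  have sub: "subspace (?F \<times> ?K)" "subspace (?V \<times> ?F \<times> ?K)" "subspace (?H \<times> ?V \<times> ?F \<times> ?K)" "subspace ?P"
    by (intro subspace_Times S K)+
  have K_supp: "?K \<subseteq> supported_on (ccm_cols d1 d2 \<alpha> \<beta> T)" by (rule subsetI, drule ccm_kernel_iff[THEN iffD1], erule conjunct1)
  with finite_ccm_cols have spK: "\<exists>U. finite U \<and> ?K \<subseteq> span U"
    using finite_span_supported_on[OF finite_ccm_cols] by blast
  have spA: "\<exists>U. finite U \<and> ?A \<subseteq> span U" and spH: "\<exists>U. finite U \<and> ?H \<subseteq> span U"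
    and spV: "\<exists>U. finite U \<and> ?V \<subseteq> span U" and spF: "\<exists>U. finite U \<and> ?F \<subseteq> span U"
    by (intro finite_span_supported_on finite_SigmaI finite_cross_cuts finite_vcross_cuts finite_free_vertices; simp)+
  have sp: "\<exists>U. finite U \<and> ?F \<times> ?K \<subseteq> span U" "\<exists>U. finite U \<and> ?V \<times> ?F \<times> ?K \<subseteq> span U"
    "\<exists>U. finite U \<and> ?H \<times> ?V \<times> ?F \<times> ?K \<subseteq> span U"
    by (intro finite_span_Times spH spV spF spK)+
  have "dim ?P = dim ?A + (dim ?H + (dim ?V + (dim ?F + dim ?K)))"
    by (simp only: dim_subspace_Times[OF S sub(3) spA sp(3)] dim_subspace_Times[OF S sub(2) spH sp(2)]
        dim_subspace_Times[OF S sub(1) spV sp(1)] dim_subspace_Times[OF S K spF spK])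
  moreover have "dim ?A = (d1 + 1) * (d2 + 1)" "dim ?H = card (hcross_cuts T) * ((d1 + 1) * (d2 - \<beta>))"
    "dim ?V = card (vcross_cuts T) * ((d1 - \<alpha>) * (d2 + 1))"
    "dim ?F = card (free_vertices T) * ((d1 - \<alpha>) * (d2 - \<beta>))"
    by (simp_all add: dim_supported_on finite_cross_cuts finite_vcross_cuts finite_free_vertices card_cartesian_product)
  moreover have "dim (spline_space d1 d2 \<alpha> \<beta> T) = dim ?P"
  proof -
    obtain F where "F \<in> T" using T_nonempty by blast
    then have "covers F (lf F) (lw F)" using index_bounds by (simp add: covers_def)
    then obtain i0 j0 where c: "covered i0 j0" unfolding covered_def by blast
    \<comment> \<open>The last two blocks enter only through their sum; they can be separated again
      since \<open>xf\<close> lives on the free-vertices and \<open>xk\<close> on the other interior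
      vertices.\<close>
    define R where "R = (\<lambda>(a, ah, av, xf, xk). param_spline i0 j0 a ah av (xf + xk))"
    show ?thesis
    proof (rule dim_linear_relation[of ?P R])
      show "subspace ?P" by (rule sub(4))
      show "\<exists>f. R z f" if "z \<in> ?P" for z
      proof -
        obtain a ah av xf xk where z: "z = (a, ah, av, xf, xk)" "xf \<in> ?F" "xk \<in> ?K" using \<open>z \<in> ?P\<close> by auto
        note k = z(3)[unfolded ccm_kernel_iff]
        have "\<exists>f. param_spline i0 j0 a ah av (xf + xk) f"
        proof (rule param_spline_exists[OF _ _ c])
          fix p q j assume r: "run p q j" "inner_point p j" "inner_point q j"
          \<comment> \<open>The part \<open>xf\<close> is invisible on interior l-edges, so the
            kernel conditions on \<open>xk\<close> suffice.\<close>
          have "(\<Sum>k=p..q. vertex_cofactor (xf + xk) k j * xpow k) =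
              (\<Sum>k=p..q. vertex_cofactor xk k j * xpow k)"
            by (rule sum.cong[OF refl])
              (simp only: atLeastAtMost_iff vertex_cofactor_without_free[OF z(2) free_vertex_not_on_interior_row[OF r]])
          then show "(\<Sum>k=p..q. vertex_cofactor (xf + xk) k j * xpow k) = 0"
            using k r by simp
        next
          fix p q i assume r: "tr.run p q i" "inner_point i p" "inner_point i q"
          have "(\<Sum>k=p..q. vertex_cofactor (xf + xk) i k * ypow k) =
              (\<Sum>k=p..q. vertex_cofactor xk i k * ypow k)"
            by (rule sum.cong[OF refl])
              (simp only: atLeastAtMost_iff vertex_cofactor_without_free[OF z(2) free_vertex_not_on_interior_column[OF r]])
          then show "(\<Sum>k=p..q. vertex_cofactor (xf + xk) i k * ypow k) = 0"
            using k r by simp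
        qed
        then show ?thesis by (simp add: R_def z(1))
      qed
      show "\<exists>z\<in>?P. R z f" if fS: "f \<in> spline_space d1 d2 \<alpha> \<beta> T" for f
      proof -
        obtain a ah av xf xk where "a \<in> ?A" "ah \<in> ?H" "av \<in> ?V" "xf \<in> ?F" "xk \<in> ?K"
          "param_spline i0 j0 a ah av (xf + xk) f"
          using param_spline_onto[OF fS c] by (elim bexE) (rule that)
        then show ?thesis by (intro bexI[of _ "(a, ah, av, xf, xk)"]) (simp_all add: R_def)
      qed
      show "f \<in> spline_space d1 d2 \<alpha> \<beta> T" if "R z f" for z f
        using that param_spline_in_spline_space by (auto simp: R_def)
      show "R (z + z') (f + f')" if zf: "R z f" "R z' f'" for z f z' f'
      proof -
        obtain a ah av xf xk where z: "z = (a, ah, av, xf, xk)" by (cases z)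
        obtain a' ah' av' xf' xk' where z': "z' = (a', ah', av', xf', xk')" by (cases z')
        have "param_spline i0 j0 (a + a') (ah + ah') (av + av') ((xf + xk) + (xf' + xk')) (f + f')"
          by (rule param_spline_add) (use zf in \<open>simp_all add: R_def z z'\<close>)
        moreover have "(xf + xk) + (xf' + xk') = (xf + xf') + (xk + xk')" by (simp only: ac_simps)
        ultimately show ?thesis by (simp add: R_def z z')
      qed
      show "R (r *\<^sub>R z) (r *\<^sub>R f)" if zf: "R z f" for r z f
      proof -
        obtain a ah av xf xk where z: "z = (a, ah, av, xf, xk)" by (cases z)
        have "param_spline i0 j0 (r *\<^sub>R a) (r *\<^sub>R ah) (r *\<^sub>R av) (r *\<^sub>R (xf + xk)) (r *\<^sub>R f)"
          by (rule param_spline_scale) (use zf in \<open>simp add: R_def z\<close>)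
        then show ?thesis by (simp add: R_def z scaleR_add_right)
      qed
      show "f = 0" if "R 0 f" for f
        using that param_spline_right_zero[OF _ c] by (simp add: R_def zero_prod_def)
      show "z = 0" if zP: "z \<in> ?P" and zR: "R z 0" for z
      proof -
        obtain a ah av xf xk where z: "z = (a, ah, av, xf, xk)" by (cases z)
        have mem: "a \<in> ?A" "ah \<in> ?H" "av \<in> ?V" "xf \<in> ?F" "xk \<in> supported_on (ccm_cols d1 d2 \<alpha> \<beta> T)"
          using zP K_supp unfolding z by blast+
        have ps: "param_spline i0 j0 a ah av (xf + xk) 0" using zR by (simp add: R_def z)
        note zero = param_spline_left_zero[OF ps c]
        have "a (k, l) = 0" for k l using mem(1) zero(1)[of k l]
          by (cases "k < d1 + 1 \<and> l < d2 + 1") (auto simp: supported_on_def)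
        moreover have "ah (e, k, l) = 0" for e k l using mem(2) zero(2)[of e k l]
          by (cases "e \<in> hcross_cuts T \<and> k < d1 + 1 \<and> l < d2 - \<beta>") (auto simp: supported_on_def)
        moreover have "av (e, k, l) = 0" for e k l using mem(3) zero(3)[of e k l]
          by (cases "e \<in> vcross_cuts T \<and> k < d1 - \<alpha> \<and> l < d2 + 1") (auto simp: supported_on_def)
        moreover have "xf m = 0 \<and> xk m = 0" for m
        proof -
          obtain w k l where m: "m = (w, k, l)" by (cases m)
          have f0: "w \<notin> free_vertices T \<or> \<not> k < d1 - \<alpha> \<or> \<not> l < d2 - \<beta> \<Longrightarrow> xf m = 0"
            by (rule supported_onD[OF mem(4)]) (auto simp: m)
          have k0: "w \<notin> interior_vertices T \<or> w \<in> free_vertices T \<or> \<not> k < d1 - \<alpha> \<or> \<not> l < d2 - \<beta> \<Longrightarrow> xk m = 0"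
            by (rule supported_onD[OF mem(5)]) (auto simp: m ccm_cols_def)
          have "w \<in> free_vertices T \<Longrightarrow> w \<in> interior_vertices T" by (simp add: free_vertices_def)
          moreover have "w \<in> interior_vertices T \<Longrightarrow> k < d1 - \<alpha> \<Longrightarrow> l < d2 - \<beta> \<Longrightarrow> xf m + xk m = 0"
            using zero(4)[of w k l] m by simp
          ultimately show ?thesis using f0 k0
            by (cases "w \<in> interior_vertices T \<and> k < d1 - \<alpha> \<and> l < d2 - \<beta>"; cases "w \<in> free_vertices T") auto
        qed
        ultimately show ?thesis by (simp add: z zero_prod_def fun_eq_iff)
      qed
    qed
  qed
  ultimately show ?thesis by (simp only: ac_simps)
qed

end

theorem theorem3p3:
  fixes d1 d2 \<alpha> \<beta> :: nat and T :: "cell set"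
  assumes "\<alpha> < d1" and "\<beta> < d2"
    and "t_mesh T" and "regular T" and "without_holes T"
    and "no_vanished_l_edges d1 d2 \<alpha> \<beta> T"
  shows "dim (spline_space d1 d2 \<alpha> \<beta> T) =
           (d1 + 1) * (d2 + 1)
           + card (hcross_cuts T) * (d1 + 1) * (d2 - \<beta>)
           + card (vcross_cuts T) * (d2 + 1) * (d1 - \<alpha>)
           + card (free_vertices T) * (d1 - \<alpha>) * (d2 - \<beta>)
           + dim (ccm_kernel d1 d2 \<alpha> \<beta> T)"
proof -
  obtain x y where "spline_mesh T x y d1 d2 \<alpha> \<beta>"
    using spline_mesh_exists[OF assms(3-5,1,2)] .
  then show ?thesis by (rule spline_mesh.dim_spline_space)
qed

end
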